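(* Let $1\le p<\infty$, let $q$ be the dual exponent of $p$ (i.e. $1/p+1/q=1$), and let $\mu=(\mu_0,\dots,\mu_k)$ be a $p$-admissible vector measure in $\mathbb{R}$, with $\Delta:=\bigcup_{j=0}^k\operatorname{supp}(\mu_j)$. Consider the canonical map $J:\prod_{j=0}^kL^q(\Delta,\mu_j)\to(W^{k,p}(\Delta,\mu))'$ defined by $$\big(J(v)\big)(f)=(Pf,v)=\sum_{j=0}^k\int_\Delta f^{(j)}\,v_j\,d\mu_j,\qquad f\in W^{k,p}(\Delta,\mu),\ v=(v_0,\dots,v_k).$$ Then for every $T\in(W^{k,p}(\Delta,\mu))'$ there exists $v\in\prod_{j=0}^kL^q(\Delta,\mu_j)$ with $$T=J(v)\qquad\text{and}\qquad \|T\|_{(W^{k,p}(\Delta,\mu))'}=\|v\|_{\prod_{j=0}^kL^q(\Delta,\mu_j)}.$$ Furthermore, if $1<p<\infty$, then there exists a unique $v\in\prod_{j=0}^kL^q(\Delta,\mu_j)$ satisfying both of these equalities.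
   Context: Throughout, $1\le p<\infty$ and $\mu=(\mu_0,\dots,\mu_k)$ is a vector of $\sigma$-finite (nonnegative) measures on $\mathbb{R}$, with Lebesgue decomposition $d\mu_j=d(\mu_j)_s+w_j\,dx$, where $(\mu_j)_s$ is singular with respect to Lebesgue measure and $w_j\ge0$ is Lebesgue measurable. $\chi_A$ is the characteristic function of $A$. $X'$ denotes the (continuous) dual of a normed space $X$ with its usual operator norm. Class $B_p$. For a set $A$ that is a union of intervals in $\mathbb{R}$, a weight $w$ on $A$ belongs to $B_p(A)$ if $w^{-1}\in L^{1/(p-1)}_{loc}(A)$, i.e. $w^{-1}\in L^{1/(p-1)}$ on every compact subset of $A$ (for $p=1$, $1/(p-1)=\infty$). Sets $\Omega_j$. For $0\le j\le k$, $\Omega_j:=\{x\in\mathbb{R}:\ \text{there is an open neighbourhood } V \text{ of } x \text{ with } w_j\in B_p(V)\}$. Muckenhoupt constants. For measures $\sigma,\nu$ on $[a,b]$, with $d\nu/ds$ the density of the absolutely continuous part of $\nu$ with respect to Lebesgue measure and the convention $0\cdot\infty=0$, $$\Lambda^+_{p,[a,b]}(\sigma,\nu):=\sup_{a<x<b}\sigma((a,x])\,\|(d\nu/ds)^{-1}\|_{L^{1/(p-1)}([x,b])},\qquad \Lambda^-_{p,[a,b]}(\sigma,\nu):=\sup_{a<x<b}\sigma([x,b))\,\|(d\nu/ds)^{-1}\|_{L^{1/(p-1)}([a,x])}.$$ Completions. A vector measure $\overline\mu=(\overline\mu_0,\dots,\overline\mu_k)$ is a right completion of $\mu$ with respect to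 $a$ in a right neighbourhood $[a,b]$ if $\overline\mu_k=\mu_k$ in $[a,b]$, $\overline\mu_j=\mu_j$ in the complement of $(a,b]$, and $\overline\mu_j=\mu_j+\tilde\mu_j$ in $(a,b]$ for $0\le j<k$, where $\tilde\mu_j$ is any measure with $\tilde\mu_j((a,b])<\infty$ and $\Lambda^+_{p,[a,b]}(\tilde\mu_j,\overline\mu_{j+1})<\infty$. A left completion with respect to $a$ in a left neighbourhood $[b,a]$ is defined symmetrically (with $[b,a)$ in place of $(a,b]$ and $\Lambda^-_{p,[b,a]}$ in place of $\Lambda^+_{p,[a,b]}$). $\overline w_i$ denotes the density of the absolutely continuous part of $\overline\mu_i$. Regular points. A point $a\in\mathbb{R}$ is right $j$-regular (respectively left $j$-regular) if there exist a right completion $\overline\mu$ of $\mu$ in some $[a,b]$ (respectively a left completion in some $[b,a]$) and an index $i$ with $j<i\le k$ such that $\overline w_i\in B_p([a,b])$ (respectively $\overline w_i\in B_p([b,a])$). The point $a$ is $j$-regular if it is both right and left $j$-regular. Half-points and $\Omega^{(j)}$. Each point $t$ is regarded as the union of two half-points $t^+$ and $t^-$. $\Omega^{(j)}$ is the set of $j$-regular points or half-points: $x\in\Omega^{(j)}$ iff $x$ is $j$-regular, $x^+\in\Omega^{(j)}$ iff $x$ is right $j$-regular, $x^-\in\Omega^{(j)}$ iff $x$ is left $j$-regular. Connectedness and continuity follow the half-point convention: $(a,b)\cup(b,c)$ together with only one of $b^+,b^-$ is disconnected, while together with both it is $(a,c)$; a function is continuous (absolutely continuous) on $[b^+,c]$,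 respectively on $[a,b^-]$, if it is so on $[b,c]$, respectively on $[a,b]$, in the usual one-sided sense. $AC_{loc}(\Omega^{(j)})$ is the set of functions absolutely continuous on every compact interval contained in $\Omega^{(j)}$ in this sense. $p$-admissibility. $\mu$ is $p$-admissible if each $\mu_j$ is $\sigma$-finite, $\mu_j^*(\mathbb{R}\setminus\Omega^{(j)})=0$ for $1\le j<k$, and $\mu_k^*\equiv0$, where $d\mu_j^*:=d\mu_j-w_j\chi_{\Omega_j}dx$. (There is no restriction on $\mu_0$ beyond $\sigma$-finiteness.) Sobolev space. For $p$-admissible $\mu$ and $\Delta:=\bigcup_{j=0}^k\operatorname{supp}(\mu_j)$, $W^{k,p}(\Delta,\mu)$ is the space of equivalence classes of $$V^{k,p}(\Delta,\mu):=\Big\{f:\Delta\to\mathbb{R}\ :\ f^{(j)}\in AC_{loc}(\Omega^{(j)})\ \text{for } 0\le j<k,\ \ \|f\|_{W^{k,p}(\Delta,\mu)}:=\Big(\sum_{j=0}^k\|f^{(j)}\|^p_{L^p(\Delta,\mu_j)}\Big)^{1/p}<\infty\Big\}$$ with respect to the seminorm $\|\cdot\|_{W^{k,p}(\Delta,\mu)}$ (two functions are identified when the seminorm of their difference is zero), normed by $\|\cdot\|_{W^{k,p}(\Delta,\mu)}$. Product spaces. For $1\le s<\infty$, $\prod_{j=0}^kL^s(\Delta,\mu_j)$ carries the norm $\|g\|=\big(\sum_{j=0}^k\|g_j\|^s_{L^s(\mu_j)}\big)^{1/s}$ for $g=(g_0,\dots,g_k)$; for $s=\infty$ the norm is $\max_{0\le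 j\le k}\|g_j\|_{L^\infty(\mu_j)}$. For $f\in\prod_jL^p(\Delta,\mu_j)$ and $g\in\prod_jL^q(\Delta,\mu_j)$ put $(f,g)=\sum_{j=0}^k\int_\Delta f_jg_j\,d\mu_j$. The map $P:W^{k,p}(\Delta,\mu)\to\prod_{j=0}^kL^p(\Delta,\mu_j)$ is $Pf=(f,f',\dots,f^{(k)})$. *)

theory Defs
  imports "HOL-Probability.Essential_Supremum"
begin

text \<open>A vector measure \<open>\<mu> = (\<mu>\<^sub>0, \<dots>, \<mu>\<^sub>k)\<close> is a function \<open>\<mu> :: nat \<Rightarrow> real measure\<close> of which only the
values at \<open>j \<le> k\<close> matter; its components are measures on the Borel sets.\<close>

section \<open>Lebesgue spaces\<close>

text \<open>Power with a positive exponent.\<close>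

definition ennreal_powr :: "ennreal \<Rightarrow> real \<Rightarrow> ennreal" where
  "ennreal_powr x r = (if x = \<infinity> then \<infinity> else ennreal (enn2real x powr r))"

text \<open>The exponent ranges over \<open>(0, \<infinity>]\<close>. Nonnegative extended functions are needed because
\<open>w\<^sup>-\<^sup>1\<close> is infinite where the weight \<open>w\<close> vanishes.\<close>

definition L_norm_nn :: "'a measure \<Rightarrow> ennreal \<Rightarrow> ('a \<Rightarrow> ennreal) \<Rightarrow> ennreal" where
  "L_norm_nn M r f =
     (if r = \<infinity> then esssup M f
      else ennreal_powr (\<integral>\<^sup>+x. ennreal_powr (f x) (enn2real r) \<partial>M) (1 / enn2real r))"

definition L_norm :: "'a measure \<Rightarrow> ennreal \<Rightarrow> ('a \<Rightarrow> real) \<Rightarrow> real" where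
  "L_norm M r f = enn2real (L_norm_nn M r (\<lambda>x. ennreal \<bar>f x\<bar>))"

definition L_fun :: "'a measure \<Rightarrow> ennreal \<Rightarrow> ('a \<Rightarrow> real) set" where
  "L_fun M r = {f \<in> borel_measurable M. L_norm_nn M r (\<lambda>x. ennreal \<bar>f x\<bar>) < \<infinity>}"

definition L_space :: "'a measure \<Rightarrow> ennreal \<Rightarrow> ('a \<Rightarrow> real) set set" where
  "L_space M r = L_fun M r // {(f, g). f \<in> L_fun M r \<and> g \<in> L_fun M r \<and> (AE x in M. f x = g x)}"

definition rep :: "'a set \<Rightarrow> 'a" where
  "rep F = (SOME f. f \<in> F)"

section \<open>Lebesgue decomposition\<close>

definition is_Lebesgue_decomposition :: "real measure \<Rightarrow> real measure \<Rightarrow> (real \<Rightarrow> real) \<Rightarrow> bool" where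
  "is_Lebesgue_decomposition M S w \<longleftrightarrow>
     sets S = sets borel \<and> (\<exists>N\<in>null_sets lborel. emeasure S (UNIV - N) = 0) \<and>
     w \<in> borel_measurable borel \<and> (\<forall>x. 0 \<le> w x) \<and>
     (\<forall>A\<in>sets borel. emeasure M A = emeasure S A + (\<integral>\<^sup>+x\<in>A. ennreal (w x) \<partial>lborel))"

text \<open>For \<open>\<sigma>\<close>-finite \<open>M\<close> a decomposition exists (shown next), the singular part is unique, and the
density is unique almost everywhere; everything below depends on the density only up to null sets.\<close>

lemma Lebesgue_decomposition_exists:
  assumes M: "sets M = sets borel" "sigma_finite_measure M"
  shows "\<exists>S w. is_Lebesgue_decomposition M S w"
proof -
  interpret M: sigma_finite_measure M by fact
  note [measurable_cong] = M(1)
  have spM: "space M = UNIV" using sets_eq_imp_space_eq[OF M(1)] by simp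
  obtain h :: "real \<Rightarrow> real" where h: "h \<in> borel_measurable M" "\<And>x. h x > 0" "integrable M h"
    using M.obtain_positive_integrable_function by metis
  note [measurable] = h(1)
  define m where "m = density M h"
  have sm: "sets m = sets borel" by (simp add: m_def M(1))
  interpret m: finite_measure m
  proof
    show "emeasure m (space m) \<noteq> \<infinity>"
      using h(3) by (simp add: m_def emeasure_density integrable_iff_bounded spM)
         (use h(2) in \<open>auto simp: less_imp_le\<close>)
  qed
  have null_m: "emeasure m A = 0 \<longleftrightarrow> emeasure M A = 0" if [measurable]: "A \<in> sets borel" for A
  proof -
    have "emeasure m A = 0 \<longleftrightarrow> A \<in> null_sets m" using that sm by auto
    also have "\<dots> \<longleftrightarrow> A \<in> sets M \<and> (AE x in M. x \<in> A \<longrightarrow> ennreal (h x) = 0)"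
      unfolding m_def by (rule null_sets_density_iff) simp
    also have "\<dots> \<longleftrightarrow> A \<in> null_sets M"
    proof -
      have "h x \<le> 0 \<longleftrightarrow> False" for x using h(2)[of x] by simp
      then show ?thesis using that M(1) by (simp add: ennreal_eq_0_iff AE_iff_null_sets[of A M])
    qed
    finally show ?thesis using that M(1) by auto
  qed
  let ?s = "SUP Z\<in>null_sets lborel. emeasure m Z"
  have "null_sets lborel \<noteq> ({} :: real set set)" by blast
  from ennreal_SUP_countable_SUP[OF this, of "emeasure m"]
  obtain f :: "nat \<Rightarrow> ennreal" where f: "range f \<subseteq> emeasure m ` null_sets lborel" "?s = (SUP i. f i)"
    by auto
  from f(1) have "\<forall>i. \<exists>Z\<in>null_sets lborel. f i = emeasure m Z" by (auto simp: image_iff subset_eq)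
  then obtain Zs where Zs: "\<And>i. Zs i \<in> null_sets lborel" "\<And>i. f i = emeasure m (Zs i)" by metis
  define Z where "Z = (\<Union>i. Zs i)"
  have Z: "Z \<in> null_sets lborel" unfolding Z_def using Zs(1) by auto
  then have Zb[measurable]: "Z \<in> sets borel" by auto
  have sZ: "?s = emeasure m Z"
  proof (rule antisym)
    have "f i \<le> emeasure m Z" for i
      unfolding Zs(2)[of i] by (rule emeasure_mono) (use Zb in \<open>auto simp: Z_def sm\<close>)
    then show "?s \<le> emeasure m Z" unfolding f(2) by (rule SUP_least)
    show "emeasure m Z \<le> ?s" by (rule SUP_upper) (rule Z)
  qed
  have ac: "emeasure M (A - Z) = 0" if A: "A \<in> null_sets lborel" for A
  proof -
    have Ab[measurable]: "A \<in> sets borel" using A by auto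
    have "emeasure m (Z \<union> (A - Z)) = emeasure m Z + emeasure m (A - Z)"
      by (rule plus_emeasure[symmetric]) (auto simp: sm)
    moreover have "emeasure m (Z \<union> (A - Z)) \<le> ?s"
      by (rule SUP_upper) (use A Z in auto)
    ultimately have "emeasure m Z + emeasure m (A - Z) \<le> emeasure m Z + 0" using sZ by simp
    then have "emeasure m (A - Z) = 0"
      using m.emeasure_finite[of Z] by (subst (asm) ennreal_add_left_cancel_le) auto
    then show ?thesis using null_m[of "A - Z"] by simp
  qed
  define S where "S = density M (indicator Z)"
  define R where "R = density M (indicator (- Z))"
  have em: "emeasure S A = emeasure M (A \<inter> Z)" "emeasure R A = emeasure M (A - Z)"
    if [measurable]: "A \<in> sets borel" for A
  proof -
    have "emeasure S A = (\<integral>\<^sup>+x. indicator Z x * indicator A x \<partial>M)"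
      unfolding S_def by (rule emeasure_density) (auto simp: M(1))
    also have "\<dots> = (\<integral>\<^sup>+x. indicator (A \<inter> Z) x \<partial>M)"
      by (rule nn_integral_cong) (simp split: split_indicator)
    also have "\<dots> = emeasure M (A \<inter> Z)" by (rule nn_integral_indicator) (simp add: M(1))
    finally show "emeasure S A = emeasure M (A \<inter> Z)" .
    have "emeasure R A = (\<integral>\<^sup>+x. indicator (- Z) x * indicator A x \<partial>M)"
      unfolding R_def by (rule emeasure_density) (auto simp: M(1))
    also have "\<dots> = (\<integral>\<^sup>+x. indicator (A - Z) x \<partial>M)"
      by (rule nn_integral_cong) (simp split: split_indicator)
    also have "\<dots> = emeasure M (A - Z)" by (rule nn_integral_indicator) (simp add: M(1))
    finally show "emeasure R A = emeasure M (A - Z)" .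
  qed
  have sR: "sets R = sets borel" by (simp add: R_def M(1))
  have "absolutely_continuous lborel R"
    unfolding absolutely_continuous_def using ac em(2) sR by (auto simp: null_sets_def)
  then obtain g where g: "g \<in> borel_measurable lborel" "density lborel g = R"
    using sigma_finite_measure.Radon_Nikodym[OF sigma_finite_lborel, of R] sR by auto
  have "AE x in M. indicator (- Z) x \<noteq> (\<infinity>::ennreal)" by (simp add: indicator_def)
  then have "sigma_finite_measure R" unfolding R_def
    by (subst M.sigma_finite_iff_density_finite) auto
  then have "AE x in lborel. g x \<noteq> \<infinity>"
    using sigma_finite_measure.sigma_finite_iff_density_finite[OF sigma_finite_lborel g(1)] g(2) by simp
  then have gw: "AE x in lborel. ennreal (enn2real (g x)) = g x"
    by eventually_elim (simp add: less_top)
  have "is_Lebesgue_decomposition M S (\<lambda>x. enn2real (g x))"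
    unfolding is_Lebesgue_decomposition_def
  proof (intro conjI ballI allI)
    show "sets S = sets borel" by (simp add: S_def M(1))
    show "\<exists>N\<in>null_sets lborel. emeasure S (UNIV - N) = 0"
      by (intro bexI[OF _ Z]) (simp add: em Diff_Int_distrib2)
    show "(\<lambda>x. enn2real (g x)) \<in> borel_measurable borel" using g(1) by simp
    show "0 \<le> enn2real (g x)" for x by simp
    fix A :: "real set" assume A[measurable]: "A \<in> sets borel"
    have "(\<integral>\<^sup>+x\<in>A. ennreal (enn2real (g x)) \<partial>lborel) = (\<integral>\<^sup>+x\<in>A. g x \<partial>lborel)"
      by (rule nn_integral_cong_AE) (use gw in eventually_elim, simp)
    also have "\<dots> = emeasure R A" using g by (subst g(2)[symmetric], subst emeasure_density) auto
    finally have "(\<integral>\<^sup>+x\<in>A. ennreal (enn2real (g x)) \<partial>lborel) = emeasure M (A - Z)" using em(2)[OF A] by simp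
    moreover have "emeasure M A = emeasure M (A \<inter> Z) + emeasure M (A - Z)"
    proof -
      have "(A \<inter> Z) \<union> (A - Z) = A" "(A \<inter> Z) \<inter> (A - Z) = {}" by blast+
      then show ?thesis using plus_emeasure[of "A \<inter> Z" M "A - Z"] by (simp add: M(1))
    qed
    ultimately show "emeasure M A = emeasure S A + (\<integral>\<^sup>+x\<in>A. ennreal (enn2real (g x)) \<partial>lborel)"
      using em(1)[OF A] by simp
  qed
  then show ?thesis by blast
qed

definition Lebesgue_decomposition :: "real measure \<Rightarrow> real measure \<times> (real \<Rightarrow> real)" where
  "Lebesgue_decomposition M = (SOME (S, w). is_Lebesgue_decomposition M S w)"

definition singular_part :: "real measure \<Rightarrow> real measure" where
  "singular_part M = fst (Lebesgue_decomposition M)"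

definition ac_density :: "real measure \<Rightarrow> real \<Rightarrow> real" where
  "ac_density M = snd (Lebesgue_decomposition M)"

section \<open>Weights, Muckenhoupt constants and completions\<close>

text \<open>The norm of \<open>w\<^sup>-\<^sup>1\<close> in \<open>L\<^bsup>1/(p-1)\<^esup>(A)\<close>. In \<open>ennreal\<close>, \<open>1 / 0 = \<infinity>\<close>, so the exponent is \<open>\<infinity>\<close>
for \<open>p = 1\<close> and \<open>inverse\<close> is infinite at the zeros of \<open>w\<close>; also \<open>0 * \<infinity> = 0\<close>.\<close>

definition inv_weight_norm :: "real \<Rightarrow> (real \<Rightarrow> real) \<Rightarrow> real set \<Rightarrow> ennreal" where
  "inv_weight_norm p w A =
     L_norm_nn (restrict_space lborel A) (1 / ennreal (p - 1)) (\<lambda>x. inverse (ennreal (w x)))"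

definition B_class :: "real \<Rightarrow> real set \<Rightarrow> (real \<Rightarrow> real) set" where
  "B_class p A = {w. \<forall>K. compact K \<and> K \<subseteq> A \<longrightarrow> inv_weight_norm p w K < \<infinity>}"

definition Omega :: "real \<Rightarrow> (nat \<Rightarrow> real measure) \<Rightarrow> nat \<Rightarrow> real set" where
  "Omega p \<mu> j = {x. \<exists>V. open V \<and> x \<in> V \<and> ac_density (\<mu> j) \<in> B_class p V}"

definition Muckenhoupt_right :: "real \<Rightarrow> real \<Rightarrow> real \<Rightarrow> real measure \<Rightarrow> real measure \<Rightarrow> ennreal" where
  "Muckenhoupt_right p a b \<sigma> \<nu> =
     (SUP x\<in>{a<..<b}. emeasure \<sigma> {a<..x} * inv_weight_norm p (ac_density \<nu>) {x..b})"

definition Muckenhoupt_left :: "real \<Rightarrow> real \<Rightarrow> real \<Rightarrow> real measure \<Rightarrow> real measure \<Rightarrow> ennreal" where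
  "Muckenhoupt_left p a b \<sigma> \<nu> =
     (SUP x\<in>{a<..<b}. emeasure \<sigma> {x..<b} * inv_weight_norm p (ac_density \<nu>) {a..x})"

definition right_completion ::
    "real \<Rightarrow> nat \<Rightarrow> (nat \<Rightarrow> real measure) \<Rightarrow> real \<Rightarrow> real \<Rightarrow> (nat \<Rightarrow> real measure) \<Rightarrow> bool" where
  "right_completion p k \<mu> a b \<mu>' \<longleftrightarrow>
     a < b \<and> (\<forall>j\<le>k. sets (\<mu>' j) = sets borel) \<and>
     (\<forall>A\<in>sets borel. A \<subseteq> {a..b} \<longrightarrow> emeasure (\<mu>' k) A = emeasure (\<mu> k) A) \<and>
     (\<forall>j\<le>k. \<forall>A\<in>sets borel. A \<subseteq> - {a<..b} \<longrightarrow> emeasure (\<mu>' j) A = emeasure (\<mu> j) A) \<and>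
     (\<forall>j<k. \<exists>\<tau>. sets \<tau> = sets borel \<and>
        (\<forall>A\<in>sets borel. A \<subseteq> {a<..b} \<longrightarrow> emeasure (\<mu>' j) A = emeasure (\<mu> j) A + emeasure \<tau> A) \<and>
        emeasure \<tau> {a<..b} < \<infinity> \<and> Muckenhoupt_right p a b \<tau> (\<mu>' (Suc j)) < \<infinity>)"

text \<open>Here \<open>[b, a]\<close> is the left neighbourhood of \<open>a\<close>.\<close>

definition left_completion ::
    "real \<Rightarrow> nat \<Rightarrow> (nat \<Rightarrow> real measure) \<Rightarrow> real \<Rightarrow> real \<Rightarrow> (nat \<Rightarrow> real measure) \<Rightarrow> bool" where
  "left_completion p k \<mu> b a \<mu>' \<longleftrightarrow>
     b < a \<and> (\<forall>j\<le>k. sets (\<mu>' j) = sets borel) \<and>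
     (\<forall>A\<in>sets borel. A \<subseteq> {b..a} \<longrightarrow> emeasure (\<mu>' k) A = emeasure (\<mu> k) A) \<and>
     (\<forall>j\<le>k. \<forall>A\<in>sets borel. A \<subseteq> - {b..<a} \<longrightarrow> emeasure (\<mu>' j) A = emeasure (\<mu> j) A) \<and>
     (\<forall>j<k. \<exists>\<tau>. sets \<tau> = sets borel \<and>
        (\<forall>A\<in>sets borel. A \<subseteq> {b..<a} \<longrightarrow> emeasure (\<mu>' j) A = emeasure (\<mu> j) A + emeasure \<tau> A) \<and>
        emeasure \<tau> {b..<a} < \<infinity> \<and> Muckenhoupt_left p b a \<tau> (\<mu>' (Suc j)) < \<infinity>)"

section \<open>Regular points and admissibility\<close>

definition right_regular :: "real \<Rightarrow> nat \<Rightarrow> (nat \<Rightarrow> real measure) \<Rightarrow> nat \<Rightarrow> real \<Rightarrow> bool" where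
  "right_regular p k \<mu> j a \<longleftrightarrow>
     (\<exists>b \<mu>' i. right_completion p k \<mu> a b \<mu>' \<and> j < i \<and> i \<le> k \<and>
        ac_density (\<mu>' i) \<in> B_class p {a..b})"

definition left_regular :: "real \<Rightarrow> nat \<Rightarrow> (nat \<Rightarrow> real measure) \<Rightarrow> nat \<Rightarrow> real \<Rightarrow> bool" where
  "left_regular p k \<mu> j a \<longleftrightarrow>
     (\<exists>b \<mu>' i. left_completion p k \<mu> b a \<mu>' \<and> j < i \<and> i \<le> k \<and>
        ac_density (\<mu>' i) \<in> B_class p {b..a})"

text \<open>The full points of \<open>\<Omega>\<^bsup>(j)\<^esup>\<close>.\<close>

definition Omega_reg :: "real \<Rightarrow> nat \<Rightarrow> (nat \<Rightarrow> real measure) \<Rightarrow> nat \<Rightarrow> real set" where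
  "Omega_reg p k \<mu> j = {x. right_regular p k \<mu> j x \<and> left_regular p k \<mu> j x}"

text \<open>The interval \<open>[a, b]\<close>, read as \<open>[a\<^sup>+, b\<^sup>-]\<close>, is contained in \<open>\<Omega>\<^bsup>(j)\<^esup>\<close>. Intervals including
the outer half-points \<open>a\<^sup>-\<close> or \<open>b\<^sup>+\<close> give the same continuity requirement on \<open>[a, b]\<close>.\<close>

definition interval_in_Omega_reg ::
    "real \<Rightarrow> nat \<Rightarrow> (nat \<Rightarrow> real measure) \<Rightarrow> nat \<Rightarrow> real \<Rightarrow> real \<Rightarrow> bool" where
  "interval_in_Omega_reg p k \<mu> j a b \<longleftrightarrow>
     a < b \<and> right_regular p k \<mu> j a \<and> left_regular p k \<mu> j b \<and> {a<..<b} \<subseteq> Omega_reg p k \<mu> j"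

text \<open>\<open>\<mu>\<^sub>j\<^sup>* = \<mu>\<^sub>j - w\<^sub>j \<chi>\<^bsub>\<Omega>\<^sub>j\<^esub> dx\<close>, with \<open>\<mu>\<^sub>j = (\<mu>\<^sub>j)\<^sub>s + w\<^sub>j dx\<close> inserted so that \<open>\<infinity> - \<infinity>\<close> does not
arise.\<close>

definition mu_star :: "real \<Rightarrow> (nat \<Rightarrow> real measure) \<Rightarrow> nat \<Rightarrow> real set \<Rightarrow> ennreal" where
  "mu_star p \<mu> j A =
     emeasure (singular_part (\<mu> j)) A + (\<integral>\<^sup>+x\<in>A - Omega p \<mu> j. ennreal (ac_density (\<mu> j) x) \<partial>lborel)"

text \<open>Since \<open>emeasure\<close> vanishes outside its \<open>\<sigma>\<close>-algebra, \<open>\<mu>\<^sub>j\<^sup>*(\<real> - \<Omega>\<^bsup>(j)\<^esup>) = 0\<close> is stated by means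
of a Borel null set \<open>N\<close>.\<close>

definition p_admissible :: "real \<Rightarrow> nat \<Rightarrow> (nat \<Rightarrow> real measure) \<Rightarrow> bool" where
  "p_admissible p k \<mu> \<longleftrightarrow>
     (\<forall>j\<le>k. sets (\<mu> j) = sets borel \<and> sigma_finite_measure (\<mu> j)) \<and>
     (\<forall>j. 1 \<le> j \<and> j < k \<longrightarrow>
        (\<exists>N\<in>sets borel. UNIV - Omega_reg p k \<mu> j \<subseteq> N \<and> mu_star p \<mu> j N = 0)) \<and>
     (\<forall>A\<in>sets borel. mu_star p \<mu> k A = 0)"

section \<open>The Sobolev space\<close>

definition supp :: "real measure \<Rightarrow> real set" where
  "supp M = {x. \<forall>U. open U \<and> x \<in> U \<longrightarrow> emeasure M U > 0}"

definition Delta :: "nat \<Rightarrow> (nat \<Rightarrow> real measure) \<Rightarrow> real set" where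
  "Delta k \<mu> = (\<Union>j\<le>k. supp (\<mu> j))"

text \<open>The measure space \<open>(\<Delta>, \<mu>\<^sub>j)\<close>. It is completed because derivatives \<open>f\<^bsup>(j)\<^esup>\<close> are determined only
\<open>\<mu>\<^sub>j\<close>-almost everywhere; without completion, measurability would depend on the values on null sets.\<close>

definition on_Delta :: "nat \<Rightarrow> (nat \<Rightarrow> real measure) \<Rightarrow> nat \<Rightarrow> real measure" where
  "on_Delta k \<mu> j = restrict_space (completion (\<mu> j)) (Delta k \<mu>)"

definition prod_norm :: "ennreal \<Rightarrow> nat \<Rightarrow> (nat \<Rightarrow> real measure) \<Rightarrow> (nat \<Rightarrow> real \<Rightarrow> real) \<Rightarrow> real" where
  "prod_norm s k \<mu> g =
     (if s = \<infinity> then (MAX j\<in>{..k}. L_norm (on_Delta k \<mu> j) s (g j))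
      else (\<Sum>j\<le>k. L_norm (on_Delta k \<mu> j) s (g j) powr enn2real s) powr (1 / enn2real s))"

definition abs_continuous_on :: "real set \<Rightarrow> (real \<Rightarrow> real) \<Rightarrow> bool" where
  "abs_continuous_on I g \<longleftrightarrow>
     (\<forall>\<epsilon>>0. \<exists>\<delta>>0. \<forall>(n::nat) x y.
        (\<forall>i<n. x i \<le> y i \<and> {x i..y i} \<subseteq> I) \<and>
        (\<forall>i<n. \<forall>l<n. i \<noteq> l \<longrightarrow> {x i<..<y i} \<inter> {x l<..<y l} = {}) \<and>
        (\<Sum>i<n. y i - x i) < \<delta> \<longrightarrow>
        (\<Sum>i<n. \<bar>g (y i) - g (x i)\<bar>) < \<epsilon>)"

text \<open>\<open>f\<close> is \<open>j\<close> times differentiable on \<open>I\<close> with \<open>j\<close>-th derivative \<open>g\<close>; derivatives are taken within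
\<open>I\<close>, i.e. one-sided at the endpoints.\<close>

definition has_nth_derivative_on :: "nat \<Rightarrow> real set \<Rightarrow> (real \<Rightarrow> real) \<Rightarrow> (real \<Rightarrow> real) \<Rightarrow> bool" where
  "has_nth_derivative_on j I f g \<longleftrightarrow>
     (\<exists>h. h 0 = f \<and> h j = g \<and>
        (\<forall>i<j. \<forall>x\<in>I. (h i has_real_derivative h (Suc i) x) (at x within I)))"

definition derivative_AC_loc :: "real \<Rightarrow> nat \<Rightarrow> (nat \<Rightarrow> real measure) \<Rightarrow> nat \<Rightarrow> (real \<Rightarrow> real) \<Rightarrow> bool" where
  "derivative_AC_loc p k \<mu> j f \<longleftrightarrow>
     (\<forall>a b. interval_in_Omega_reg p k \<mu> j a b \<longrightarrow>
        (\<exists>g. has_nth_derivative_on j {a..b} f g \<and> abs_continuous_on {a..b} g))"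

text \<open>\<open>P f = (f, f', \<dots>, f\<^bsup>(k)\<^esup>)\<close>. For \<open>j \<ge> 1\<close> and \<open>f\<close> in the space below, \<open>f\<^bsup>(j)\<^esup>\<close> exists in the
classical two-sided sense at \<open>\<mu>\<^sub>j\<close>-almost every point: at the points of \<open>Omega_reg p k \<mu> j\<close>, and
Lebesgue-almost everywhere on \<open>Omega p \<mu> j \<subseteq> Omega_reg p k \<mu> (j - 1)\<close>.\<close>

definition P_map :: "(real \<Rightarrow> real) \<Rightarrow> nat \<Rightarrow> real \<Rightarrow> real" where
  "P_map f j = (deriv ^^ j) f"

definition sobolev_norm :: "real \<Rightarrow> nat \<Rightarrow> (nat \<Rightarrow> real measure) \<Rightarrow> (real \<Rightarrow> real) \<Rightarrow> real" where
  "sobolev_norm p k \<mu> f = prod_norm (ennreal p) k \<mu> (P_map f)"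

text \<open>Functions \<open>\<Delta> \<rightarrow> \<real>\<close> are represented by total functions; their values outside \<open>\<Delta>\<close> play no role
(\<open>Delta k \<mu>\<close> contains every interval occurring in \<open>derivative_AC_loc\<close>) and are identified by the
seminorm.\<close>

definition sobolev_fun :: "real \<Rightarrow> nat \<Rightarrow> (nat \<Rightarrow> real measure) \<Rightarrow> (real \<Rightarrow> real) set" where
  "sobolev_fun p k \<mu> =
     {f. (\<forall>j<k. derivative_AC_loc p k \<mu> j f) \<and>
         (\<forall>j\<le>k. P_map f j \<in> L_fun (on_Delta k \<mu> j) (ennreal p))}"

definition sobolev_rel :: "real \<Rightarrow> nat \<Rightarrow> (nat \<Rightarrow> real measure) \<Rightarrow> (real \<Rightarrow> real) rel" where
  "sobolev_rel p k \<mu> =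
     {(f, g). f \<in> sobolev_fun p k \<mu> \<and> g \<in> sobolev_fun p k \<mu> \<and>
        sobolev_norm p k \<mu> (\<lambda>x. f x - g x) = 0}"

definition sobolev_space :: "real \<Rightarrow> nat \<Rightarrow> (nat \<Rightarrow> real measure) \<Rightarrow> (real \<Rightarrow> real) set set" where
  "sobolev_space p k \<mu> = sobolev_fun p k \<mu> // sobolev_rel p k \<mu>"

definition sobolev_class :: "real \<Rightarrow> nat \<Rightarrow> (nat \<Rightarrow> real measure) \<Rightarrow> (real \<Rightarrow> real) \<Rightarrow> (real \<Rightarrow> real) set" where
  "sobolev_class p k \<mu> f = sobolev_rel p k \<mu> `` {f}"

section \<open>The dual space and the map J\<close>

definition sobolev_dual :: "real \<Rightarrow> nat \<Rightarrow> (nat \<Rightarrow> real measure) \<Rightarrow> ((real \<Rightarrow> real) set \<Rightarrow> real) set" where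
  "sobolev_dual p k \<mu> =
     {T. (\<forall>f\<in>sobolev_fun p k \<mu>. \<forall>g\<in>sobolev_fun p k \<mu>.
            T (sobolev_class p k \<mu> (\<lambda>x. f x + g x)) =
              T (sobolev_class p k \<mu> f) + T (sobolev_class p k \<mu> g)) \<and>
         (\<forall>c. \<forall>f\<in>sobolev_fun p k \<mu>.
            T (sobolev_class p k \<mu> (\<lambda>x. c * f x)) = c * T (sobolev_class p k \<mu> f)) \<and>
         (\<exists>C. \<forall>F\<in>sobolev_space p k \<mu>. \<bar>T F\<bar> \<le> C * sobolev_norm p k \<mu> (rep F))}"

definition dual_norm :: "real \<Rightarrow> nat \<Rightarrow> (nat \<Rightarrow> real measure) \<Rightarrow> ((real \<Rightarrow> real) set \<Rightarrow> real) \<Rightarrow> real" where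
  "dual_norm p k \<mu> T = (SUP F\<in>{F \<in> sobolev_space p k \<mu>. sobolev_norm p k \<mu> (rep F) \<le> 1}. \<bar>T F\<bar>)"

definition prod_space :: "ennreal \<Rightarrow> nat \<Rightarrow> (nat \<Rightarrow> real measure) \<Rightarrow> (nat \<Rightarrow> (real \<Rightarrow> real) set) set" where
  "prod_space s k \<mu> = (\<Pi>\<^sub>E j\<in>{..k}. L_space (on_Delta k \<mu> j) s)"

definition pairing :: "nat \<Rightarrow> (nat \<Rightarrow> real measure) \<Rightarrow> (nat \<Rightarrow> real \<Rightarrow> real) \<Rightarrow> (nat \<Rightarrow> real \<Rightarrow> real) \<Rightarrow> real" where
  "pairing k \<mu> f g = (\<Sum>j\<le>k. \<integral>x. f j x * g j x \<partial>(on_Delta k \<mu> j))"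

definition J_map ::
    "nat \<Rightarrow> (nat \<Rightarrow> real measure) \<Rightarrow> (nat \<Rightarrow> (real \<Rightarrow> real) set) \<Rightarrow> (real \<Rightarrow> real) set \<Rightarrow> real" where
  "J_map k \<mu> v F = pairing k \<mu> (P_map (rep F)) (\<lambda>j. rep (v j))"

end

theory Submission
  imports Defs
begin

text \<open>
Write \<open>P f = (f, f', \<dots>, f\<^bsup>(k)\<^esup>)\<close>. The map \<open>P\<close> embeds the Sobolev space isometrically into the product of
the spaces \<open>L\<^sup>p(\<Delta>, \<mu>\<^sub>j)\<close>, so a bounded functional \<open>T\<close> is a functional on a subspace of that product. The
Hahn-Banach theorem extends it with the same norm, and the dual of a finite product of \<open>L\<^sup>p\<close> spaces
over \<open>\<sigma>\<close>-finite measures is the product of the \<open>L\<^sup>q\<close> spaces. This produces \<open>v\<close> with \<open>T = J v\<close> and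
\<open>\<parallel>v\<parallel> \<le> \<parallel>T\<parallel>\<close>; the Hoelder inequality gives \<open>\<parallel>T\<parallel> \<le> \<parallel>v\<parallel>\<close>. If \<open>1 < p < \<infinity>\<close> then \<open>1 < q < \<infinity>\<close>, and two
representatives \<open>v \<noteq> v'\<close> of norm \<open>\<parallel>T\<parallel>\<close> are impossible: their midpoint also represents \<open>T\<close>, but its norm
is smaller than \<open>\<parallel>T\<parallel>\<close> by strict convexity of \<open>t \<mapsto> \<bar>t\<bar>\<^sup>q\<close>.

Two parts of this outline need work.

The first is that \<open>P\<close> is linear modulo null sets, where the derivatives are the iterated two-sided
derivatives \<open>deriv\<close>, which take an arbitrary value at points of nondifferentiability. So \<open>f\<^bsup>(j)\<^esup>\<close> has
to exist at \<open>\<mu>\<^sub>j\<close>-almost every point (\<open>diff_times_ae\<close>). For \<open>1 \<le> j < k\<close>, admissibility splits \<open>\<mu>\<^sub>j\<close> into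
a measure carried by \<open>\<Omega>\<^bsup>(j)\<^esup>\<close> and the absolutely continuous measure \<open>w\<^sub>j dx\<close> on \<open>\<Omega>\<^sub>j\<close>; for \<open>j = k\<close> only the
latter remains. On \<open>\<Omega>\<^bsup>(j)\<^esup>\<close> the derivative exists because this set is open: on each side of a regular
point, some original weight \<open>w\<^sub>m\<close> with \<open>m > j\<close> is of class \<open>B\<^sub>p\<close> on a half-open interval ending at the
point, whatever completion was used (\<open>weight_near_regular_end\<close>). On \<open>\<Omega>\<^sub>j\<close> the derivative of order \<open>j - 1\<close> is locally absolutely continuous, hence differentiable Lebesgue-almost
everywhere (\<open>abs_continuous_on_differentiable_ae\<close>). The latter is proved from the Vitali covering
theorem: if difference quotients both below \<open>r\<close> and above \<open>s > r\<close> occurred at arbitrarily small scales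
on a set of positive outer measure, that set would be covered up to small measure by disjoint
intervals of either kind, and the increments over the two families would differ too much for
intervals whose set difference is small.

The second is the duality of \<open>L\<^sup>p\<close>, obtained together with the extension step
(\<open>family_representation\<close>). The functional is first doubled: with \<open>u\<close> is associated the pair \<open>(u, -u)\<close>,
and the pairs are dominated by the sublinear functional \<open>C \<parallel>w\<^sup>+\<parallel>\<close>. An extension dominated by this
functional is automatically positive, so its components come from measures, and the Radon-Nikodym
theorem provides densities (\<open>positive_functional_representation\<close>) without a decomposition of signed
measures.
\<close>

section \<open>The Hahn-Banach theorem for spaces of real functions\<close>

text \<open>Vectors are real functions, not classes modulo null sets: functionals that depend only on the class
arise from the domination by a sublinear functional with this property.\<close>

definition fun_space :: "('b \<Rightarrow> real) set \<Rightarrow> bool" where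
  "fun_space V \<longleftrightarrow> (\<lambda>_. 0) \<in> V \<and> (\<forall>u\<in>V. \<forall>v\<in>V. \<forall>a b. (\<lambda>x. a * u x + b * v x) \<in> V)"

definition linear_on_fun :: "('b \<Rightarrow> real) set \<Rightarrow> (('b \<Rightarrow> real) \<Rightarrow> real) \<Rightarrow> bool" where
  "linear_on_fun V T \<longleftrightarrow> (\<forall>u\<in>V. \<forall>v\<in>V. \<forall>a b. T (\<lambda>x. a * u x + b * v x) = a * T u + b * T v)"

lemma fun_spaceD:
  assumes "fun_space V"
  shows "(\<lambda>_. 0) \<in> V" "u \<in> V \<Longrightarrow> v \<in> V \<Longrightarrow> (\<lambda>x. a * u x + b * v x) \<in> V"
    "u \<in> V \<Longrightarrow> v \<in> V \<Longrightarrow> (\<lambda>x. u x + v x) \<in> V" "u \<in> V \<Longrightarrow> v \<in> V \<Longrightarrow> (\<lambda>x. u x - v x) \<in> V"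
    "u \<in> V \<Longrightarrow> (\<lambda>x. a * u x) \<in> V" "u \<in> V \<Longrightarrow> (\<lambda>x. - u x) \<in> V"
proof -
  have c: "(\<lambda>x. a * u x + b * v x) \<in> V" if "u \<in> V" "v \<in> V" for u v a b
    using assms that unfolding fun_space_def by blast
  show "(\<lambda>_. 0) \<in> V" using assms unfolding fun_space_def by blast
  show "u \<in> V \<Longrightarrow> v \<in> V \<Longrightarrow> (\<lambda>x. a * u x + b * v x) \<in> V" by (rule c)
  show "u \<in> V \<Longrightarrow> v \<in> V \<Longrightarrow> (\<lambda>x. u x + v x) \<in> V" using c[of u v 1 1] by simp
  show "u \<in> V \<Longrightarrow> v \<in> V \<Longrightarrow> (\<lambda>x. u x - v x) \<in> V" using c[of u v 1 "-1"] by simp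
  show "u \<in> V \<Longrightarrow> (\<lambda>x. a * u x) \<in> V" using c[of u u a 0] by simp
  show "u \<in> V \<Longrightarrow> (\<lambda>x. - u x) \<in> V" using c[of u u "-1" 0] by simp
qed

lemma linear_on_funD:
  assumes "linear_on_fun V T"
  shows "u \<in> V \<Longrightarrow> v \<in> V \<Longrightarrow> T (\<lambda>x. a * u x + b * v x) = a * T u + b * T v"
    "u \<in> V \<Longrightarrow> v \<in> V \<Longrightarrow> T (\<lambda>x. u x + v x) = T u + T v"
    "u \<in> V \<Longrightarrow> v \<in> V \<Longrightarrow> T (\<lambda>x. u x - v x) = T u - T v"
    "u \<in> V \<Longrightarrow> T (\<lambda>x. a * u x) = a * T u" "u \<in> V \<Longrightarrow> T (\<lambda>x. - u x) = - T u"
proof -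
  have c: "T (\<lambda>x. a * u x + b * v x) = a * T u + b * T v" if "u \<in> V" "v \<in> V" for u v a b
    using assms that unfolding linear_on_fun_def by blast
  show "u \<in> V \<Longrightarrow> v \<in> V \<Longrightarrow> T (\<lambda>x. a * u x + b * v x) = a * T u + b * T v" by (rule c)
  show "u \<in> V \<Longrightarrow> v \<in> V \<Longrightarrow> T (\<lambda>x. u x + v x) = T u + T v" using c[of u v 1 1] by simp
  show "u \<in> V \<Longrightarrow> v \<in> V \<Longrightarrow> T (\<lambda>x. u x - v x) = T u - T v" using c[of u v 1 "-1"] by simp
  show "u \<in> V \<Longrightarrow> T (\<lambda>x. a * u x) = a * T u" using c[of u u a 0] by simp
  show "u \<in> V \<Longrightarrow> T (\<lambda>x. - u x) = - T u" using c[of u u "-1" 0] by simp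
qed

text \<open>A maximal linear graph extending that of \<open>T\<close> and lying below \<open>S\<close> is total: at a new vector \<open>z\<close> any
value between \<open>sup (s - S (v - z))\<close> and \<open>inf (S (u + z) - r)\<close>, taken over the graph, extends it further.
Working with graphs makes unions of chains trivial; a graph below \<open>S\<close> is single-valued because
\<open>S 0 = 0\<close>.\<close>

theorem Hahn_Banach_fun:
  fixes V W :: "('b \<Rightarrow> real) set"
  assumes V: "fun_space V" and W: "fun_space W" "W \<subseteq> V" and T: "linear_on_fun W T"
    and S: "\<And>u v. u \<in> V \<Longrightarrow> v \<in> V \<Longrightarrow> S (\<lambda>x. u x + v x) \<le> S u + S v"
      "\<And>u c. u \<in> V \<Longrightarrow> c \<ge> 0 \<Longrightarrow> S (\<lambda>x. c * u x) = c * S u"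
    and TS: "\<And>u. u \<in> W \<Longrightarrow> T u \<le> S u"
  obtains \<Phi> where "linear_on_fun V \<Phi>" "\<And>u. u \<in> W \<Longrightarrow> \<Phi> u = T u" "\<And>u. u \<in> V \<Longrightarrow> \<Phi> u \<le> S u"
proof -
  define \<G> where "\<G> = {G. (\<forall>u\<in>W. (u, T u) \<in> G) \<and> (\<forall>u r. (u, r) \<in> G \<longrightarrow> u \<in> V \<and> r \<le> S u) \<and>
    (\<forall>u r v s a b. (u, r) \<in> G \<longrightarrow> (v, s) \<in> G \<longrightarrow> ((\<lambda>x. a * u x + b * v x), a * r + b * s) \<in> G)}"
  have "\<exists>G\<in>\<G>. \<forall>X\<in>\<G>. G \<subseteq> X \<longrightarrow> X = G"
  proof (rule subset_Zorn_nonempty)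
    have "(\<lambda>u. (u, T u)) ` W \<in> \<G>"
      unfolding \<G>_def using W TS fun_spaceD(2)[OF W(1)] linear_on_funD(1)[OF T] by auto
    then show "\<G> \<noteq> {}" by blast
    fix \<C> assume ne: "\<C> \<noteq> {}" and ch: "subset.chain \<G> \<C>"
    have sub: "\<C> \<subseteq> \<G>" using ch by (simp add: subset_chain_def)
    show "\<Union>\<C> \<in> \<G>"
      unfolding \<G>_def
    proof (intro CollectI conjI allI impI ballI)
      show "(u, T u) \<in> \<Union>\<C>" if u: "u \<in> W" for u
      proof -
        obtain X where X: "X \<in> \<C>" using ne by blast
        then have "(u, T u) \<in> X" using sub u unfolding \<G>_def by blast
        then show ?thesis using X by blast
      qed
      show "u \<in> V" "r \<le> S u" if "(u, r) \<in> \<Union>\<C>" for u r using sub that by (auto simp: \<G>_def)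
      fix u r v s a b assume "(u, r) \<in> \<Union>\<C>" "(v, s) \<in> \<Union>\<C>"
      then obtain X Y where XY: "X \<in> \<C>" "(u, r) \<in> X" "Y \<in> \<C>" "(v, s) \<in> Y" by blast
      have "X \<subseteq> Y \<or> Y \<subseteq> X" using ch XY by (simp add: subset_chain_def)
      then obtain Z where Z: "Z \<in> \<C>" "(u, r) \<in> Z" "(v, s) \<in> Z" using XY by blast
      have "Z \<in> \<G>" using Z sub by blast
      then have "((\<lambda>x. a * u x + b * v x), a * r + b * s) \<in> Z" using Z unfolding \<G>_def by blast
      then show "((\<lambda>x. a * u x + b * v x), a * r + b * s) \<in> \<Union>\<C>" using Z by blast
    qed
  qed
  then obtain G where G: "G \<in> \<G>" and mx: "\<And>X. X \<in> \<G> \<Longrightarrow> G \<subseteq> X \<Longrightarrow> X = G" by blast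
  have GW: "(u, T u) \<in> G" if "u \<in> W" for u using G that by (simp add: \<G>_def)
  have GV: "u \<in> V" "r \<le> S u" if "(u, r) \<in> G" for u r using G that by (auto simp: \<G>_def)
  have Glin: "((\<lambda>x. a * u x + b * v x), a * r + b * s) \<in> G" if "(u, r) \<in> G" "(v, s) \<in> G" for u r v s a b
    using G that unfolding \<G>_def by blast
  have T0: "T (\<lambda>_. 0) = 0" using linear_on_funD(4)[OF T fun_spaceD(1)[OF W(1)], of 0] by simp
  have S0: "S (\<lambda>_. 0) = 0" using S(2)[OF fun_spaceD(1)[OF V], of 0] by simp
  have G0: "((\<lambda>_. 0), 0) \<in> G" using GW[OF fun_spaceD(1)[OF W(1)]] T0 by simp
  have uniq: "r = s" if "(u, r) \<in> G" "(u, s) \<in> G" for u r s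
  proof -
    have "((\<lambda>x. 1 * u x + (-1) * u x), 1 * r + (-1) * s) \<in> G" "((\<lambda>x. 1 * u x + (-1) * u x), 1 * s + (-1) * r) \<in> G"
      using that by (intro Glin; simp)+
    then have "r - s \<le> S (\<lambda>_. 0)" "s - r \<le> S (\<lambda>_. 0)" using GV(2) by fastforce+
    then show ?thesis using S0 by simp
  qed
  have total: "\<exists>r. (z, r) \<in> G" if z: "z \<in> V" for z
  proof (rule ccontr)
    assume nz: "\<nexists>r. (z, r) \<in> G"
    define L where "L = {s - S (\<lambda>x. v x - z x) | v s. (v, s) \<in> G}"
    have LU: "s - S (\<lambda>x. v x - z x) \<le> S (\<lambda>x. u x + z x) - r" if "(u, r) \<in> G" "(v, s) \<in> G" for u r v s
    proof -
      have "r + s \<le> S (\<lambda>x. u x + v x)" using GV(2)[OF Glin[OF that, of 1 1]] by simp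
      also have "(\<lambda>x. u x + v x) = (\<lambda>x. (u x + z x) + (v x - z x))" by simp
      also have "S \<dots> \<le> S (\<lambda>x. u x + z x) + S (\<lambda>x. v x - z x)"
        using GV(1) that z V by (intro S(1)) (auto intro: fun_spaceD)
      finally show ?thesis by simp
    qed
    have Lne: "L \<noteq> {}" using G0 by (auto simp: L_def)
    have Lbd: "bdd_above L" using LU[OF G0] by (intro bdd_aboveI) (auto simp: L_def)
    define c where "c = Sup L"
    have c1: "s - S (\<lambda>x. v x - z x) \<le> c" if "(v, s) \<in> G" for v s
      unfolding c_def using that by (intro cSup_upper Lbd) (auto simp: L_def)
    have c2: "c \<le> S (\<lambda>x. u x + z x) - r" if "(u, r) \<in> G" for u r
      unfolding c_def using that LU by (intro cSup_least Lne) (auto simp: L_def)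
    define G' where "G' = {((\<lambda>x. u x + t * z x), r + t * c) | u r t. (u, r) \<in> G}"
    have GG': "G \<subseteq> G'"
    proof (rule subrelI)
      fix u r assume "(u, r) \<in> G"
      then show "(u, r) \<in> G'" unfolding G'_def by (intro CollectI exI[of _ u] exI[of _ r] exI[of _ 0]) auto
    qed
    have "G' \<in> \<G>"
      unfolding \<G>_def
    proof (intro CollectI conjI allI impI ballI)
      show "(u, T u) \<in> G'" if "u \<in> W" for u using GW GG' that by blast
      show "u \<in> V" if "(u, r) \<in> G'" for u r
        using that GV(1) z fun_spaceD(2)[OF V, of _ z 1] by (fastforce simp: G'_def)
      show "r \<le> S u" if "(u, r) \<in> G'" for u r
      proof -
        obtain u0 r0 t where u: "u = (\<lambda>x. u0 x + t * z x)" "r = r0 + t * c" "(u0, r0) \<in> G"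
          using \<open>(u, r) \<in> G'\<close> unfolding G'_def by blast
        have sc: "((\<lambda>x. a * u0 x), a * r0) \<in> G" for a using Glin[OF u(3) u(3), of a 0] by simp
        consider "t = 0" | "t > 0" | "t < 0" by linarith
        then show ?thesis
        proof cases
          case 1
          then show ?thesis using u GV(2) by simp
        next
          case 2
          have "c \<le> S (\<lambda>x. (1 / t) * u0 x + z x) - (1 / t) * r0" by (rule c2[OF sc])
          then have "t * c \<le> t * (S (\<lambda>x. (1 / t) * u0 x + z x) - (1 / t) * r0)"
            using 2 by (intro mult_left_mono) auto
          also have "\<dots> = t * S (\<lambda>x. (1 / t) * u0 x + z x) - r0" using 2 by (simp add: right_diff_distrib)
          also have "t * S (\<lambda>x. (1 / t) * u0 x + z x) = S (\<lambda>x. t * ((1 / t) * u0 x + z x))"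
            by (rule S(2)[symmetric, OF fun_spaceD(3)[OF V GV(1)[OF sc] z]]) (use 2 in simp)
          also have "(\<lambda>x. t * ((1 / t) * u0 x + z x)) = u" using 2 u by (auto simp: distrib_left)
          finally show ?thesis using u by simp
        next
          case 3
          have "(- 1 / t) * r0 - S (\<lambda>x. (- 1 / t) * u0 x - z x) \<le> c" by (rule c1[OF sc])
          then have "t * c \<le> t * ((- 1 / t) * r0 - S (\<lambda>x. (- 1 / t) * u0 x - z x))"
            using 3 by (intro mult_left_mono_neg) auto
          also have "\<dots> = (- t) * S (\<lambda>x. (- 1 / t) * u0 x - z x) - r0" using 3 by (simp add: right_diff_distrib)
          also have "(- t) * S (\<lambda>x. (- 1 / t) * u0 x - z x) = S (\<lambda>x. (- t) * ((- 1 / t) * u0 x - z x))"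
            by (rule S(2)[symmetric, OF fun_spaceD(4)[OF V GV(1)[OF sc] z]]) (use 3 in simp)
          also have "(\<lambda>x. (- t) * ((- 1 / t) * u0 x - z x)) = u" using 3 u by (auto simp: right_diff_distrib)
          finally show ?thesis using u by simp
        qed
      qed
      fix u r v s a b assume uv: "(u, r) \<in> G'" "(v, s) \<in> G'"
      obtain u0 r0 t where u: "u = (\<lambda>x. u0 x + t * z x)" "r = r0 + t * c" "(u0, r0) \<in> G"
        using uv(1) unfolding G'_def by blast
      obtain v0 s0 t' where v: "v = (\<lambda>x. v0 x + t' * z x)" "s = s0 + t' * c" "(v0, s0) \<in> G"
        using uv(2) unfolding G'_def by blast
      have "(\<lambda>x. a * u x + b * v x) = (\<lambda>x. (a * u0 x + b * v0 x) + (a * t + b * t') * z x)"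
        "a * r + b * s = (a * r0 + b * s0) + (a * t + b * t') * c"
        unfolding u v by (auto simp: algebra_simps)
      then show "((\<lambda>x. a * u x + b * v x), a * r + b * s) \<in> G'"
        unfolding G'_def using Glin[OF u(3) v(3), of a b]
        by (intro CollectI exI[of _ "\<lambda>x. a * u0 x + b * v0 x"] exI[of _ "a * r0 + b * s0"]
            exI[of _ "a * t + b * t'"]) simp
    qed
    then have "G' = G" using mx GG' by blast
    moreover have "(z, c) \<in> G'"
      unfolding G'_def using G0 by (intro CollectI exI[of _ "\<lambda>_. 0"] exI[of _ 0] exI[of _ 1]) auto
    ultimately show False using nz by blast
  qed
  define \<Phi> where "\<Phi> u = (THE r. (u, r) \<in> G)" for u
  have \<Phi>: "\<Phi> u = r" if "(u, r) \<in> G" for u r unfolding \<Phi>_def using that uniq by blast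
  have \<Phi>G: "(u, \<Phi> u) \<in> G" if "u \<in> V" for u using total[OF that] \<Phi> by metis
  show thesis
  proof
    show "linear_on_fun V \<Phi>" unfolding linear_on_fun_def using Glin \<Phi>G \<Phi> by blast
    show "\<Phi> u = T u" if "u \<in> W" for u using \<Phi>[OF GW[OF that]] .
    show "\<Phi> u \<le> S u" if "u \<in> V" for u using GV(2)[OF \<Phi>G[OF that]] .
  qed
qed

text \<open>The Minkowski inequality in abstract form: for convex \<open>\<rho>\<close> homogeneous of degree \<open>p\<close>, the function
\<open>\<rho>\<^bsup>1/p\<^esup>\<close> is the gauge of the convex set \<open>\<rho> \<le> 1\<close>.\<close>

lemma root_of_convex_subadditive:
  fixes V :: "('b \<Rightarrow> real) set" and p :: real
  assumes V: "fun_space V" and p: "p \<ge> 1" and nonneg: "\<And>u. u \<in> V \<Longrightarrow> \<rho> u \<ge> 0"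
    and hom: "\<And>u c. u \<in> V \<Longrightarrow> c > 0 \<Longrightarrow> \<rho> (\<lambda>x. c * u x) = c powr p * \<rho> u"
    and conv: "\<And>u v a b. u \<in> V \<Longrightarrow> v \<in> V \<Longrightarrow> a \<ge> 0 \<Longrightarrow> b \<ge> 0 \<Longrightarrow> a + b = 1 \<Longrightarrow>
        \<rho> (\<lambda>x. a * u x + b * v x) \<le> a * \<rho> u + b * \<rho> v"
    and uv: "u \<in> V" "v \<in> V"
  shows "\<rho> (\<lambda>x. u x + v x) powr (1 / p) \<le> \<rho> u powr (1 / p) + \<rho> v powr (1 / p)"
proof (rule field_le_epsilon)
  fix e :: real assume e: "e > 0"
  define a where "a = \<rho> u powr (1 / p) + e / 2"
  define b where "b = \<rho> v powr (1 / p) + e / 2"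
  have ab: "a > 0" "b > 0" using e by (auto simp: a_def b_def add_nonneg_pos)
  have le: "\<rho> w \<le> c powr p" if "w \<in> V" "\<rho> w powr (1 / p) \<le> c" for w c
  proof -
    have "\<rho> w = (\<rho> w powr (1 / p)) powr p" using p nonneg[OF that(1)] by (simp add: powr_powr)
    also have "\<dots> \<le> c powr p" using p that(2) by (intro powr_mono2) auto
    finally show ?thesis .
  qed
  have unit: "\<rho> (\<lambda>x. (1 / c) * w x) \<le> 1" if "w \<in> V" "\<rho> w powr (1 / p) \<le> c" "c > 0" for w c
  proof -
    have "\<rho> (\<lambda>x. (1 / c) * w x) = (1 / c) powr p * \<rho> w" using that by (intro hom) auto
    also have "\<dots> \<le> (1 / c) powr p * c powr p" using le[OF that(1,2)] by (intro mult_left_mono) auto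
    also have "\<dots> = 1" using that(3) by (simp add: powr_mult[symmetric])
    finally show ?thesis .
  qed
  let ?u = "\<lambda>x. (1 / a) * u x" and ?v = "\<lambda>x. (1 / b) * v x"
  have in_V: "?u \<in> V" "?v \<in> V" by (intro fun_spaceD(5)[OF V] uv)+
  let ?w = "\<lambda>x. (a / (a + b)) * ?u x + (b / (a + b)) * ?v x"
  have w: "?w \<in> V" using in_V V by (intro fun_spaceD(2))
  have "\<rho> ?w \<le> (a / (a + b)) * \<rho> ?u + (b / (a + b)) * \<rho> ?v"
    using ab by (intro conv in_V) (auto simp: add_divide_distrib[symmetric])
  also have "\<dots> \<le> (a / (a + b)) * 1 + (b / (a + b)) * 1"
    using ab e uv by (intro add_mono mult_left_mono unit) (auto simp: a_def b_def)
  also have "\<dots> = 1" using ab by (simp add: add_divide_distrib[symmetric])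
  finally have w1: "\<rho> ?w \<le> 1" .
  have "(\<lambda>x. u x + v x) = (\<lambda>x. (a + b) * ?w x)"
  proof
    fix x
    have "a / (a + b) * (1 / a * u x) = u x / (a + b)" "b / (a + b) * (1 / b * v x) = v x / (a + b)"
      using ab by simp_all
    then show "u x + v x = (a + b) * ?w x" using ab by (simp add: add_divide_distrib[symmetric])
  qed
  then have "\<rho> (\<lambda>x. u x + v x) = (a + b) powr p * \<rho> ?w" using hom[OF w, of "a + b"] ab by simp
  also have "\<dots> \<le> (a + b) powr p * 1" using w1 by (intro mult_left_mono) auto
  finally have "\<rho> (\<lambda>x. u x + v x) \<le> (a + b) powr p" by simp
  moreover have "0 \<le> \<rho> (\<lambda>x. u x + v x)" using uv V by (intro nonneg fun_spaceD(3))
  ultimately have "\<rho> (\<lambda>x. u x + v x) powr (1 / p) \<le> ((a + b) powr p) powr (1 / p)"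
    using p by (intro powr_mono2) auto
  also have "\<dots> = a + b" using p ab by (simp add: powr_powr)
  finally show "\<rho> (\<lambda>x. u x + v x) powr (1 / p) \<le> \<rho> u powr (1 / p) + \<rho> v powr (1 / p) + e"
    by (simp add: a_def b_def)
qed

text \<open>Extends convexity of \<open>x powr p\<close> from the open half-line to \<open>0\<close>.\<close>

lemma powr_convex_nonneg:
  fixes p :: real
  assumes p: "p \<ge> 1" and "a \<ge> 0" "b \<ge> 0" "a + b = 1" "s \<ge> 0" "t \<ge> 0"
  shows "(a * s + b * t) powr p \<le> a * s powr p + b * t powr p"
proof -
  have shrink: "(c * r) powr p \<le> c * r powr p" if "0 \<le> c" "c \<le> 1" "r \<ge> 0" for c r :: real
  proof -
    have "c powr p \<le> c"
    proof (cases "c = 0")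
      case False
      then show ?thesis using powr_le_one_le[of c p] that p by simp
    qed (use p in simp)
    then show ?thesis using that by (simp add: powr_mult mult_right_mono)
  qed
  show ?thesis
  proof (cases "s = 0 \<or> t = 0")
    case True
    then show ?thesis using shrink[of a s] shrink[of b t] assms by auto
  next
    case False
    then show ?thesis
      using convex_onD[OF powr_convex[OF p], of b s t] assms by (simp add: eq_diff_eq[symmetric])
  qed
qed

lemma pos_part_powr_convex:
  fixes p :: real
  assumes p: "p \<ge> 1" and ab: "a \<ge> 0" "b \<ge> 0" "a + b = 1"
  shows "(max 0 (a * s + b * t)) powr p \<le> a * (max 0 s) powr p + b * (max 0 t) powr p"
proof -
  have "max 0 (a * s + b * t) \<le> a * max 0 s + b * max 0 t"
  proof (rule max.boundedI)
    show "0 \<le> a * max 0 s + b * max 0 t" using ab by simp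
    show "a * s + b * t \<le> a * max 0 s + b * max 0 t" using ab by (intro add_mono mult_left_mono) auto
  qed
  then have "(max 0 (a * s + b * t)) powr p \<le> (a * max 0 s + b * max 0 t) powr p"
    using p by (intro powr_mono2) auto
  also have "\<dots> \<le> a * (max 0 s) powr p + b * (max 0 t) powr p"
    using p ab by (intro powr_convex_nonneg) auto
  finally show ?thesis .
qed

section \<open>Representation of positive functionals on Lp\<close>

lemma ennreal_powr_ennreal: "0 \<le> a \<Longrightarrow> ennreal_powr (ennreal a) r = ennreal (a powr r)"
  by (simp add: ennreal_powr_def)

lemma L_norm_nn_real:
  assumes "p > 0"
  shows "L_norm_nn M (ennreal p) (\<lambda>x. ennreal \<bar>f x\<bar>)
    = ennreal_powr (\<integral>\<^sup>+x. ennreal (\<bar>f x\<bar> powr p) \<partial>M) (1 / p)"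
  using assms by (simp add: L_norm_nn_def ennreal_powr_ennreal)

lemma L_fun_real_iff:
  assumes "p > 0"
  shows "f \<in> L_fun M (ennreal p) \<longleftrightarrow> f \<in> borel_measurable M \<and> integrable M (\<lambda>x. \<bar>f x\<bar> powr p)"
proof -
  have "ennreal_powr y r < \<infinity> \<longleftrightarrow> y < \<infinity>" for y r by (auto simp: ennreal_powr_def less_top)
  then show ?thesis
    using assms by (auto simp: L_fun_def L_norm_nn_real integrable_iff_bounded)
qed

lemma L_norm_real:
  assumes "p > 0" "f \<in> L_fun M (ennreal p)"
  shows "L_norm M (ennreal p) f = (\<integral>x. \<bar>f x\<bar> powr p \<partial>M) powr (1 / p)"
proof -
  have "integrable M (\<lambda>x. \<bar>f x\<bar> powr p)" using assms by (simp add: L_fun_real_iff)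
  then show ?thesis
    using assms(1) unfolding L_norm_def
    by (simp add: L_norm_nn_real nn_integral_eq_integral ennreal_powr_ennreal)
qed

lemma L_fun_measurable: "f \<in> L_fun M r \<Longrightarrow> f \<in> borel_measurable M"
  by (simp add: L_fun_def)

lemma L_fun_bound:
  assumes "p > 0" "g \<in> L_fun M (ennreal p)" "f \<in> borel_measurable M" "AE x in M. \<bar>f x\<bar> \<le> \<bar>g x\<bar>"
  shows "f \<in> L_fun M (ennreal p)"
  unfolding L_fun_real_iff[OF assms(1)]
proof
  note [measurable] = assms(3)
  show "integrable M (\<lambda>x. \<bar>f x\<bar> powr p)"
  proof (rule Bochner_Integration.integrable_bound)
    show "integrable M (\<lambda>x. \<bar>g x\<bar> powr p)" using assms by (simp add: L_fun_real_iff)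
    show "AE x in M. norm (\<bar>f x\<bar> powr p) \<le> norm (\<bar>g x\<bar> powr p)"
      using assms(4) by eventually_elim (use assms(1) in \<open>auto intro: powr_mono2\<close>)
  qed measurable
qed fact

lemma fun_space_L_fun:
  assumes p: "p > 0"
  shows "fun_space (L_fun M (ennreal p))"
proof -
  have "(\<lambda>x. a * f x + b * g x) \<in> L_fun M (ennreal p)"
    if fg: "f \<in> L_fun M (ennreal p)" "g \<in> L_fun M (ennreal p)" for f g a b
  proof -
    note [measurable] = fg[THEN L_fun_measurable]
    have i: "integrable M (\<lambda>x. \<bar>f x\<bar> powr p)" "integrable M (\<lambda>x. \<bar>g x\<bar> powr p)"
      using fg p by (auto simp: L_fun_real_iff)
    let ?B = "\<lambda>x. 2 powr p * (\<bar>a\<bar> powr p * \<bar>f x\<bar> powr p + \<bar>b\<bar> powr p * \<bar>g x\<bar> powr p)"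
    have "integrable M (\<lambda>x. \<bar>a * f x + b * g x\<bar> powr p)"
    proof (rule Bochner_Integration.integrable_bound)
      show "integrable M ?B" using i by simp
      show "AE x in M. norm (\<bar>a * f x + b * g x\<bar> powr p) \<le> norm (?B x)"
      proof (rule AE_I2)
        fix x
        have two: "(s + t) powr p \<le> 2 powr p * (s powr p + t powr p)" if "s \<ge> 0" "t \<ge> 0" for s t :: real
        proof -
          have "(s + t) powr p \<le> (2 * max s t) powr p" using that p by (intro powr_mono2) auto
          also have "\<dots> = 2 powr p * (max s t) powr p" using that by (simp add: powr_mult)
          also have "\<dots> \<le> 2 powr p * (s powr p + t powr p)" by (auto simp: max_def)
          finally show ?thesis .
        qed
        have "\<bar>a * f x + b * g x\<bar> powr p \<le> (\<bar>a * f x\<bar> + \<bar>b * g x\<bar>) powr p"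
          using p by (intro powr_mono2) auto
        also have "\<dots> \<le> ?B x" using two[of "\<bar>a * f x\<bar>" "\<bar>b * g x\<bar>"] by (simp add: abs_mult powr_mult)
        finally show "norm (\<bar>a * f x + b * g x\<bar> powr p) \<le> norm (?B x)" by simp
      qed
    qed measurable
    then show ?thesis using p by (simp add: L_fun_real_iff)
  qed
  moreover have "(\<lambda>_. 0) \<in> L_fun M (ennreal p)" using p by (simp add: L_fun_real_iff)
  ultimately show ?thesis unfolding fun_space_def by blast
qed

text \<open>The right-hand side of the bound vanishes on \<open>f \<le> 0\<close>, so \<open>\<Phi>\<close> is positive, and it is continuous under
dominated convergence. With \<open>h > 0\<close> in \<open>L\<^sup>p\<close>, which exists by \<open>\<sigma>\<close>-finiteness, \<open>A \<mapsto> \<Phi>(1\<^sub>A h)\<close> is therefore a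
finite measure, absolutely continuous with respect to \<open>M\<close>; its density divided by \<open>h\<close> represents \<open>\<Phi>\<close>.\<close>

lemma positive_functional_representation:
  assumes sf: "sigma_finite_measure M" and p: "p \<ge> 1"
    and lin: "linear_on_fun (L_fun M (ennreal p)) \<Phi>"
    and bd: "\<And>f. f \<in> L_fun M (ennreal p) \<Longrightarrow> \<Phi> f \<le> C * (\<integral>x. (max 0 (f x)) powr p \<partial>M) powr (1 / p)"
  obtains v where "v \<in> borel_measurable M"
    "\<And>f. f \<in> L_fun M (ennreal p) \<Longrightarrow> integrable M (\<lambda>x. f x * v x) \<and> \<Phi> f = (\<integral>x. f x * v x \<partial>M)"
proof -
  interpret sigma_finite_measure M by fact
  let ?V = "L_fun M (ennreal p)"
  have p0: "p > 0" using p by simp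
  note Vsp = fun_space_L_fun[OF p0, of M]
  obtain h0 :: "'a \<Rightarrow> real" where h0: "h0 \<in> borel_measurable M" "\<And>x. h0 x > 0" "integrable M h0"
    using obtain_positive_integrable_function by metis
  define h where "h x = h0 x powr (1 / p)" for x
  note [measurable] = h0(1)
  have h [measurable]: "h \<in> borel_measurable M" unfolding h_def by measurable
  have hpos: "h x > 0" for x using h0(2)[of x] by (simp add: h_def)
  have hp: "h x powr p = h0 x" for x using h0(2)[of x] p by (simp add: h_def powr_powr)
  have hV: "h \<in> ?V" using h0(3) hpos by (simp add: L_fun_real_iff[OF p0] hp abs_of_pos)
  have pos: "0 \<le> \<Phi> f" if f: "f \<in> ?V" "\<And>x. x \<in> space M \<Longrightarrow> 0 \<le> f x" for f
  proof -
    have "(\<integral>x. (max 0 (- f x)) powr p \<partial>M) = (\<integral>x. 0 \<partial>M)"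
      by (rule Bochner_Integration.integral_cong) (use f(2) in \<open>auto simp: max_def intro: antisym\<close>)
    then have "\<Phi> (\<lambda>x. - f x) \<le> 0" using bd[OF fun_spaceD(6)[OF Vsp f(1)]] by simp
    then show ?thesis using linear_on_funD(5)[OF lin f(1)] by simp
  qed
  have cont: "(\<lambda>n. \<Phi> (f n)) \<longlonglongrightarrow> 0"
    if f: "\<And>n. f n \<in> ?V" "F \<in> ?V" "\<And>n x. x \<in> space M \<Longrightarrow> 0 \<le> f n x"
      "\<And>n x. x \<in> space M \<Longrightarrow> f n x \<le> F x" "\<And>x. x \<in> space M \<Longrightarrow> (\<lambda>n. f n x) \<longlonglongrightarrow> 0"
    for f :: "nat \<Rightarrow> 'a \<Rightarrow> real" and F
  proof -
    note [measurable] = L_fun_measurable[OF f(1)]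
    have "(\<lambda>n. \<integral>x. (max 0 (f n x)) powr p \<partial>M) \<longlonglongrightarrow> (\<integral>x. 0 \<partial>M)"
    proof (rule integral_dominated_convergence[where w = "\<lambda>x. \<bar>F x\<bar> powr p"])
      show "integrable M (\<lambda>x. \<bar>F x\<bar> powr p)" using f(2) by (simp add: L_fun_real_iff[OF p0])
      show "AE x in M. (\<lambda>n. (max 0 (f n x)) powr p) \<longlonglongrightarrow> 0"
      proof (rule AE_I2)
        fix x assume x: "x \<in> space M"
        have "(\<lambda>n. (f n x) powr p) \<longlonglongrightarrow> 0"
          by (rule tendsto_zero_powrI[OF f(5)[OF x] tendsto_const]) (use p0 f(3)[OF x] in auto)
        moreover have "max 0 (f n x) = f n x" for n using f(3)[OF x] by simp
        ultimately show "(\<lambda>n. (max 0 (f n x)) powr p) \<longlonglongrightarrow> 0" by simp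
      qed
      show "AE x in M. norm (max 0 (f n x) powr p) \<le> \<bar>F x\<bar> powr p" for n
      proof (rule AE_I2)
        fix x assume x: "x \<in> space M"
        have "max 0 (f n x) \<le> \<bar>F x\<bar>" using f(3,4)[OF x, of n] by auto
        then show "norm (max 0 (f n x) powr p) \<le> \<bar>F x\<bar> powr p" using p0 by (auto intro: powr_mono2)
      qed
    qed measurable
    then have "(\<lambda>n. C * (\<integral>x. (max 0 (f n x)) powr p \<partial>M) powr (1 / p)) \<longlonglongrightarrow> C * 0"
      using p0 by (intro tendsto_mult tendsto_const tendsto_zero_powrI[OF _ tendsto_const])
        (auto intro!: always_eventually)
    then have lim: "(\<lambda>n. C * (\<integral>x. (max 0 (f n x)) powr p \<partial>M) powr (1 / p)) \<longlonglongrightarrow> 0" by simp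
    show ?thesis
      by (rule tendsto_sandwich[OF _ _ tendsto_const lim])
        (use pos[OF f(1) f(3)] bd[OF f(1)] in \<open>auto intro!: always_eventually\<close>)
  qed
  have indV: "(\<lambda>x. indicator A x * h x) \<in> ?V" if [measurable]: "A \<in> sets M" for A
    by (rule L_fun_bound[OF p0 hV]) (use hpos in \<open>auto split: split_indicator\<close>)
  have subV: "(\<lambda>x. w x * h x) \<in> ?V"
    if "(\<lambda>x. u x * h x) \<in> ?V" and [measurable]: "w \<in> borel_measurable M"
      and le: "\<And>x. x \<in> space M \<Longrightarrow> 0 \<le> w x \<and> w x \<le> u x" for u w
  proof (rule L_fun_bound[OF p0 that(1)])
    show "AE x in M. \<bar>w x * h x\<bar> \<le> \<bar>u x * h x\<bar>"
    proof (rule AE_I2)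
      fix x assume "x \<in> space M"
      then show "\<bar>w x * h x\<bar> \<le> \<bar>u x * h x\<bar>"
        using le[of x] hpos[of x] by (simp add: abs_mult mult_right_mono)
    qed
  qed measurable
  define \<nu> where "\<nu> A = ennreal (\<Phi> (\<lambda>x. indicator A x * h x))" for A
  have \<nu>pos: "0 \<le> \<Phi> (\<lambda>x. indicator A x * h x)" if "A \<in> sets M" for A
    by (rule pos[OF indV[OF that]]) (use hpos in \<open>auto simp: less_imp_le\<close>)
  have \<Phi>0: "\<Phi> (\<lambda>_. 0) = 0" using linear_on_funD(4)[OF lin fun_spaceD(1)[OF Vsp], of 0] by simp
  have posi: "positive (sets M) \<nu>" by (simp add: positive_def \<nu>_def \<Phi>0)
  have "additive (sets M) \<nu>"
    unfolding additive_def
  proof (intro ballI impI)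
    fix A B assume AB: "A \<in> sets M" "B \<in> sets M" "A \<inter> B = {}"
    have "(\<lambda>x. indicator (A \<union> B) x * h x) = (\<lambda>x. indicator A x * h x + indicator B x * h x)"
      using AB(3) by (intro ext) (auto split: split_indicator)
    then have "\<Phi> (\<lambda>x. indicator (A \<union> B) x * h x) = \<Phi> (\<lambda>x. indicator A x * h x) + \<Phi> (\<lambda>x. indicator B x * h x)"
      using linear_on_funD(2)[OF lin indV[OF AB(1)] indV[OF AB(2)]] by simp
    then show "\<nu> (A \<union> B) = \<nu> A + \<nu> B" using \<nu>pos AB by (simp add: \<nu>_def ennreal_plus)
  qed
  then have ca: "countably_additive (sets M) \<nu>"
  proof (rule sets.empty_continuous_imp_countably_additive[OF posi])
    show "\<forall>A\<in>sets M. \<nu> A \<noteq> \<infinity>" by (simp add: \<nu>_def)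
    fix A :: "nat \<Rightarrow> 'a set" assume A: "range A \<subseteq> sets M" "decseq A" "(\<Inter>i. A i) = {}"
    have "(\<lambda>n. \<Phi> (\<lambda>x. indicator (A n) x * h x)) \<longlonglongrightarrow> 0"
    proof (rule cont[OF _ hV])
      fix x
      obtain m where m: "x \<notin> A m" using A(3) by blast
      have "\<forall>n\<ge>m. indicator (A n) x * h x = 0" using m A(2) by (auto simp: decseq_def indicator_def)
      then show "(\<lambda>n. indicator (A n) x * h x) \<longlonglongrightarrow> 0"
        by (intro tendsto_eventually) (auto simp: eventually_sequentially)
    qed (use indV A(1) hpos in \<open>auto simp: less_imp_le split: split_indicator\<close>)
    then show "(\<lambda>i. \<nu> (A i)) \<longlonglongrightarrow> 0" unfolding \<nu>_def using tendsto_ennrealI by fastforce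
  qed
  define N where "N = measure_of (space M) (sets M) \<nu>"
  have sN: "sets N = sets M" by (simp add: N_def)
  have eN: "emeasure N A = \<nu> A" if "A \<in> sets M" for A
    unfolding N_def using that by (intro emeasure_measure_of_sigma[OF _ posi ca]) (auto simp: sets.sigma_algebra_axioms)
  have "absolutely_continuous M N"
    unfolding absolutely_continuous_def
  proof
    fix A assume A: "A \<in> null_sets M"
    then have [measurable]: "A \<in> sets M" by auto
    have "(\<integral>x. (max 0 (indicator A x * h x)) powr p \<partial>M) = (\<integral>x. 0 \<partial>M)"
      by (rule integral_cong_AE) (use AE_not_in[OF A] in \<open>auto elim!: eventually_mono\<close>)
    then have "\<Phi> (\<lambda>x. indicator A x * h x) \<le> 0" using bd[OF indV[of A]] by simp
    then show "A \<in> null_sets N" using eN[of A] sN by (simp add: null_sets_def \<nu>_def ennreal_neg)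
  qed
  then obtain g where g [measurable]: "g \<in> borel_measurable M" and gN: "density M g = N"
    using Radon_Nikodym sN by blast
  have "(\<integral>\<^sup>+x. g x \<partial>M) = emeasure (density M g) (space M)" by (simp add: emeasure_density cong: nn_integral_cong)
  also have "\<dots> = \<nu> (space M)" by (simp add: gN eN)
  finally have "(\<integral>\<^sup>+x. g x \<partial>M) \<noteq> \<infinity>" by (simp add: \<nu>_def)
  then have gfin: "AE x in M. g x \<noteq> \<infinity>" by (rule nn_integral_PInf_AE[OF g])
  define v where "v x = enn2real (g x) / h x" for x
  have v [measurable]: "v \<in> borel_measurable M" unfolding v_def by measurable
  \<comment> \<open>Approximation by simple functions is carried out for \<open>f / h\<close>, as indicators themselves need not
    lie in \<open>L\<^sup>p\<close>.\<close>
  have nn: "(\<integral>\<^sup>+x. ennreal (u x) * g x \<partial>M) = ennreal (\<Phi> (\<lambda>x. u x * h x))"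
    if u: "u \<in> borel_measurable M" "\<And>x. 0 \<le> u x" "(\<lambda>x. u x * h x) \<in> ?V" for u
    using u
  proof (induction rule: borel_measurable_induct_real)
    case (set A)
    have "(\<integral>\<^sup>+x. ennreal (indicator A x) * g x \<partial>M) = emeasure (density M g) A"
      using set(1) by (simp add: emeasure_density ennreal_indicator mult.commute)
    then show ?case using set(1) by (simp add: gN eN \<nu>_def)
  next
    case (mult u c)
    show ?case
    proof (cases "c = 0")
      case True
      then show ?thesis using \<Phi>0 by simp
    next
      case False
      then have uV: "(\<lambda>x. u x * h x) \<in> ?V"
        using fun_spaceD(5)[OF Vsp mult.prems, of "1 / c"] by (simp add: mult.assoc)
      have "(\<integral>\<^sup>+x. ennreal (c * u x) * g x \<partial>M) = (\<integral>\<^sup>+x. ennreal c * (ennreal (u x) * g x) \<partial>M)"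
        using mult by (simp add: ennreal_mult mult.assoc)
      also have "\<dots> = ennreal c * (\<integral>\<^sup>+x. ennreal (u x) * g x \<partial>M)"
        by (rule nn_integral_cmult) (use mult(2) g in simp)
      also have "\<dots> = ennreal (c * \<Phi> (\<lambda>x. u x * h x))"
        using mult.IH[OF uV] mult(1) by (simp add: ennreal_mult')
      also have "c * \<Phi> (\<lambda>x. u x * h x) = \<Phi> (\<lambda>x. c * u x * h x)"
        using linear_on_funD(4)[OF lin uV, of c] by (simp add: mult.assoc)
      finally show ?thesis .
    qed
  next
    case (add u w)
    note [measurable] = add.hyps(1,3)
    have uV: "(\<lambda>x. u x * h x) \<in> ?V"
      by (rule subV[OF add.prems]) (use add.hyps(1-4) in auto)
    have wV: "(\<lambda>x. w x * h x) \<in> ?V"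
      by (rule subV[OF add.prems]) (use add.hyps(1-4) in auto)
    have "(\<integral>\<^sup>+x. ennreal (w x + u x) * g x \<partial>M) = (\<integral>\<^sup>+x. ennreal (w x) * g x + ennreal (u x) * g x \<partial>M)"
      using add.hyps(2,4) by (simp add: ennreal_plus distrib_right)
    also have "\<dots> = (\<integral>\<^sup>+x. ennreal (w x) * g x \<partial>M) + (\<integral>\<^sup>+x. ennreal (u x) * g x \<partial>M)"
      by (rule nn_integral_add) (use add.hyps(1,3) g in simp_all)
    also have "\<dots> = ennreal (\<Phi> (\<lambda>x. w x * h x) + \<Phi> (\<lambda>x. u x * h x))"
      using add.IH(1)[OF uV] add.IH(2)[OF wV] pos[OF uV] pos[OF wV] add.hyps(2,4) hpos
      by (simp add: ennreal_plus less_imp_le)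
    also have "\<Phi> (\<lambda>x. w x * h x) + \<Phi> (\<lambda>x. u x * h x) = \<Phi> (\<lambda>x. (w x + u x) * h x)"
      using linear_on_funD(2)[OF lin wV uV] by (simp add: distrib_right)
    finally show ?case .
  next
    case (seq U)
    note [measurable] = seq.hyps(1)
    have Ule: "U i x \<le> u x" if "x \<in> space M" for i x
      using seq.hyps(3,4) that by (intro incseq_le) (auto simp: incseq_def le_fun_def)
    have UV: "(\<lambda>x. U i x * h x) \<in> ?V" for i
      by (rule subV[OF seq.prems]) (use Ule seq.hyps(1,2) in auto)
    have dV: "(\<lambda>x. u x * h x - U i x * h x) \<in> ?V" for i by (rule fun_spaceD(4)[OF Vsp seq.prems UV])
    have "(\<lambda>i. \<Phi> (\<lambda>x. u x * h x - U i x * h x)) \<longlonglongrightarrow> 0"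
    proof (rule cont[OF dV seq.prems])
      fix i x assume x: "x \<in> space M"
      show "0 \<le> u x * h x - U i x * h x" using Ule[OF x] hpos[of x] by (simp add: mult_right_mono less_imp_le)
      show "u x * h x - U i x * h x \<le> u x * h x" using seq.hyps(2) hpos[of x] by (simp add: less_imp_le)
    next
      fix x assume x: "x \<in> space M"
      have "(\<lambda>i. u x * h x - U i x * h x) \<longlonglongrightarrow> u x * h x - u x * h x"
        by (intro tendsto_intros seq.hyps(4) x)
      then show "(\<lambda>i. u x * h x - U i x * h x) \<longlonglongrightarrow> 0" by simp
    qed
    then have "(\<lambda>i. \<Phi> (\<lambda>x. u x * h x) - \<Phi> (\<lambda>x. U i x * h x)) \<longlonglongrightarrow> 0"
      using linear_on_funD(3)[OF lin seq.prems UV] by simp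
    then have "(\<lambda>i. \<Phi> (\<lambda>x. U i x * h x)) \<longlonglongrightarrow> \<Phi> (\<lambda>x. u x * h x)"
      by (rule Lim_transform2[OF tendsto_const])
    then have 1: "(\<lambda>i. ennreal (\<Phi> (\<lambda>x. U i x * h x))) \<longlonglongrightarrow> ennreal (\<Phi> (\<lambda>x. u x * h x))"
      by (rule tendsto_ennrealI)
    let ?f = "\<lambda>i x. ennreal (U i x) * g x * indicator (space M) x"
    have "(\<lambda>i. \<integral>\<^sup>+x. ?f i x \<partial>M) \<longlonglongrightarrow> (\<integral>\<^sup>+x. ennreal (u x) * g x * indicator (space M) x \<partial>M)"
    proof (rule nn_integral_LIMSEQ)
      show "incseq ?f" using seq.hyps(3) by (auto simp: incseq_def le_fun_def intro!: mult_right_mono ennreal_leI)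
      fix x
      show "(\<lambda>i. ?f i x) \<longlonglongrightarrow> ennreal (u x) * g x * indicator (space M) x"
      proof (cases "x \<in> space M")
        case True
        have "(\<lambda>i. ennreal (U i x)) \<longlonglongrightarrow> ennreal (u x)" using seq.hyps(4)[OF True] by (rule tendsto_ennrealI)
        moreover have "incseq (\<lambda>i. ennreal (U i x))" using seq.hyps(3) by (auto simp: incseq_def le_fun_def intro!: ennreal_leI)
        ultimately have "(SUP i. ennreal (U i x)) = ennreal (u x)" by (metis LIMSEQ_SUP LIMSEQ_unique)
        then have "(SUP i. ennreal (U i x) * g x) = ennreal (u x) * g x" by (simp add: SUP_mult_right_ennreal[symmetric])
        moreover have "incseq (\<lambda>i. ennreal (U i x) * g x)"
          using seq.hyps(3) by (auto simp: incseq_def le_fun_def intro!: ennreal_leI mult_right_mono)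
        ultimately show ?thesis using True LIMSEQ_SUP by fastforce
      qed simp
    qed measurable
    then have 2: "(\<lambda>i. \<integral>\<^sup>+x. ennreal (U i x) * g x \<partial>M) \<longlonglongrightarrow> (\<integral>\<^sup>+x. ennreal (u x) * g x \<partial>M)"
      by (simp cong: nn_integral_cong)
    show ?case using LIMSEQ_unique[OF 2] 1 seq.IH[OF UV] by simp
  qed
  have rep: "integrable M (\<lambda>x. f x * v x) \<and> \<Phi> f = (\<integral>x. f x * v x \<partial>M)"
    if f: "f \<in> ?V" "\<And>x. 0 \<le> f x" for f
  proof -
    note [measurable] = L_fun_measurable[OF f(1)]
    have hne: "h x \<noteq> 0" for x using hpos[of x] by simp
    have hh: "f x / h x * h x = f x" for x using hne[of x] by simp
    have "(\<integral>\<^sup>+x. ennreal (f x / h x) * g x \<partial>M) = ennreal (\<Phi> (\<lambda>x. f x / h x * h x))"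
    proof (rule nn)
      show "(\<lambda>x. f x / h x) \<in> borel_measurable M" by measurable
      show "0 \<le> f x / h x" for x using f(2)[of x] hpos[of x] by simp
      show "(\<lambda>x. f x / h x * h x) \<in> ?V" unfolding hh by (rule f(1))
    qed
    moreover have "(\<integral>\<^sup>+x. ennreal (f x / h x) * g x \<partial>M) = (\<integral>\<^sup>+x. ennreal (f x * v x) \<partial>M)"
    proof (rule nn_integral_cong_AE, use gfin in eventually_elim)
      case (elim x)
      then obtain r where r: "g x = ennreal r" "0 \<le> r" by (cases "g x") auto
      have "0 \<le> f x / h x" using f(2)[of x] hpos[of x] by simp
      then show ?case using r by (simp add: v_def ennreal_mult[symmetric])
    qed
    ultimately have "(\<integral>\<^sup>+x. ennreal (f x * v x) \<partial>M) = ennreal (\<Phi> f)" by (simp add: hne)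
    moreover have "0 \<le> f x * v x" for x using f(2)[of x] hpos[of x] by (simp add: v_def less_imp_le)
    ultimately show ?thesis
      using nn_integral_eq_integrable[of "\<lambda>x. f x * v x" M "\<Phi> f"] pos[OF f(1)] f(2) by auto
  qed
  show thesis
  proof (rule that[OF v])
    fix f assume f: "f \<in> ?V"
    note [measurable] = L_fun_measurable[OF f]
    have fp: "(\<lambda>x. max 0 (f x)) \<in> ?V" "(\<lambda>x. max 0 (- f x)) \<in> ?V"
      by (rule L_fun_bound[OF p0 f]; auto)+
    have fd: "(\<lambda>x. max 0 (f x) - max 0 (- f x)) = f" by auto
    have "f x * v x = max 0 (f x) * v x - max 0 (- f x) * v x" for x
      by (simp add: max_def)
    moreover have "\<Phi> f = \<Phi> (\<lambda>x. max 0 (f x)) - \<Phi> (\<lambda>x. max 0 (- f x))"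
      using linear_on_funD(3)[OF lin fp] fd by simp
    ultimately show "integrable M (\<lambda>x. f x * v x) \<and> \<Phi> f = (\<integral>x. f x * v x \<partial>M)"
      using rep[OF fp(1)] rep[OF fp(2)] by simp
  qed
qed

section \<open>Functionals on finite products of Lp spaces\<close>

text \<open>The step by which testing a functional on \<open>\<bar>v\<bar>\<^bsup>q-1\<^esup> sgn v\<close> bounds the norm of \<open>v\<close>: there \<open>a\<close> is
\<open>\<integral>\<bar>v\<bar>\<^sup>q\<close>, and \<open>(p - 1) / p\<close> is \<open>1 / q\<close>.\<close>

lemma self_bound_power:
  fixes a C p :: real
  assumes p: "p > 1" and a: "0 \<le> a" "a \<le> C * a powr (1 / p)" and C: "0 \<le> C"
  shows "a powr ((p - 1) / p) \<le> C" "a \<le> C powr (p / (p - 1))"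
proof -
  show *: "a powr ((p - 1) / p) \<le> C"
  proof (cases "a = 0")
    case False
    then have a0: "a > 0" using a by simp
    have "a powr ((p - 1) / p) * a powr (1 / p) = a powr ((p - 1) / p + 1 / p)" by (rule powr_add[symmetric])
    also have "(p - 1) / p + 1 / p = 1" using p by (simp add: field_simps)
    finally have "a powr ((p - 1) / p) * a powr (1 / p) \<le> C * a powr (1 / p)" using a a0 by simp
    then show ?thesis using a0 by (simp add: mult_le_cancel_right)
  qed (use C in simp)
  have "a = (a powr ((p - 1) / p)) powr (p / (p - 1))" using p a by (simp add: powr_powr)
  also have "\<dots> \<le> C powr (p / (p - 1))" using * p by (intro powr_mono2) auto
  finally show "a \<le> C powr (p / (p - 1))" .
qed

lemma sgn_powr_powr:
  fixes m v p q :: real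
  assumes "p > 1" "q = p / (p - 1)" "0 \<le> m" "v = 0 \<Longrightarrow> m = 0"
  shows "\<bar>m powr (q - 1) * sgn v\<bar> powr p = m powr q"
proof (cases "v = 0")
  case False
  have "q - 1 = 1 / (p - 1)" using assms(1,2) by (simp add: field_simps)
  then have "(q - 1) * p = q" using assms(2) by simp
  then show ?thesis using False by (simp add: abs_mult powr_powr abs_sgn_eq)
qed (use assms in simp)

text \<open>The extremal test function \<open>\<bar>v\<bar>\<^bsup>q-1\<^esup> sgn v\<close> is not known to lie in \<open>L\<^sup>p\<close> before the conclusion is
proved, so \<open>\<bar>v\<bar>\<close> is first cut off at \<open>n h\<^sub>0\<^bsup>1/q\<^esup>\<close> with \<open>h\<^sub>0 > 0\<close> integrable. The resulting bounds do not
depend on \<open>n\<close>, and Fatou's lemma removes the cut-off.\<close>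

lemma dual_exponent_integrable:
  assumes sf: "sigma_finite_measure M" and p: "p > 1" and q: "q = p / (p - 1)"
    and v [measurable]: "v \<in> borel_measurable M" and C: "C \<ge> 0"
    and bd: "\<And>f. f \<in> L_fun M (ennreal p) \<Longrightarrow> integrable M (\<lambda>x. f x * v x) \<and>
        (\<integral>x. f x * v x \<partial>M) \<le> C * (\<integral>x. \<bar>f x\<bar> powr p \<partial>M) powr (1 / p)"
  shows "integrable M (\<lambda>x. \<bar>v x\<bar> powr q)"
proof -
  interpret sigma_finite_measure M by fact
  have p0: "p > 0" using p by simp
  have q1: "q > 1" unfolding q using p by (simp add: less_divide_eq)
  have pq: "(p - 1) * q = p" using p q by simp
  obtain h0 :: "'a \<Rightarrow> real" where h0: "h0 \<in> borel_measurable M" "\<And>x. h0 x > 0" "integrable M h0"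
    using obtain_positive_integrable_function by metis
  note [measurable] = h0(1)
  define m where "m n x = min \<bar>v x\<bar> (real n * h0 x powr (1 / q))" for n x
  have m [measurable]: "m n \<in> borel_measurable M" for n unfolding m_def by measurable
  have m0: "0 \<le> m n x" "m n x \<le> \<bar>v x\<bar>" for n x by (auto simp: m_def)
  have int: "integrable M (\<lambda>x. m n x powr q)" for n
  proof (rule Bochner_Integration.integrable_bound)
    show "integrable M (\<lambda>x. real n powr q * h0 x)" using h0(3) by simp
    show "AE x in M. norm (m n x powr q) \<le> norm (real n powr q * h0 x)"
    proof (rule AE_I2)
      fix x
      have "m n x powr q \<le> (real n * h0 x powr (1 / q)) powr q"
        using m0 q1 by (intro powr_mono2) (auto simp: m_def)
      also have "\<dots> = real n powr q * h0 x" using h0(2)[of x] q1 by (simp add: powr_mult powr_powr)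
      finally show "norm (m n x powr q) \<le> norm (real n powr q * h0 x)" using h0(2)[of x] by simp
    qed
  qed measurable
  have bound: "(\<integral>x. m n x powr q \<partial>M) \<le> C powr q" for n
  proof -
    define f where "f x = m n x powr (q - 1) * sgn (v x)" for x
    have [measurable]: "f \<in> borel_measurable M" unfolding f_def by measurable
    have fp: "\<bar>f x\<bar> powr p = m n x powr q" for x
      unfolding f_def using m0[of n x] p q by (intro sgn_powr_powr) auto
    have fV: "f \<in> L_fun M (ennreal p)" using int by (simp add: L_fun_real_iff[OF p0] fp)
    have "(\<integral>x. m n x powr q \<partial>M) \<le> (\<integral>x. f x * v x \<partial>M)"
    proof (rule integral_mono[OF int])
      show "integrable M (\<lambda>x. f x * v x)" using bd[OF fV] by blast
      fix x
      have "m n x powr q = m n x powr (q - 1) * m n x"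
        using m0(1)[of n x] powr_add[of "m n x" "q - 1" 1] by simp
      also have "\<dots> \<le> m n x powr (q - 1) * \<bar>v x\<bar>" using m0(2) by (intro mult_left_mono) auto
      also have "\<dots> = f x * v x" by (simp add: f_def mult.assoc sgn_mult_self_eq abs_sgn mult.commute[of "sgn _"])
      finally show "m n x powr q \<le> f x * v x" .
    qed
    also have "\<dots> \<le> C * (\<integral>x. m n x powr q \<partial>M) powr (1 / p)" using bd[OF fV] by (simp add: fp)
    finally show ?thesis using p C q by (intro self_bound_power(2)[of p, folded q]) (auto intro: integral_nonneg_AE)
  qed
  \<comment> \<open>Since \<open>h0 > 0\<close>, the cut-off is inactive at each point for large \<open>n\<close>.\<close>
  have "(\<integral>\<^sup>+x. ennreal (\<bar>v x\<bar> powr q) \<partial>M) = (\<integral>\<^sup>+x. liminf (\<lambda>n. ennreal (m n x powr q)) \<partial>M)"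
  proof (rule nn_integral_cong)
    fix x
    obtain k :: nat where k: "\<bar>v x\<bar> / h0 x powr (1 / q) \<le> real k" using real_arch_simple by blast
    have hp: "h0 x powr (1 / q) > 0" using h0(2)[of x] by simp
    have "m n x = \<bar>v x\<bar>" if "n \<ge> k" for n
    proof -
      have "\<bar>v x\<bar> / h0 x powr (1 / q) \<le> real n" using k that by linarith
      then show ?thesis using hp by (simp add: m_def pos_divide_le_eq)
    qed
    then have "(\<lambda>n. ennreal (m n x powr q)) \<longlonglongrightarrow> ennreal (\<bar>v x\<bar> powr q)"
      by (intro tendsto_eventually) (auto simp: eventually_sequentially intro!: exI[of _ k])
    then show "ennreal (\<bar>v x\<bar> powr q) = liminf (\<lambda>n. ennreal (m n x powr q))"
      by (rule lim_imp_Liminf[OF sequentially_bot, symmetric])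
  qed
  also have "\<dots> \<le> liminf (\<lambda>n. \<integral>\<^sup>+x. ennreal (m n x powr q) \<partial>M)"
    by (rule nn_integral_liminf) measurable
  also have "\<dots> \<le> ennreal (C powr q)"
  proof -
    have "(\<integral>\<^sup>+x. ennreal (m n x powr q) \<partial>M) \<le> ennreal (C powr q)" for n
      using bound[of n] int[of n] by (subst nn_integral_eq_integral) (auto intro: ennreal_leI)
    then show ?thesis by (intro Liminf_le always_eventually) auto
  qed
  finally show ?thesis by (simp add: integrable_iff_bounded le_less_trans)
qed

text \<open>For \<open>p = 1\<close> the test function is \<open>sgn v\<close> times a positive integrable function on \<open>{\<bar>v\<bar> > C}\<close>; it
contradicts the bound unless that set is null.\<close>

lemma dual_exponent_bounded:
  assumes sf: "sigma_finite_measure M"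
    and v [measurable]: "v \<in> borel_measurable M" and C: "C \<ge> 0"
    and bd: "\<And>f. f \<in> L_fun M (ennreal 1) \<Longrightarrow> integrable M (\<lambda>x. f x * v x) \<and>
        (\<integral>x. f x * v x \<partial>M) \<le> C * (\<integral>x. \<bar>f x\<bar> \<partial>M)"
  shows "AE x in M. \<bar>v x\<bar> \<le> C"
proof -
  interpret sigma_finite_measure M by fact
  obtain h :: "'a \<Rightarrow> real" where h: "h \<in> borel_measurable M" "\<And>x. h x > 0" "integrable M h"
    using obtain_positive_integrable_function by metis
  note [measurable] = h(1)
  define b where "b x = (if C < \<bar>v x\<bar> then h x else 0)" for x
  have [measurable]: "b \<in> borel_measurable M" unfolding b_def by measurable
  define f where "f x = b x * sgn (v x)" for x
  have [measurable]: "f \<in> borel_measurable M" unfolding f_def by measurable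
  have fb: "\<bar>f x\<bar> = b x" for x using h(2)[of x] C by (auto simp: f_def b_def abs_mult abs_sgn_eq)
  have bint: "integrable M b"
    by (rule Bochner_Integration.integrable_bound[OF h(3)]) (use h(2) in \<open>auto simp: b_def less_imp_le\<close>)
  have b0: "b x \<ge> 0" for x using h(2)[of x] by (simp add: b_def)
  have fV: "f \<in> L_fun M (ennreal 1)" using bint b0 L_fun_real_iff[of 1 f M] by (simp add: fb)
  have fv: "f x * v x = b x * \<bar>v x\<bar>" for x by (simp add: f_def abs_sgn mult.assoc mult.commute[of "sgn _"])
  have i: "integrable M (\<lambda>x. b x * \<bar>v x\<bar>)" "(\<integral>x. b x * \<bar>v x\<bar> \<partial>M) \<le> C * (\<integral>x. b x \<partial>M)"
    using bd[OF fV] by (auto simp: fv fb)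
  have pos: "0 \<le> b x * \<bar>v x\<bar> - b x * C" for x
    using b0[of x] by (auto simp: b_def right_diff_distrib[symmetric] less_imp_le h(2) intro!: mult_nonneg_nonneg)
  have int: "integrable M (\<lambda>x. b x * \<bar>v x\<bar> - b x * C)" using i(1) bint by simp
  have "(\<integral>x. b x * \<bar>v x\<bar> - b x * C \<partial>M) \<le> 0" using i bint by (simp add: mult.commute)
  moreover have "(\<integral>x. b x * \<bar>v x\<bar> - b x * C \<partial>M) \<ge> 0" using pos by (intro integral_nonneg_AE) auto
  ultimately have "AE x in M. b x * \<bar>v x\<bar> - b x * C = 0"
    using integral_nonneg_eq_0_iff_AE[OF int] pos by auto
  then show ?thesis
  proof eventually_elim
    case (elim x)
    show ?case
    proof (rule ccontr)
      assume "\<not> \<bar>v x\<bar> \<le> C"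
      then have "h x * (\<bar>v x\<bar> - C) = 0" using elim by (simp add: b_def right_diff_distrib)
      then show False using h(2)[of x] \<open>\<not> \<bar>v x\<bar> \<le> C\<close> by simp
    qed
  qed
qed

text \<open>Elements of a product of \<open>L\<^sup>p\<close> spaces are functions on the disjoint union, written as functions of pairs
\<open>(i, x)\<close>. In this form the Hahn-Banach theorem for real functions applies to them directly.\<close>

definition fam_space :: "real \<Rightarrow> 'i set \<Rightarrow> ('i \<Rightarrow> 'a measure) \<Rightarrow> ('i \<times> 'a \<Rightarrow> real) set" where
  "fam_space p I M = {u. \<forall>i\<in>I. (\<lambda>x. u (i, x)) \<in> L_fun (M i) (ennreal p)}"

abbreviation fam_pairing :: "'i set \<Rightarrow> ('i \<Rightarrow> 'a measure) \<Rightarrow> ('i \<times> 'a \<Rightarrow> real) \<Rightarrow> ('i \<times> 'a \<Rightarrow> real) \<Rightarrow> real" where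
  "fam_pairing I M u v \<equiv> \<Sum>i\<in>I. \<integral>x. u (i, x) * v (i, x) \<partial>(M i)"

abbreviation fam_pos_power :: "real \<Rightarrow> 'i set \<Rightarrow> ('i \<Rightarrow> 'a measure) \<Rightarrow> ('i \<times> 'a \<Rightarrow> real) \<Rightarrow> real" where
  "fam_pos_power p I M u \<equiv> \<Sum>i\<in>I. \<integral>x. (max 0 (u (i, x))) powr p \<partial>(M i)"

definition fam_power :: "real \<Rightarrow> 'i set \<Rightarrow> ('i \<Rightarrow> 'a measure) \<Rightarrow> ('i \<times> 'a \<Rightarrow> real) \<Rightarrow> real" where
  "fam_power p I M u = (\<Sum>i\<in>I. \<integral>x. \<bar>u (i, x)\<bar> powr p \<partial>(M i))"

lemma fam_power_nonneg: "0 \<le> fam_power p I M u"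
  by (auto simp: fam_power_def intro!: sum_nonneg integral_nonneg_AE)

lemma fam_spaceD: "u \<in> fam_space p I M \<Longrightarrow> i \<in> I \<Longrightarrow> (\<lambda>x. u (i, x)) \<in> L_fun (M i) (ennreal p)"
  by (simp add: fam_space_def)

lemma fun_space_fam_space:
  assumes "p > 0"
  shows "fun_space (fam_space p I M)"
  unfolding fun_space_def
proof (intro conjI ballI allI)
  show "(\<lambda>_. 0) \<in> fam_space p I M"
    by (simp add: fam_space_def fun_spaceD(1)[OF fun_space_L_fun[OF assms]])
  fix u v a b assume uv: "u \<in> fam_space p I M" "v \<in> fam_space p I M"
  show "(\<lambda>y. a * u y + b * v y) \<in> fam_space p I M"
    unfolding fam_space_def
    using fun_spaceD(2)[OF fun_space_L_fun[OF assms] fam_spaceD[OF uv(1)] fam_spaceD[OF uv(2)]] by blast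
qed

lemma fam_pos_power_subadditive:
  fixes M :: "'i \<Rightarrow> 'a measure"
  assumes I: "finite I" and p: "p \<ge> 1" and uv: "u \<in> fam_space p I M" "v \<in> fam_space p I M"
  defines "\<rho> \<equiv> \<lambda>u. fam_pos_power p I M u"
  shows "\<rho> (\<lambda>y. u y + v y) powr (1 / p) \<le> \<rho> u powr (1 / p) + \<rho> v powr (1 / p)"
proof (rule root_of_convex_subadditive[OF fun_space_fam_space p])
  have p0: "p > 0" using p by simp
  then show "p > 0" .
  have int: "integrable (M i) (\<lambda>x. (max 0 (u (i, x))) powr p)" if "u \<in> fam_space p I M" "i \<in> I" for u i
  proof -
    have "(\<lambda>x. max 0 (u (i, x))) \<in> L_fun (M i) (ennreal p)"
      using fam_spaceD[OF that]
      by (intro L_fun_bound[OF p0 fam_spaceD[OF that]]) (auto dest!: L_fun_measurable)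
    then show ?thesis by (simp add: L_fun_real_iff[OF p0])
  qed
  show "0 \<le> \<rho> u" if "u \<in> fam_space p I M" for u
    unfolding \<rho>_def by (intro sum_nonneg integral_nonneg_AE) auto
  show "\<rho> (\<lambda>y. c * u y) = c powr p * \<rho> u" if "u \<in> fam_space p I M" "c > 0" for u c
  proof -
    have "max 0 (c * t) = c * max 0 t" for t using that(2) by (simp add: max_def zero_le_mult_iff)
    then show ?thesis using that(2) by (simp add: \<rho>_def powr_mult sum_distrib_left)
  qed
  show "\<rho> (\<lambda>y. a * u y + b * v y) \<le> a * \<rho> u + b * \<rho> v"
    if uv: "u \<in> fam_space p I M" "v \<in> fam_space p I M" and ab: "a \<ge> 0" "b \<ge> 0" "a + b = 1" for u v a b
  proof -
    have w: "(\<lambda>y. a * u y + b * v y) \<in> fam_space p I M"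
      by (rule fun_spaceD(2)[OF fun_space_fam_space[OF p0] uv])
    have "\<rho> (\<lambda>y. a * u y + b * v y) \<le> (\<Sum>i\<in>I. a * (\<integral>x. (max 0 (u (i, x))) powr p \<partial>(M i)) + b * (\<integral>x. (max 0 (v (i, x))) powr p \<partial>(M i)))"
      unfolding \<rho>_def
    proof (rule sum_mono)
      fix i assume i: "i \<in> I"
      have "(\<integral>x. (max 0 (a * u (i, x) + b * v (i, x))) powr p \<partial>(M i))
          \<le> (\<integral>x. a * (max 0 (u (i, x))) powr p + b * (max 0 (v (i, x))) powr p \<partial>(M i))"
        using int[OF w i] int[OF uv(1) i] int[OF uv(2) i] pos_part_powr_convex[OF p ab]
        by (intro integral_mono) auto
      also have "\<dots> = a * (\<integral>x. (max 0 (u (i, x))) powr p \<partial>(M i)) + b * (\<integral>x. (max 0 (v (i, x))) powr p \<partial>(M i))"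
        using int[OF uv(1) i] int[OF uv(2) i] by simp
      finally show "(\<integral>x. (max 0 (a * u (i, x) + b * v (i, x))) powr p \<partial>(M i))
          \<le> a * (\<integral>x. (max 0 (u (i, x))) powr p \<partial>(M i)) + b * (\<integral>x. (max 0 (v (i, x))) powr p \<partial>(M i))" .
    qed
    also have "\<dots> = a * \<rho> u + b * \<rho> v" by (simp add: \<rho>_def sum.distrib sum_distrib_left)
    finally show ?thesis .
  qed
qed (fact uv)+

text \<open>The extension is restricted to each factor, where positivity allows it to be represented by a
function. The restrictions determine it, because a family vanishing on all indices in \<open>I\<close> has bound \<open>0\<close>
together with its negative.\<close>

theorem positive_family_representation:
  fixes M :: "'i \<Rightarrow> 'a measure"
  assumes I: "finite I" and sf: "\<And>i. i \<in> I \<Longrightarrow> sigma_finite_measure (M i)" and p: "p \<ge> 1" and C: "C \<ge> 0"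
    and W: "fun_space W" "W \<subseteq> fam_space p I M" and T: "linear_on_fun W T"
    and TC: "\<And>u. u \<in> W \<Longrightarrow> T u \<le> C * fam_pos_power p I M u powr (1 / p)"
  obtains v where "\<And>i. i \<in> I \<Longrightarrow> (\<lambda>x. v (i, x)) \<in> borel_measurable (M i)"
    "\<And>i f. i \<in> I \<Longrightarrow> f \<in> L_fun (M i) (ennreal p) \<Longrightarrow> integrable (M i) (\<lambda>x. f x * v (i, x))"
    "\<And>u. u \<in> W \<Longrightarrow> T u = fam_pairing I M u v"
    "\<And>u. u \<in> fam_space p I M \<Longrightarrow> fam_pairing I M u v
        \<le> C * fam_pos_power p I M u powr (1 / p)"
proof -
  define \<rho> where "\<rho> u = fam_pos_power p I M u" for u :: "'i \<times> 'a \<Rightarrow> real"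
  let ?V = "fam_space p I M"
  have p0: "p > 0" using p by simp
  note Vsp = fun_space_fam_space[OF p0, of I M]
  have sub: "C * \<rho> (\<lambda>y. u y + v y) powr (1 / p) \<le> C * \<rho> u powr (1 / p) + C * \<rho> v powr (1 / p)"
    if "u \<in> ?V" "v \<in> ?V" for u v
    using fam_pos_power_subadditive[OF I p that] C
    by (simp add: \<rho>_def distrib_left[symmetric] mult_left_mono)
  have hom: "C * \<rho> (\<lambda>y. c * u y) powr (1 / p) = c * (C * \<rho> u powr (1 / p))" if "c \<ge> 0" for u c
  proof -
    have "max 0 (c * t) = c * max 0 t" for t
      using that by (auto simp: max_def zero_le_mult_iff)
    then have "\<rho> (\<lambda>y. c * u y) = c powr p * \<rho> u"
      using that by (simp add: \<rho>_def powr_mult sum_distrib_left)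
    moreover have "0 \<le> \<rho> u" unfolding \<rho>_def by (intro sum_nonneg integral_nonneg_AE) auto
    ultimately show ?thesis using that p by (simp add: powr_mult powr_powr)
  qed
  obtain \<Phi> where \<Phi>: "linear_on_fun ?V \<Phi>" "\<And>u. u \<in> W \<Longrightarrow> \<Phi> u = T u"
    "\<And>u. u \<in> ?V \<Longrightarrow> \<Phi> u \<le> C * \<rho> u powr (1 / p)"
    using Hahn_Banach_fun[OF Vsp W T, of "\<lambda>u. C * \<rho> u powr (1 / p)"] sub hom TC by (auto simp: \<rho>_def)
  define e where "e i f = (\<lambda>y::'i \<times> 'a. if fst y = i then f (snd y) else (0::real))" for i f
  have eV: "e i f \<in> ?V" if f: "i \<in> I" "f \<in> L_fun (M i) (ennreal p)" for i f
    unfolding fam_space_def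
  proof (intro CollectI ballI)
    fix j assume "j \<in> I"
    show "(\<lambda>x. e i f (j, x)) \<in> L_fun (M j) (ennreal p)"
      by (cases "j = i") (use f fun_spaceD(1)[OF fun_space_L_fun[OF p0]] in \<open>simp_all add: e_def\<close>)
  qed
  have ex: "\<exists>v. v \<in> borel_measurable (M i) \<and> (\<forall>f\<in>L_fun (M i) (ennreal p).
      integrable (M i) (\<lambda>x. f x * v x) \<and> \<Phi> (e i f) = (\<integral>x. f x * v x \<partial>(M i)))" if i: "i \<in> I" for i
  proof (rule positive_functional_representation[OF sf[OF i] p, where \<Phi> = "\<lambda>f. \<Phi> (e i f)" and C = C])
    show "linear_on_fun (L_fun (M i) (ennreal p)) (\<lambda>f. \<Phi> (e i f))"
      unfolding linear_on_fun_def
    proof (intro ballI allI)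
      fix f g a b assume fg: "f \<in> L_fun (M i) (ennreal p)" "g \<in> L_fun (M i) (ennreal p)"
      have "e i (\<lambda>x. a * f x + b * g x) = (\<lambda>y. a * e i f y + b * e i g y)" by (auto simp: e_def)
      then show "\<Phi> (e i (\<lambda>x. a * f x + b * g x)) = a * \<Phi> (e i f) + b * \<Phi> (e i g)"
        using linear_on_funD(1)[OF \<Phi>(1) eV[OF i fg(1)] eV[OF i fg(2)]] by simp
    qed
    show "\<Phi> (e i f) \<le> C * (\<integral>x. (max 0 (f x)) powr p \<partial>(M i)) powr (1 / p)"
      if f: "f \<in> L_fun (M i) (ennreal p)" for f
    proof -
      have "\<rho> (e i f) = (\<Sum>j\<in>I. if j = i then \<integral>x. (max 0 (f x)) powr p \<partial>(M i) else 0)"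
        unfolding \<rho>_def e_def by (rule sum.cong) auto
      also have "\<dots> = (\<integral>x. (max 0 (f x)) powr p \<partial>(M i))" using I i by simp
      finally show ?thesis using \<Phi>(3)[OF eV[OF i f]] by simp
    qed
  qed blast
  then obtain v' where v': "\<And>i. i \<in> I \<Longrightarrow> v' i \<in> borel_measurable (M i)"
    "\<And>i f. i \<in> I \<Longrightarrow> f \<in> L_fun (M i) (ennreal p) \<Longrightarrow>
      integrable (M i) (\<lambda>x. f x * v' i x) \<and> \<Phi> (e i f) = (\<integral>x. f x * v' i x \<partial>(M i))"
    by metis
  have parts: "(\<lambda>y. if fst y \<in> J then u y else 0) \<in> ?V \<and>
      \<Phi> (\<lambda>y. if fst y \<in> J then u y else 0) = (\<Sum>i\<in>J. \<Phi> (e i (\<lambda>x. u (i, x))))"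
    if "J \<subseteq> I" and u: "u \<in> ?V" for J u
    using finite_subset[OF that(1) I] that(1)
  proof (induction J)
    case empty
    have "\<Phi> (\<lambda>_. 0) = 0" using linear_on_funD(4)[OF \<Phi>(1) fun_spaceD(1)[OF Vsp], of 0] by simp
    then show ?case using fun_spaceD(1)[OF Vsp] by simp
  next
    case (insert i J)
    have i: "i \<in> I" and J: "J \<subseteq> I" using insert.prems by auto
    have ev: "e i (\<lambda>x. u (i, x)) \<in> ?V" by (rule eV[OF i fam_spaceD[OF u i]])
    have eq: "(\<lambda>y. if fst y \<in> insert i J then u y else 0)
        = (\<lambda>y. e i (\<lambda>x. u (i, x)) y + (if fst y \<in> J then u y else 0))"
      using insert.hyps(2) by (auto simp: e_def)
    show ?case
      using insert.IH[OF J] fun_spaceD(3)[OF Vsp ev] linear_on_funD(2)[OF \<Phi>(1) ev] insert.hyps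
      unfolding eq by simp
  qed
  have \<Phi>sum: "\<Phi> u = (\<Sum>i\<in>I. \<integral>x. u (i, x) * v' i x \<partial>(M i))" if u: "u \<in> ?V" for u
  proof -
    let ?r = "\<lambda>y. if fst y \<in> I then u y else 0"
    let ?z = "\<lambda>y. u y - ?r y"
    have rV: "?r \<in> ?V" and \<Phi>r: "\<Phi> ?r = (\<Sum>i\<in>I. \<Phi> (e i (\<lambda>x. u (i, x))))" using parts[OF order_refl u] by auto
    have zV: "?z \<in> ?V" by (rule fun_spaceD(4)[OF Vsp u rV])
    have "\<rho> ?z = 0" "\<rho> (\<lambda>y. - ?z y) = 0" unfolding \<rho>_def by auto
    then have "\<Phi> ?z \<le> 0" "- \<Phi> ?z \<le> 0"
      using \<Phi>(3)[OF zV] \<Phi>(3)[OF fun_spaceD(6)[OF Vsp zV]] linear_on_funD(5)[OF \<Phi>(1) zV] by simp_all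
    then have "\<Phi> u = \<Phi> ?r" using linear_on_funD(3)[OF \<Phi>(1) u rV] by simp
    also have "\<dots> = (\<Sum>i\<in>I. \<integral>x. u (i, x) * v' i x \<partial>(M i))"
      unfolding \<Phi>r using v'(2) fam_spaceD[OF u] by (intro sum.cong) auto
    finally show ?thesis .
  qed
  show thesis
  proof (rule that[of "\<lambda>(i, x). v' i x"])
    show "T u = (\<Sum>i\<in>I. \<integral>x. u (i, x) * (case (i, x) of (i, x) \<Rightarrow> v' i x) \<partial>(M i))" if "u \<in> W" for u
      using \<Phi>(2)[OF that] \<Phi>sum[of u] that W(2) by auto
    show "(\<Sum>i\<in>I. \<integral>x. u (i, x) * (case (i, x) of (i, x) \<Rightarrow> v' i x) \<partial>(M i))
        \<le> C * fam_pos_power p I M u powr (1 / p)" if "u \<in> ?V" for u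
      using \<Phi>(3)[OF that] \<Phi>sum[OF that] by (simp add: \<rho>_def)
  qed (use v' in auto)
qed

text \<open>Reduction to the positive case by doubling the index set. The pair \<open>(u, -u)\<close> has positive part
\<open>(u\<^sup>+, u\<^sup>-)\<close>, whose norm is that of \<open>u\<close>, so a two-sided bound for \<open>T\<close> is a bound by the sublinear functional
that forces positivity. The difference of the two densities represents \<open>T\<close>.\<close>

theorem family_representation:
  fixes M :: "'i \<Rightarrow> 'a measure"
  assumes I: "finite I" and sf: "\<And>i. i \<in> I \<Longrightarrow> sigma_finite_measure (M i)" and p: "p \<ge> 1" and C: "C \<ge> 0"
    and W: "fun_space W" "W \<subseteq> fam_space p I M" and T: "linear_on_fun W T"
    and TC: "\<And>u. u \<in> W \<Longrightarrow> \<bar>T u\<bar> \<le> C * fam_power p I M u powr (1 / p)"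
  obtains v where "\<And>i. i \<in> I \<Longrightarrow> (\<lambda>x. v (i, x)) \<in> borel_measurable (M i)"
    "\<And>i f. i \<in> I \<Longrightarrow> f \<in> L_fun (M i) (ennreal p) \<Longrightarrow> integrable (M i) (\<lambda>x. f x * v (i, x))"
    "\<And>u. u \<in> W \<Longrightarrow> T u = fam_pairing I M u v"
    "\<And>u. u \<in> fam_space p I M \<Longrightarrow> fam_pairing I M u v
        \<le> C * fam_power p I M u powr (1 / p)"
proof -
  let ?V = "fam_space p I M"
  have p0: "p > 0" using p by simp
  define J where "J = I \<times> (UNIV :: bool set)"
  define N where "N = (\<lambda>j::'i \<times> bool. M (fst j))"
  let ?V2 = "fam_space p J N"
  define up where "up w = (\<lambda>y::'i \<times> 'a. w ((fst y, True), snd y) :: real)" for w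
  define dbl where "dbl u = (\<lambda>y::('i \<times> bool) \<times> 'a. if snd (fst y) then u (fst (fst y), snd y) else - u (fst (fst y), snd y) :: real)" for u
  define W2 where "W2 = {w \<in> ?V2. up w \<in> W \<and> (\<forall>i\<in>I. \<forall>x. w ((i, False), x) = - w ((i, True), x))}"
  have updbl: "up (dbl u) = u" for u by (auto simp: up_def dbl_def)
  have dblV: "dbl u \<in> ?V2" if "u \<in> ?V" for u
  proof -
    have "(\<lambda>x. dbl u ((i, b), x)) \<in> L_fun (M i) (ennreal p)" if "i \<in> I" for i b
    proof -
      note ui = fam_spaceD[OF \<open>u \<in> ?V\<close> that]
      show ?thesis
        by (cases b) (use ui fun_spaceD(6)[OF fun_space_L_fun[OF p0] ui] in \<open>simp_all add: dbl_def\<close>)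
    qed
    then show ?thesis by (auto simp: fam_space_def J_def N_def)
  qed
  have sumJ: "(\<Sum>j\<in>J. g j) = (\<Sum>i\<in>I. g (i, True) + g (i, False))" for g :: "'i \<times> bool \<Rightarrow> real"
  proof -
    have "(\<Sum>j\<in>J. g j) = (\<Sum>i\<in>I. \<Sum>b\<in>UNIV. g (i, b))" by (simp add: J_def sum.cartesian_product)
    then show ?thesis by (simp add: UNIV_bool add.commute)
  qed
  have pw: "fam_pos_power p J N w = fam_power p I M u"
    if u: "u \<in> ?V" and w: "\<And>i x. i \<in> I \<Longrightarrow> w ((i, True), x) = u (i, x) \<and> w ((i, False), x) = - u (i, x)" for u w
    unfolding sumJ fam_power_def
  proof (rule sum.cong[OF refl])
    fix i assume i: "i \<in> I"
    note ui = fam_spaceD[OF u i]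
    have "(\<lambda>x. max 0 (u (i, x))) \<in> L_fun (M i) (ennreal p)" "(\<lambda>x. max 0 (- u (i, x))) \<in> L_fun (M i) (ennreal p)"
      using L_fun_measurable[OF ui] by (auto intro!: L_fun_bound[OF p0 ui])
    then have "integrable (M i) (\<lambda>x. (max 0 (u (i, x))) powr p)" "integrable (M i) (\<lambda>x. (max 0 (- u (i, x))) powr p)"
      by (auto simp: L_fun_real_iff[OF p0])
    then have "(\<integral>x. (max 0 (u (i, x))) powr p \<partial>(M i)) + (\<integral>x. (max 0 (- u (i, x))) powr p \<partial>(M i))
        = (\<integral>x. (max 0 (u (i, x))) powr p + (max 0 (- u (i, x))) powr p \<partial>(M i))" by simp
    also have "\<dots> = (\<integral>x. \<bar>u (i, x)\<bar> powr p \<partial>(M i))"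
    proof (rule Bochner_Integration.integral_cong[OF refl])
      fix x
      show "(max 0 (u (i, x))) powr p + (max 0 (- u (i, x))) powr p = \<bar>u (i, x)\<bar> powr p"
        by (cases "u (i, x) \<ge> 0") (auto simp: max_def)
    qed
    finally show "(\<integral>x. (max 0 (w ((i, True), x))) powr p \<partial>(N (i, True))) + (\<integral>x. (max 0 (w ((i, False), x))) powr p \<partial>(N (i, False)))
        = (\<integral>x. \<bar>u (i, x)\<bar> powr p \<partial>(M i))" using w[OF i] by (simp add: N_def)
  qed
  have upW: "w ((i, True), x) = up w (i, x) \<and> w ((i, False), x) = - up w (i, x)" if "w \<in> W2" "i \<in> I" for w i x
    using that by (auto simp: W2_def up_def)
  obtain v where v: "\<And>j. j \<in> J \<Longrightarrow> (\<lambda>x. v (j, x)) \<in> borel_measurable (N j)"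
    "\<And>j f. j \<in> J \<Longrightarrow> f \<in> L_fun (N j) (ennreal p) \<Longrightarrow> integrable (N j) (\<lambda>x. f x * v (j, x))"
    "\<And>w. w \<in> W2 \<Longrightarrow> T (up w) = fam_pairing J N w v"
    "\<And>w. w \<in> ?V2 \<Longrightarrow> fam_pairing J N w v
        \<le> C * fam_pos_power p J N w powr (1 / p)"
  proof (rule positive_family_representation[of J N p C W2 "\<lambda>w. T (up w)"])
    show "finite J" using I by (simp add: J_def)
    show "sigma_finite_measure (N j)" if "j \<in> J" for j using that sf by (auto simp: J_def N_def)
    show "W2 \<subseteq> ?V2" by (auto simp: W2_def)
    have uplin: "up (\<lambda>y. a * w y + b * w' y) = (\<lambda>y. a * up w y + b * up w' y)" for a b w w' by (simp add: up_def)
    have up0: "up (\<lambda>_. 0) = (\<lambda>_. 0)" by (simp add: up_def)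
    show "fun_space W2"
      unfolding fun_space_def
    proof (intro conjI ballI allI)
      show "(\<lambda>_. 0) \<in> W2" unfolding W2_def
        using fun_spaceD(1)[OF W(1)] fun_spaceD(1)[OF fun_space_fam_space[OF p0]] by (auto simp: up0)
      fix w w' a b assume w: "w \<in> W2" "w' \<in> W2"
      have "(\<lambda>y. a * w y + b * w' y) \<in> ?V2"
        using w by (intro fun_spaceD(2)[OF fun_space_fam_space[OF p0]]) (auto simp: W2_def)
      moreover have "up (\<lambda>y. a * w y + b * w' y) \<in> W"
        unfolding uplin using w by (intro fun_spaceD(2)[OF W(1)]) (auto simp: W2_def)
      ultimately show "(\<lambda>y. a * w y + b * w' y) \<in> W2" using w by (auto simp: W2_def)
    qed
    show "linear_on_fun W2 (\<lambda>w. T (up w))"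
      unfolding linear_on_fun_def uplin using linear_on_funD(1)[OF T] by (auto simp: W2_def)
    fix w assume w: "w \<in> W2"
    then have uw: "up w \<in> W" "up w \<in> ?V" using W(2) by (auto simp: W2_def)
    have "T (up w) \<le> C * fam_power p I M (up w) powr (1 / p)" using TC[OF uw(1)] by simp
    then show "T (up w) \<le> C * fam_pos_power p J N w powr (1 / p)"
      using pw[OF uw(2), of w] upW[OF w] by simp
  qed (use p C in auto)
  define V where "V = (\<lambda>(i, x). v ((i, True), x) - v ((i, False), x))"
  have intV: "integrable (M i) (\<lambda>x. f x * v ((i, b), x))" if "i \<in> I" "f \<in> L_fun (M i) (ennreal p)" for i f b
    using v(2)[of "(i, b)" f] that by (simp add: J_def N_def)
  have Vsum: "(\<Sum>j\<in>J. \<integral>x. dbl u (j, x) * v (j, x) \<partial>(N j)) = fam_pairing I M u V"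
    if u: "u \<in> ?V" for u
    unfolding sumJ
  proof (rule sum.cong[OF refl])
    fix i assume i: "i \<in> I"
    show "(\<integral>x. dbl u ((i, True), x) * v ((i, True), x) \<partial>(N (i, True))) + (\<integral>x. dbl u ((i, False), x) * v ((i, False), x) \<partial>(N (i, False)))
      = (\<integral>x. u (i, x) * V (i, x) \<partial>(M i))"
      using intV[OF i fam_spaceD[OF u i]] by (simp add: dbl_def N_def V_def right_diff_distrib)
  qed
  show thesis
  proof (rule that[of V])
    show "(\<lambda>x. V (i, x)) \<in> borel_measurable (M i)" if "i \<in> I" for i
      using v(1)[of "(i, True)"] v(1)[of "(i, False)"] that by (simp add: V_def J_def N_def)
    show "integrable (M i) (\<lambda>x. f x * V (i, x))" if "i \<in> I" "f \<in> L_fun (M i) (ennreal p)" for i f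
      using intV[OF that] by (simp add: V_def right_diff_distrib)
    show "T u = fam_pairing I M u V" if u: "u \<in> W" for u
    proof -
      have "dbl u \<in> W2" using u W(2) dblV by (auto simp: W2_def updbl) (auto simp: dbl_def)
      then show ?thesis using v(3)[of "dbl u"] Vsum[of u] u W(2) by (auto simp: updbl)
    qed
    show "fam_pairing I M u V \<le> C * fam_power p I M u powr (1 / p)" if u: "u \<in> ?V" for u
      using v(4)[OF dblV[OF u]] Vsum[OF u] pw[OF u, of "dbl u"] by (simp add: dbl_def)
  qed
qed

section \<open>Hoelder inequality and strict convexity in finite products\<close>

text \<open>Not yet normalised: \<open>fam_Holder\<close> applies this to families scaled to norm at most \<open>1\<close>.\<close>

lemma Young_integral:
  assumes p: "p > 1" and q: "q = p / (p - 1)"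
    and f: "f \<in> L_fun M (ennreal p)" and g: "g \<in> L_fun M (ennreal q)"
  shows "integrable M (\<lambda>x. f x * g x)"
    and "\<bar>\<integral>x. f x * g x \<partial>M\<bar> \<le> (\<integral>x. \<bar>f x\<bar> powr p \<partial>M) / p + (\<integral>x. \<bar>g x\<bar> powr q \<partial>M) / q"
proof -
  have q1: "q > 1" unfolding q using p by (simp add: less_divide_eq)
  have pq: "1 / p + 1 / q = 1" unfolding q using p by (simp add: field_simps)
  have i: "integrable M (\<lambda>x. \<bar>f x\<bar> powr p)" "integrable M (\<lambda>x. \<bar>g x\<bar> powr q)"
    using f g p q1 by (simp_all add: L_fun_real_iff)
  note [measurable] = L_fun_measurable[OF f] L_fun_measurable[OF g]
  have le: "\<bar>f x * g x\<bar> \<le> \<bar>f x\<bar> powr p / p + \<bar>g x\<bar> powr q / q" for x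
    using Youngs_inequality[OF p q1 pq, of "\<bar>f x\<bar>" "\<bar>g x\<bar>"] by (simp add: abs_mult)
  have int: "integrable M (\<lambda>x. \<bar>f x\<bar> powr p / p + \<bar>g x\<bar> powr q / q)" using i by simp
  show fg: "integrable M (\<lambda>x. f x * g x)"
    by (rule Bochner_Integration.integrable_bound[OF int]) (use le in \<open>auto intro: order_trans[OF _ abs_ge_self]\<close>)
  have "\<bar>\<integral>x. f x * g x \<partial>M\<bar> \<le> (\<integral>x. \<bar>f x * g x\<bar> \<partial>M)" by (rule integral_abs_bound)
  also have "\<dots> \<le> (\<integral>x. \<bar>f x\<bar> powr p / p + \<bar>g x\<bar> powr q / q \<partial>M)"
    using fg int le by (intro integral_mono) auto
  also have "\<dots> = (\<integral>x. \<bar>f x\<bar> powr p \<partial>M) / p + (\<integral>x. \<bar>g x\<bar> powr q \<partial>M) / q" using i by simp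
  finally show "\<bar>\<integral>x. f x * g x \<partial>M\<bar> \<le> (\<integral>x. \<bar>f x\<bar> powr p \<partial>M) / p + (\<integral>x. \<bar>g x\<bar> powr q \<partial>M) / q" .
qed

lemma fam_power_scale:
  assumes "c \<ge> 0"
  shows "fam_power p I M (\<lambda>y. c * u y) = c powr p * fam_power p I M u"
  using assms by (simp add: fam_power_def abs_mult powr_mult sum_distrib_left)

lemma fam_Holder:
  assumes p: "p > 1" and q: "q = p / (p - 1)"
    and u: "u \<in> fam_space p I M" and v: "v \<in> fam_space q I M"
  shows "\<bar>fam_pairing I M u v\<bar>
    \<le> fam_power p I M u powr (1 / p) * fam_power q I M v powr (1 / q)"
proof -
  have q1: "q > 1" unfolding q using p by (simp add: less_divide_eq)
  have pq: "1 / p + 1 / q = 1" unfolding q using p by (simp add: field_simps)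
  have p0: "p > 0" "q > 0" using p q1 by auto
  define X where "X = fam_pairing I M u v"
  define a where "a = fam_power p I M u powr (1 / p)"
  define b where "b = fam_power q I M v powr (1 / q)"
  have ab0: "a \<ge> 0" "b \<ge> 0" by (auto simp: a_def b_def)
  have young: "\<bar>fam_pairing I M u v\<bar> \<le> fam_power p I M u / p + fam_power q I M v / q"
    if "u \<in> fam_space p I M" "v \<in> fam_space q I M" for u v
  proof -
    have "\<bar>fam_pairing I M u v\<bar> \<le> (\<Sum>i\<in>I. \<bar>\<integral>x. u (i, x) * v (i, x) \<partial>(M i)\<bar>)"
      by (rule sum_abs)
    also have "\<dots> \<le> (\<Sum>i\<in>I. (\<integral>x. \<bar>u (i, x)\<bar> powr p \<partial>(M i)) / p + (\<integral>x. \<bar>v (i, x)\<bar> powr q \<partial>(M i)) / q)"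
      using that by (intro sum_mono Young_integral(2)[OF p q]) (auto dest: fam_spaceD)
    also have "\<dots> = fam_power p I M u / p + fam_power q I M v / q"
      by (simp add: fam_power_def sum.distrib sum_divide_distrib)
    finally show ?thesis .
  qed
  \<comment> \<open>Dividing by \<open>a + e\<close> and \<open>b + e\<close> avoids a case distinction for vanishing norms.\<close>
  have key: "\<bar>X\<bar> \<le> (a + e) * (b + e)" if e: "e > 0" for e
  proof -
    have ae: "a + e > 0" "b + e > 0" using ab0 e by auto
    have unit: "(1 / (F powr (1 / r) + e)) powr r * F \<le> 1" if "F \<ge> 0" "r > 0" for F r :: real
    proof -
      have "F = (F powr (1 / r)) powr r" using that by (simp add: powr_powr)
      also have "\<dots> \<le> (F powr (1 / r) + e) powr r" using that e by (intro powr_mono2) auto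
      finally have "F \<le> (F powr (1 / r) + e) powr r" .
      then have "(1 / (F powr (1 / r) + e)) powr r * F \<le> (1 / (F powr (1 / r) + e)) powr r * (F powr (1 / r) + e) powr r"
        by (intro mult_left_mono) auto
      also have "\<dots> = 1" using e by (simp add: powr_mult[symmetric] add_nonneg_pos less_imp_neq[symmetric])
      finally show ?thesis .
    qed
    let ?u = "\<lambda>y. (1 / (a + e)) * u y" and ?v = "\<lambda>y. (1 / (b + e)) * v y"
    have uv: "?u \<in> fam_space p I M" "?v \<in> fam_space q I M"
      using fun_spaceD(5)[OF fun_space_fam_space[OF p0(1)] u] fun_spaceD(5)[OF fun_space_fam_space[OF p0(2)] v] by blast+
    have U: "fam_power p I M ?u \<le> 1" "fam_power q I M ?v \<le> 1"
      using unit[OF fam_power_nonneg p0(1)] unit[OF fam_power_nonneg p0(2)] ae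
      by (simp_all only: fam_power_scale a_def b_def divide_nonneg_pos less_imp_le zero_le_one zero_le_divide_1_iff)
    have "fam_pairing I M ?u ?v = (1 / (a + e)) * (1 / (b + e)) * X"
    proof -
      have "?u (i, x) * ?v (i, x) = ((1 / (a + e)) * (1 / (b + e))) * (u (i, x) * v (i, x))" for i x by simp
      then show ?thesis unfolding X_def sum_distrib_left by (simp only: integral_mult_right_zero)
    qed
    then have "\<bar>(1 / (a + e)) * (1 / (b + e)) * X\<bar> \<le> fam_power p I M ?u / p + fam_power q I M ?v / q"
      using young[OF uv] by simp
    also have "\<dots> \<le> 1 / p + 1 / q" using U p0 by (intro add_mono divide_right_mono) auto
    also have "\<dots> = 1" by (rule pq)
    finally have "\<bar>X\<bar> / ((a + e) * (b + e)) \<le> 1" using ae by (simp add: abs_mult)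
    then show ?thesis using ae by (simp add: divide_le_eq)
  qed
  have lim: "((\<lambda>e. (a + e) * (b + e)) \<longlongrightarrow> (a + 0) * (b + 0)) (at_right 0)"
    by (intro tendsto_intros)
  have "\<bar>X\<bar> \<le> (a + 0) * (b + 0)"
    by (rule tendsto_lowerbound[OF lim]) (use key in \<open>auto simp: eventually_at_right_less intro!: eventually_mono[OF eventually_at_right_less[of 0]]\<close>)
  then show ?thesis by (simp add: X_def a_def b_def)
qed

lemma fam_dual_norm_le:
  assumes p: "p > 1" and q: "q = p / (p - 1)" and C: "C \<ge> 0" and v: "v \<in> fam_space q I M"
    and bd: "\<And>u. u \<in> fam_space p I M \<Longrightarrow>
      fam_pairing I M u v \<le> C * fam_power p I M u powr (1 / p)"
  shows "fam_power q I M v powr (1 / q) \<le> C"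
proof -
  have q1: "q > 1" unfolding q using p by (simp add: less_divide_eq)
  have p0: "p > 0" "q > 0" using p q1 by auto
  define u where "u y = \<bar>v y\<bar> powr (q - 1) * sgn (v y)" for y
  have up: "\<bar>u y\<bar> powr p = \<bar>v y\<bar> powr q" for y
    unfolding u_def by (rule sgn_powr_powr[OF p q]) auto
  have uv: "u y * v y = \<bar>v y\<bar> powr q" for y
  proof -
    have sg: "sgn (v y) * v y = \<bar>v y\<bar>" by (simp add: sgn_real_def)
    have "u y * v y = (sgn (v y) * v y) * \<bar>v y\<bar> powr (q - 1)" by (simp only: u_def mult_ac)
    also have "\<dots> = \<bar>v y\<bar> * \<bar>v y\<bar> powr (q - 1)" unfolding sg ..
    also have "\<dots> = \<bar>v y\<bar> powr (1 + (q - 1))" by (rule powr_mult_base) simp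
    finally show ?thesis by simp
  qed
  have "u \<in> fam_space p I M"
    unfolding fam_space_def
  proof (intro CollectI ballI)
    fix i assume i: "i \<in> I"
    note vi = fam_spaceD[OF v i]
    note [measurable] = L_fun_measurable[OF vi]
    have "(\<lambda>x. u (i, x)) \<in> borel_measurable (M i)" unfolding u_def by measurable
    then show "(\<lambda>x. u (i, x)) \<in> L_fun (M i) (ennreal p)"
      using vi by (simp add: L_fun_real_iff p0 up)
  qed
  from bd[OF this] have "fam_power q I M v \<le> C * fam_power q I M v powr (1 / p)"
    by (simp add: fam_power_def up uv)
  then have "fam_power q I M v powr ((p - 1) / p) \<le> C"
    by (rule self_bound_power(1)[OF p fam_power_nonneg _ C])
  then show ?thesis unfolding q by simp
qed

lemma powr_midpoint_strict:
  fixes a b q :: real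
  assumes q: "q > 1" and ab: "0 \<le> a" "a < b"
  shows "((a + b) / 2) powr q < (a powr q + b powr q) / 2"
proof -
  define m where "m = (a + b) / 2"
  have m: "a < m" "m < b" using ab by (auto simp: m_def)
  have cont: "continuous_on {s..t} (\<lambda>x. x powr q)" if "0 \<le> s" for s t :: real
    using that q by (intro continuous_on_powr' continuous_intros) auto
  have der: "((\<lambda>x. x powr q) has_derivative (*) (q * x powr (q - 1))) (at x)" if "0 < x" for x :: real
    using has_real_derivative_powr[OF that, of q] by (simp add: has_field_derivative_def)
  obtain z1 where z1: "a < z1" "z1 < m" "m powr q - a powr q = q * z1 powr (q - 1) * (m - a)"
    by (rule mvt[OF m(1) cont[OF ab(1)] der]) (use ab in auto)
  obtain z2 where z2: "m < z2" "z2 < b" "b powr q - m powr q = q * z2 powr (q - 1) * (b - m)"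
    by (rule mvt[OF m(2) cont der]) (use ab m in auto)
  have "z1 powr (q - 1) < z2 powr (q - 1)" using z1 z2 ab q by (intro powr_less_mono2) auto
  then have "q * z1 powr (q - 1) * (m - a) < q * z2 powr (q - 1) * (m - a)" using q m by simp
  moreover have "m - a = b - m" by (simp add: m_def field_simps)
  ultimately have "q * z1 powr (q - 1) * (m - a) < q * z2 powr (q - 1) * (b - m)" by metis
  then have "m powr q - a powr q < b powr q - m powr q" unfolding z1(3) z2(3) .
  then show ?thesis by (simp add: m_def)
qed

lemma abs_powr_midpoint:
  fixes s t q :: real
  assumes q: "q > 1"
  shows "\<bar>(s + t) / 2\<bar> powr q \<le> (\<bar>s\<bar> powr q + \<bar>t\<bar> powr q) / 2"
    and "\<bar>(s + t) / 2\<bar> powr q = (\<bar>s\<bar> powr q + \<bar>t\<bar> powr q) / 2 \<Longrightarrow> s = t"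
proof -
  have le: "\<bar>(s + t) / 2\<bar> powr q \<le> ((\<bar>s\<bar> + \<bar>t\<bar>) / 2) powr q"
    using q by (intro powr_mono2) auto
  have strict: "((\<bar>s\<bar> + \<bar>t\<bar>) / 2) powr q < (\<bar>s\<bar> powr q + \<bar>t\<bar> powr q) / 2" if "\<bar>s\<bar> \<noteq> \<bar>t\<bar>"
    using powr_midpoint_strict[OF q, of "\<bar>s\<bar>" "\<bar>t\<bar>"] powr_midpoint_strict[OF q, of "\<bar>t\<bar>" "\<bar>s\<bar>"] that
    by (auto simp: add.commute neq_iff)
  show "\<bar>(s + t) / 2\<bar> powr q \<le> (\<bar>s\<bar> powr q + \<bar>t\<bar> powr q) / 2"
    using le strict by (cases "\<bar>s\<bar> = \<bar>t\<bar>") auto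
  assume eq: "\<bar>(s + t) / 2\<bar> powr q = (\<bar>s\<bar> powr q + \<bar>t\<bar> powr q) / 2"
  then have st: "\<bar>s\<bar> = \<bar>t\<bar>" using le strict by fastforce
  show "s = t"
  proof (rule ccontr)
    assume "s \<noteq> t"
    then have "s = - t" "t \<noteq> 0" using st by auto
    then show False using eq by simp
  qed
qed

text \<open>The integrals of the nonnegative functions \<open>(\<bar>v\<bar>\<^sup>q + \<bar>v'\<bar>\<^sup>q) / 2 - \<bar>(v + v') / 2\<bar>\<^sup>q\<close> add up to
at most \<open>0\<close>, and such a function vanishes only where \<open>v = v'\<close>.\<close>

lemma fam_strict_convexity:
  assumes I: "finite I" and q: "q > 1" and v: "v \<in> fam_space q I M" and v': "v' \<in> fam_space q I M"
    and A: "fam_power q I M v = A" "fam_power q I M v' = A"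
      "A \<le> fam_power q I M (\<lambda>y. (v y + v' y) / 2)"
    and i: "i \<in> I"
  shows "AE x in M i. v (i, x) = v' (i, x)"
proof -
  have q0: "q > 0" using q by simp
  define D where "D j x = (\<bar>v (j, x)\<bar> powr q + \<bar>v' (j, x)\<bar> powr q) / 2 - \<bar>(v (j, x) + v' (j, x)) / 2\<bar> powr q" for j x
  have w: "(\<lambda>y. (v y + v' y) / 2) \<in> fam_space q I M"
    using fun_spaceD(2)[OF fun_space_fam_space[OF q0] v v', of "1/2" "1/2"] by (simp add: add_divide_distrib)
  have int: "integrable (M j) (\<lambda>x. \<bar>v (j, x)\<bar> powr q)" "integrable (M j) (\<lambda>x. \<bar>v' (j, x)\<bar> powr q)"
    "integrable (M j) (\<lambda>x. \<bar>(v (j, x) + v' (j, x)) / 2\<bar> powr q)" if "j \<in> I" for j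
    using fam_spaceD[OF v that] fam_spaceD[OF v' that] fam_spaceD[OF w that] by (simp_all add: L_fun_real_iff[OF q0])
  have Dint: "integrable (M j) (D j)" if "j \<in> I" for j
    unfolding D_def using int[OF that] by simp
  have D0: "D j x \<ge> 0" for j x using abs_powr_midpoint(1)[OF q] by (simp add: D_def)
  have "(\<integral>x. D j x \<partial>(M j)) = ((\<integral>x. \<bar>v (j, x)\<bar> powr q \<partial>(M j)) + (\<integral>x. \<bar>v' (j, x)\<bar> powr q \<partial>(M j))) / 2
      - (\<integral>x. \<bar>(v (j, x) + v' (j, x)) / 2\<bar> powr q \<partial>(M j))" if "j \<in> I" for j
    unfolding D_def using int[OF that] by simp
  then have "(\<Sum>j\<in>I. \<integral>x. D j x \<partial>(M j)) = (fam_power q I M v + fam_power q I M v') / 2 - fam_power q I M (\<lambda>y. (v y + v' y) / 2)"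
    by (simp add: fam_power_def sum_subtractf sum.distrib sum_divide_distrib[symmetric])
  then have "(\<Sum>j\<in>I. \<integral>x. D j x \<partial>(M j)) \<le> 0" using A by simp
  moreover have nn: "(\<integral>x. D j x \<partial>(M j)) \<ge> 0" for j using D0 by (intro integral_nonneg_AE) auto
  ultimately have "(\<Sum>j\<in>I. \<integral>x. D j x \<partial>(M j)) = 0" by (intro antisym sum_nonneg) auto
  then have "(\<integral>x. D i x \<partial>(M i)) = 0" using sum_nonneg_eq_0_iff[OF I, of "\<lambda>j. \<integral>x. D j x \<partial>(M j)"] nn i by auto
  then have "AE x in M i. D i x = 0" using integral_nonneg_eq_0_iff_AE[OF Dint[OF i]] D0 by auto
  then show ?thesis by eventually_elim (rule abs_powr_midpoint(2)[OF q], simp add: D_def)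
qed

section \<open>Almost everywhere differentiability of absolutely continuous functions\<close>

text \<open>Indexed by sets rather than by end points, so that increments can be summed over divisions; for the
identity function they are lengths.\<close>

definition incr :: "(real \<Rightarrow> real) \<Rightarrow> real set \<Rightarrow> real" where
  "incr f K = f (Sup K) - f (Inf K)"

lemma incr_interval [simp]: "u \<le> v \<Longrightarrow> incr f {u..v} = f v - f u"
  by (simp add: incr_def)

lemma division_incr_sum:
  assumes "c \<le> d" "D division_of {c..d}"
  shows "(\<Sum>K\<in>D. incr f K) = f d - f c"
proof -
  let ?p = "(\<lambda>K. (Inf K, K)) ` D"
  have t: "?p tagged_division_of {c..d}"
  proof (rule tagged_division_ofI)
    show "finite ?p" using division_ofD(1)[OF assms(2)] by simp
    fix x K assume "(x, K) \<in> ?p"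
    then have K: "K \<in> D" "x = Inf K" by auto
    from division_ofD(4)[OF assms(2) K(1)] obtain u v where uv: "K = cbox u v" by blast
    have ne: "u \<le> v" using division_ofD(3)[OF assms(2) K(1)] uv by simp
    show "x \<in> K" using K uv ne by simp
    show "K \<subseteq> {c..d}" using division_ofD(2)[OF assms(2) K(1)] .
    show "\<exists>a b. K = cbox a b" using uv by blast
    fix y L assume "(y, L) \<in> ?p" "(x, K) \<noteq> (y, L)"
    then have "L \<in> D" "K \<noteq> L" using K by auto
    then show "interior K \<inter> interior L = {}" using division_ofD(5)[OF assms(2) K(1)] by blast
  next
    show "\<Union> {K. \<exists>x. (x, K) \<in> ?p} = {c..d}"
      using division_ofD(6)[OF assms(2)] by (auto simp: image_iff)
  qed
  have "(\<Sum>(x,K)\<in>?p. f (Sup K) - f (Inf K)) = (\<Sum>K\<in>D. incr f K)"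
    by (subst sum.reindex) (auto simp: inj_on_def incr_def)
  then show ?thesis using additive_tagged_division_1[OF assms(1) t, of f] by simp
qed

lemma abs_continuous_on_division:
  assumes f: "abs_continuous_on {a..b} f" and e: "e > 0"
  obtains d where "d > 0"
    "\<And>D. D division_of \<Union>D \<Longrightarrow> \<Union>D \<subseteq> {a..b} \<Longrightarrow> (\<Sum>K\<in>D. incr (\<lambda>x. x) K) < d
        \<Longrightarrow> (\<Sum>K\<in>D. \<bar>incr f K\<bar>) < e"
proof -
  obtain d where d: "d > 0" and H: "\<And>(n::nat) x y.
        (\<forall>i<n. x i \<le> y i \<and> {x i..y i} \<subseteq> {a..b}) \<Longrightarrow>
        (\<forall>i<n. \<forall>l<n. i \<noteq> l \<longrightarrow> {x i<..<y i} \<inter> {x l<..<y l} = {}) \<Longrightarrow>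
        (\<Sum>i<n. y i - x i) < d \<Longrightarrow> (\<Sum>i<n. \<bar>f (y i) - f (x i)\<bar>) < e"
    using f[unfolded abs_continuous_on_def, rule_format, OF e] by blast
  show thesis
  proof (rule that[OF d])
    fix D :: "real set set"
    assume D: "D division_of \<Union>D" "\<Union>D \<subseteq> {a..b}" and s: "(\<Sum>K\<in>D. incr (\<lambda>x. x) K) < d"
    have fin: "finite D" using D(1) by blast
    then obtain h where h: "bij_betw h {..<card D} D"
      using ex_bij_betw_nat_finite atLeast0LessThan by metis
    have hD: "h i \<in> D" if "i < card D" for i using h that by (auto simp: bij_betw_def)
    have hK: "h i = {Inf (h i)..Sup (h i)} \<and> Inf (h i) \<le> Sup (h i)" if i: "i < card D" for i
    proof -
      obtain u v where "h i = cbox u v" using division_ofD(4)[OF D(1), of "h i"] hD[OF i] by blast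
      moreover have "h i \<noteq> {}" using division_ofD(3)[OF D(1), of "h i"] hD[OF i] by blast
      ultimately show ?thesis by simp
    qed
    have "(\<Sum>i<card D. \<bar>f (Sup (h i)) - f (Inf (h i))\<bar>) < e"
    proof (rule H)
      show "\<forall>i<card D. Inf (h i) \<le> Sup (h i) \<and> {Inf (h i)..Sup (h i)} \<subseteq> {a..b}"
      proof (intro allI impI)
        fix i assume i: "i < card D"
        have "h i \<subseteq> {a..b}" using hD[OF i] D(2) by blast
        then show "Inf (h i) \<le> Sup (h i) \<and> {Inf (h i)..Sup (h i)} \<subseteq> {a..b}" using hK[OF i] by simp
      qed
      show "\<forall>i<card D. \<forall>l<card D. i \<noteq> l \<longrightarrow>
          {Inf (h i)<..<Sup (h i)} \<inter> {Inf (h l)<..<Sup (h l)} = {}"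
      proof (intro allI impI)
        fix i l assume il: "i < card D" "l < card D" "i \<noteq> l"
        then have "h i \<noteq> h l" using h by (metis bij_betw_def inj_on_def lessThan_iff)
        then have "interior (h i) \<inter> interior (h l) = {}"
          using division_ofD(5)[OF D(1), of "h i" "h l"] hD il by blast
        then show "{Inf (h i)<..<Sup (h i)} \<inter> {Inf (h l)<..<Sup (h l)} = {}"
          by (subst (asm) conjunct1[OF hK[OF il(1)]], subst (asm) conjunct1[OF hK[OF il(2)]]) simp
      qed
      have "(\<Sum>i<card D. Sup (h i) - Inf (h i)) = (\<Sum>K\<in>D. incr (\<lambda>x. x) K)"
        using sum.reindex_bij_betw[OF h, of "incr (\<lambda>x. x)"] by (simp add: incr_def)
      then show "(\<Sum>i<card D. Sup (h i) - Inf (h i)) < d" using s by simp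
    qed
    then show "(\<Sum>K\<in>D. \<bar>incr f K\<bar>) < e"
      using sum.reindex_bij_betw[OF h, of "\<lambda>K. \<bar>incr f K\<bar>"] by (simp add: incr_def)
  qed
qed

lemma disjoint_intervals_division:
  fixes D :: "real set set"
  assumes "finite D" "pairwise disjnt D" "\<And>K. K \<in> D \<Longrightarrow> \<exists>u v. u < v \<and> K = {u..v}"
  shows "D division_of \<Union>D"
proof (rule division_ofI)
  fix K assume K: "K \<in> D"
  obtain u v where uv: "u < v" "K = {u..v}" using assms(3)[OF K] by blast
  then show "K \<noteq> {}" "\<exists>a b. K = cbox a b" by auto
  show "K \<subseteq> \<Union>D" using K by blast
  fix L assume "L \<in> D" "K \<noteq> L"
  then have "K \<inter> L = {}" using assms(2) K by (meson disjnt_def pairwiseD)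
  then show "interior K \<inter> interior L = {}" using interior_subset by blast
qed (use assms in auto)

text \<open>The family \<open>G\<close> consists of the gaps left by \<open>B\<close> inside the members of \<open>A\<close>. The identity holds for all \<open>f\<close>
at once, so for the identity function it computes the total length of the gaps.\<close>

lemma disjoint_intervals_gaps:
  fixes A B :: "real set set"
  assumes A: "finite A" "pairwise disjnt A" "\<And>K. K \<in> A \<Longrightarrow> \<exists>u v. u < v \<and> K = {u..v}"
    and B: "finite B" "pairwise disjnt B" "\<And>K. K \<in> B \<Longrightarrow> \<exists>u v. u < v \<and> K = {u..v}"
    and BA: "\<And>J. J \<in> B \<Longrightarrow> \<exists>I\<in>A. J \<subseteq> I"
  obtains G where "G division_of \<Union>G" "\<Union>G \<subseteq> \<Union>A"
    "\<And>f. (\<Sum>K\<in>A. incr f K) = (\<Sum>K\<in>B. incr f K) + (\<Sum>K\<in>G. incr f K)"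
proof -
  define S where "S I = {J\<in>B. J \<subseteq> I}" for I
  have "\<exists>q. S I \<subseteq> q \<and> q division_of I" if I: "I \<in> A" for I
  proof -
    obtain u v where uv: "I = cbox u v" using A(3)[OF I] by auto
    have "S I division_of \<Union>(S I)"
      by (rule disjoint_intervals_division) (use B in \<open>auto simp: S_def pairwise_def\<close>)
    moreover have "\<Union>(S I) \<subseteq> cbox u v" unfolding S_def uv[symmetric] by blast
    ultimately show ?thesis using partial_division_extend_interval uv by metis
  qed
  then obtain q where q: "\<And>I. I \<in> A \<Longrightarrow> S I \<subseteq> q I" "\<And>I. I \<in> A \<Longrightarrow> q I division_of I" by metis
  define G where "G = (\<Union>I\<in>A. q I - S I)"
  have qne: "K \<noteq> {}" "K \<subseteq> I" "\<exists>a b. K = cbox a b" if "I \<in> A" "K \<in> q I" for I K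
    using division_ofD(2-4)[OF q(2)[OF that(1)] that(2)] by auto
  have qfin: "finite (q I)" if "I \<in> A" for I using q(2)[OF that] by blast
  have uniq: "I = I'" if "I \<in> A" "I' \<in> A" "K \<in> q I" "K \<in> q I'" for I I' K
  proof (rule ccontr)
    assume "I \<noteq> I'"
    then have "I \<inter> I' = {}" using A(2) that by (meson disjnt_def pairwiseD)
    then show False using qne(1,2)[OF that(1,3)] qne(1,2)[OF that(2,4)] by blast
  qed
  have Bq: "B = (\<Union>I\<in>A. S I)" using BA by (auto simp: S_def)
  show thesis
  proof
    show "G division_of \<Union>G"
    proof (rule division_ofI)
      show "finite G" unfolding G_def using A(1) qfin by auto
      fix K assume "K \<in> G"
      then obtain I where I: "I \<in> A" "K \<in> q I" by (auto simp: G_def)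
      show "K \<subseteq> \<Union>G" using \<open>K \<in> G\<close> by blast
      show "K \<noteq> {}" "\<exists>a b. K = cbox a b" using qne[OF I] by auto
      fix L assume "L \<in> G" "K \<noteq> L"
      then obtain I' where I': "I' \<in> A" "L \<in> q I'" by (auto simp: G_def)
      show "interior K \<inter> interior L = {}"
      proof (cases "I = I'")
        case True
        then show ?thesis using division_ofD(5)[OF q(2)[OF I(1)] I(2)] I' \<open>K \<noteq> L\<close> by blast
      next
        case False
        then have "I \<inter> I' = {}" using A(2) I I' by (meson disjnt_def pairwiseD)
        then show ?thesis using qne(2)[OF I] qne(2)[OF I'] interior_subset by blast
      qed
    qed simp
    show "\<Union>G \<subseteq> \<Union>A" using qne(2) by (fastforce simp: G_def)
    fix f
    have "(\<Sum>K\<in>A. incr f K) = (\<Sum>I\<in>A. \<Sum>K\<in>q I. incr f K)"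
    proof (rule sum.cong[OF refl])
      fix I assume I: "I \<in> A"
      then obtain u v where "u < v" "I = {u..v}" using A(3) by blast
      then show "incr f I = (\<Sum>K\<in>q I. incr f K)"
        using division_incr_sum[of u v "q I" f] q(2)[OF I] by simp
    qed
    also have "\<dots> = (\<Sum>I\<in>A. (\<Sum>K\<in>S I. incr f K) + (\<Sum>K\<in>q I - S I. incr f K))"
      by (rule sum.cong[OF refl]) (metis q(1) qfin sum.subset_diff add.commute)
    also have "\<dots> = (\<Sum>I\<in>A. \<Sum>K\<in>S I. incr f K) + (\<Sum>I\<in>A. \<Sum>K\<in>q I - S I. incr f K)"
      by (rule sum.distrib)
    also have "(\<Sum>I\<in>A. \<Sum>K\<in>S I. incr f K) = (\<Sum>K\<in>B. incr f K)"
      unfolding Bq using A(1) qfin q(1) uniq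
      by (intro sum.UNION_disjoint[symmetric]) (blast intro: finite_subset)+
    also have "(\<Sum>I\<in>A. \<Sum>K\<in>q I - S I. incr f K) = (\<Sum>K\<in>G. incr f K)"
      unfolding G_def using A(1) qfin uniq
      by (intro sum.UNION_disjoint[symmetric]) blast+
    finally show "(\<Sum>K\<in>A. incr f K) = (\<Sum>K\<in>B. incr f K) + (\<Sum>K\<in>G. incr f K)" .
  qed
qed

text \<open>The number \<open>e\<close> is a lower bound for the outer measure of \<open>E\<close>. The Vitali theorem provides countably
many disjoint intervals covering \<open>E\<close> up to a null set, and finitely many of them have almost the
same measure. Outer measure avoids showing that \<open>E\<close> is measurable.\<close>

lemma Vitali_finite_intervals:
  fixes E W :: "real set"
  assumes W: "open W" "W \<in> lmeasurable" "E \<subseteq> W"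
    and cov: "\<And>x d. x \<in> E \<Longrightarrow> d > 0 \<Longrightarrow> \<exists>u v. u < v \<and> v - u < d \<and> x \<in> {u..v} \<and> P u v"
    and e: "\<And>S. S \<in> lmeasurable \<Longrightarrow> E \<subseteq> S \<Longrightarrow> e \<le> measure lebesgue S"
    and eps: "\<epsilon> > 0"
  obtains D where "finite D" "pairwise disjnt D" "\<Union>D \<subseteq> W"
    "\<And>K. K \<in> D \<Longrightarrow> \<exists>u v. u < v \<and> P u v \<and> K = {u..v}"
    "measure lebesgue (\<Union>D) > e - \<epsilon>" "(\<Sum>K\<in>D. incr (\<lambda>x. x) K) = measure lebesgue (\<Union>D)"
proof -
  define \<K> where "\<K> = {(u, v). u < v \<and> P u v \<and> {u..v} \<subseteq> W}"
  have cb: "cball ((u + v) / 2) ((v - u) / 2) = {u..v}" for u v :: real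
    by (auto simp: cball_def dist_real_def abs_le_iff field_simps)
  define c where "c = (\<lambda>(u, v). (u + v) / 2 :: real)"
  define r where "r = (\<lambda>(u, v). (v - u) / 2 :: real)"
  define I where "I = (\<lambda>(u, v). {u..v :: real})"
  have cI: "cball (c i) (r i) = I i" for i
    by (cases i) (simp add: c_def r_def I_def cb)
  obtain C where C: "countable C" "C \<subseteq> \<K>" "pairwise (\<lambda>i j. disjnt (I i) (I j)) C"
    "negligible (E - (\<Union>i\<in>C. I i))"
  proof (rule Vitali_covering_theorem_cballs[of \<K> r E c, unfolded cI])
    show "0 < r i" if "i \<in> \<K>" for i using that by (auto simp: \<K>_def r_def)
    fix x d :: real assume x: "x \<in> E" "0 < d"
    then obtain \<delta> where \<delta>: "\<delta> > 0" "ball x \<delta> \<subseteq> W" using W by (meson openE subsetD)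
    obtain u v where uv: "u < v" "v - u < min d \<delta>" "x \<in> {u..v}" "P u v"
      using cov[OF x(1), of "min d \<delta>"] x(2) \<delta>(1) by auto
    have "{u..v} \<subseteq> ball x \<delta>" using uv by (auto simp: dist_real_def)
    then show "\<exists>i. i \<in> \<K> \<and> x \<in> I i \<and> r i < d"
      using uv \<delta> x by (intro exI[of _ "(u, v)"]) (auto simp: \<K>_def I_def r_def)
  qed
  define U where "U = (\<Union>i\<in>C. I i)"
  have Ism: "I i \<in> lmeasurable" for i by (cases i) (simp add: I_def)
  have UW: "U \<subseteq> W" using C(2) by (auto simp: U_def \<K>_def I_def)
  have Us: "U \<in> sets lebesgue" unfolding U_def using C(1) Ism by blast
  have Ul: "U \<in> lmeasurable" by (rule fmeasurableI2[OF W(2) UW Us])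
  have eU: "e \<le> measure lebesgue U"
  proof -
    have n: "E - U \<in> null_sets lebesgue" using C(4) negligible_iff_null_sets U_def by auto
    have "e \<le> measure lebesgue (U \<union> (E - U))"
      by (rule e[OF fmeasurable.Un[OF Ul fmeasurableI_null_sets[OF n]]]) blast
    also have "\<dots> = measure lebesgue U" using n Us measure_Un_null_set by blast
    finally show ?thesis .
  qed
  have "\<exists>F. finite F \<and> F \<subseteq> C \<and> measure lebesgue (\<Union>i\<in>F. I i) > e - \<epsilon>"
  proof (cases "C = {}")
    case True
    then have "e \<le> 0" using eU by (simp add: U_def)
    then show ?thesis using eps by (intro exI[of _ "{}"]) auto
  next
    case False
    define g where "g = from_nat_into C"
    define A where "A n = (\<Union>i\<in>g ` {..<n}. I i)" for n
    have gC: "range g = C" unfolding g_def using False C(1) by (rule range_from_nat_into)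
    have AU: "(\<Union>n. A n) = U"
      unfolding A_def U_def gC[symmetric] by (auto intro: lessI)
    have As: "A n \<in> sets lebesgue" for n unfolding A_def using Ism by blast
    have "incseq A" unfolding A_def incseq_def by (fastforce)
    then have "(\<lambda>n. measure lebesgue (A n)) \<longlonglongrightarrow> measure lebesgue (\<Union>n. A n)"
      using As Ul by (intro Lim_measure_incseq) (auto simp: AU fmeasurable_def)
    moreover have "e - \<epsilon> < measure lebesgue (\<Union>n. A n)" using eU eps by (simp add: AU)
    ultimately have "\<forall>\<^sub>F n in sequentially. e - \<epsilon> < measure lebesgue (A n)"
      by (rule order_tendstoD(1))
    then obtain n where "e - \<epsilon> < measure lebesgue (A n)" by (auto simp: eventually_sequentially)
    then show ?thesis using gC by (intro exI[of _ "g ` {..<n}"]) (auto simp: A_def)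
  qed
  then obtain F where F: "finite F" "F \<subseteq> C" "measure lebesgue (\<Union>i\<in>F. I i) > e - \<epsilon>" by blast
  have pw: "pairwise disjnt (I ` F)"
    using C(3) F(2) by (force simp: pairwise_def)
  have PK: "\<exists>u v. u < v \<and> P u v \<and> K = {u..v}" if K: "K \<in> I ` F" for K
  proof -
    obtain i where i: "i \<in> F" "K = I i" using K by blast
    then have "i \<in> \<K>" using F(2) C(2) by blast
    then show ?thesis using i(2) by (cases i) (auto simp: \<K>_def I_def)
  qed
  show thesis
  proof
    show "finite (I ` F)" using F(1) by simp
    show "\<Union>(I ` F) \<subseteq> W" using UW F(2) by (auto simp: U_def)
    show "e - \<epsilon> < measure lebesgue (\<Union>(I ` F))" using F(3) by simp
    have "measure lebesgue (\<Union>(I ` F)) = (\<Sum>K\<in>I ` F. measure lebesgue K)"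
    proof (rule measure_Union')
      show "pairwise disjnt (I ` F)" by (rule pw)
    qed (use F Ism in auto)
    also have "\<dots> = (\<Sum>K\<in>I ` F. incr (\<lambda>x. x) K)"
      by (rule sum.cong[OF refl]) (use PK in fastforce)
    finally show "(\<Sum>K\<in>I ` F. incr (\<lambda>x. x) K) = measure lebesgue (\<Union>(I ` F))" by simp
  qed (use pw PK in auto)
qed

lemma non_negligible_outer_measure:
  fixes E W :: "real set"
  assumes "open W" "bounded W" "E \<subseteq> W" "\<not> negligible E"
  obtains e where "e > 0" "\<And>S. S \<in> lmeasurable \<Longrightarrow> E \<subseteq> S \<Longrightarrow> e \<le> measure lebesgue S"
    "\<And>\<epsilon>. \<epsilon> > 0 \<Longrightarrow> \<exists>U. open U \<and> U \<in> lmeasurable \<and> E \<subseteq> U \<and> U \<subseteq> W \<and> measure lebesgue U < e + \<epsilon>"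
proof -
  define M where "M = measure lebesgue ` {S \<in> lmeasurable. E \<subseteq> S}"
  have Wl: "W \<in> lmeasurable" using assms by (simp add: lmeasurable_open)
  have ne: "M \<noteq> {}" and bb: "bdd_below M" unfolding M_def using Wl assms(3)
    by (auto intro!: bdd_belowI[of _ 0])
  show thesis
  proof
    show le: "Inf M \<le> measure lebesgue S" if "S \<in> lmeasurable" "E \<subseteq> S" for S
      by (rule cInf_lower[OF _ bb]) (use that in \<open>auto simp: M_def\<close>)
    obtain d where d: "d > 0" "\<And>T. E \<subseteq> T \<Longrightarrow> T \<in> lmeasurable \<Longrightarrow> d \<le> measure lebesgue T"
      using assms(4) unfolding negligible_outer by (meson not_less)
    have "d \<le> Inf M" by (rule cInf_greatest[OF ne]) (use d(2) in \<open>auto simp: M_def\<close>)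
    then show "Inf M > 0" using d(1) by simp
    fix \<epsilon> :: real assume eps: "\<epsilon> > 0"
    obtain S where S: "S \<in> lmeasurable" "E \<subseteq> S" "measure lebesgue S < Inf M + \<epsilon> / 2"
      using cInf_lessD[OF ne, of "Inf M + \<epsilon> / 2"] eps by (auto simp: M_def)
    obtain T where T: "open T" "S \<subseteq> T" "T - S \<in> lmeasurable"
      "emeasure lebesgue (T - S) < ennreal (\<epsilon> / 2)"
      using sets_lebesgue_outer_open[of S "\<epsilon> / 2"] S(1) eps by auto
    have TS: "T = S \<union> (T - S)" using T(2) by blast
    then have Tl: "T \<in> lmeasurable" using S(1) T(3) by (metis fmeasurable.Un)
    have "measure lebesgue T \<le> measure lebesgue S + measure lebesgue (T - S)"
      using TS S(1) T(3) by (metis fmeasurableD measure_Un_le)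
    also have "measure lebesgue (T - S) < \<epsilon> / 2"
      using T(4) eps unfolding emeasure_eq_measure2[OF T(3)] by (simp add: ennreal_less_iff)
    finally have Tm: "measure lebesgue T < Inf M + \<epsilon>" using S(3) by simp
    have "measure lebesgue (T \<inter> W) \<le> measure lebesgue T"
      by (rule measure_mono_fmeasurable) (use Tl Wl in auto)
    then show "\<exists>U. open U \<and> U \<in> lmeasurable \<and> E \<subseteq> U \<and> U \<subseteq> W \<and> measure lebesgue U < Inf M + \<epsilon>"
      using T Tl Tm S assms Wl by (intro exI[of _ "T \<inter> W"]) (auto intro!: fmeasurable.Int)
  qed
qed


abbreviation quot :: "(real \<Rightarrow> real) \<Rightarrow> real \<Rightarrow> real \<Rightarrow> real" where
  "quot f x y \<equiv> (f y - f x) / (y - x)"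

lemma frequently_difference_quotient_intervals:
  fixes f :: "real \<Rightarrow> real"
  assumes "\<exists>\<^sub>F y in at x. Q (quot f x y)" "d > 0"
  shows "\<exists>u v. u < v \<and> v - u < d \<and> x \<in> {u..v} \<and> Q (quot f u v)"
proof -
  have "\<exists>y. y \<noteq> x \<and> dist y x < d \<and> Q (quot f x y)"
    using assms unfolding frequently_def eventually_at by blast
  then obtain y where y: "y \<noteq> x" "dist y x < d" "Q (quot f x y)" by blast
  show ?thesis
  proof (cases "x < y")
    case True
    then show ?thesis using y by (intro exI[of _ x] exI[of _ y]) (auto simp: dist_real_def)
  next
    case False
    have "quot f y x = quot f x y"
      using y(1) by (simp add: divide_simps algebra_simps)
    then show ?thesis using y False
      by (intro exI[of _ y] exI[of _ x]) (auto simp: dist_real_def)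
  qed
qed

text \<open>Suppose the set \<open>E\<close> has outer measure \<open>e > 0\<close>. Choose an open \<open>U \<supseteq> E\<close> of measure close to \<open>e\<close>, disjoint
intervals \<open>A\<close> in \<open>U\<close> with quotients below \<open>r\<close> that nearly exhaust \<open>e\<close>, and inside them disjoint intervals
\<open>B\<close> with quotients above \<open>s\<close> that still nearly exhaust \<open>e\<close>. The gaps have small total length, so by
absolute continuity the increments of \<open>f\<close> over \<open>A\<close> and \<open>B\<close> nearly agree; but the former is at most \<open>r e\<close>
and the latter at least \<open>s e\<close>, up to small errors.\<close>

lemma negligible_oscillating_quotient:
  assumes f: "abs_continuous_on {a..b} f" and rs: "r < s"
  defines "E \<equiv> {x\<in>{a<..<b}. (\<exists>\<^sub>F y in at x. quot f x y < r)
            \<and> (\<exists>\<^sub>F y in at x. s < quot f x y)}"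
  shows "negligible E"
proof (rule ccontr)
  assume nn: "\<not> negligible E"
  have W: "open {a<..<b}" "bounded {a<..<b}" "E \<subseteq> {a<..<b}" by (auto simp: E_def)
  obtain e where e: "e > 0" "\<And>S. S \<in> lmeasurable \<Longrightarrow> E \<subseteq> S \<Longrightarrow> e \<le> measure lebesgue S"
    "\<And>\<epsilon>. \<epsilon> > 0 \<Longrightarrow> \<exists>U. open U \<and> U \<in> lmeasurable \<and> E \<subseteq> U \<and> U \<subseteq> {a<..<b} \<and> measure lebesgue U < e + \<epsilon>"
    by (rule non_negligible_outer_measure[OF W nn]) blast
  \<comment> \<open>The final estimate reads \<open>(s - r) (e - \<epsilon>) < 4 \<epsilon> \<bar>s\<bar> + \<eta>\<close>; both \<open>\<eta>\<close> and \<open>\<epsilon>\<close> are chosen to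
    contradict it, with \<open>4 \<epsilon>\<close> below the \<open>\<delta>\<close> that belongs to \<open>\<eta>\<close>.\<close>
  define \<eta> where "\<eta> = (s - r) * e / 4"
  have \<eta>: "\<eta> > 0" using rs e(1) by (simp add: \<eta>_def)
  obtain d where d: "d > 0" "\<And>D. D division_of \<Union>D \<Longrightarrow> \<Union>D \<subseteq> {a..b} \<Longrightarrow> (\<Sum>K\<in>D. incr (\<lambda>x. x) K) < d
        \<Longrightarrow> (\<Sum>K\<in>D. \<bar>incr f K\<bar>) < \<eta>"
    using abs_continuous_on_division[OF f \<eta>] by blast
  define \<epsilon> where "\<epsilon> = min (e / 4) (min (d / 5) ((s - r) * e / (16 * (\<bar>s\<bar> + 1))))"
  have eps: "\<epsilon> > 0" "\<epsilon> \<le> e / 4" "4 * \<epsilon> < d" "\<epsilon> \<le> (s - r) * e / (16 * (\<bar>s\<bar> + 1))"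
  proof -
    show "\<epsilon> > 0" using e(1) d(1) rs by (auto simp: \<epsilon>_def)
    show "\<epsilon> \<le> e / 4" unfolding \<epsilon>_def by (rule min.cobounded1)
    show "\<epsilon> \<le> (s - r) * e / (16 * (\<bar>s\<bar> + 1))"
      unfolding \<epsilon>_def by (intro min.coboundedI2 order_refl)
    have "\<epsilon> \<le> d / 5" unfolding \<epsilon>_def by (rule min.coboundedI2[OF min.cobounded1])
    then show "4 * \<epsilon> < d" using d(1) by linarith
  qed
  have eps4: "4 * \<epsilon> * \<bar>s\<bar> \<le> \<eta>"
  proof -
    have "\<epsilon> * (16 * (\<bar>s\<bar> + 1)) \<le> (s - r) * e" using eps(4) by (simp add: pos_le_divide_eq)
    then show ?thesis using eps(1) by (simp add: \<eta>_def algebra_simps)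
  qed
  obtain U where U: "open U" "U \<in> lmeasurable" "E \<subseteq> U" "U \<subseteq> {a<..<b}" "measure lebesgue U < e + \<epsilon>"
    using e(3)[OF eps(1)] by blast
  obtain A where A: "finite A" "pairwise disjnt A" "\<Union>A \<subseteq> U"
    "\<And>K. K \<in> A \<Longrightarrow> \<exists>u v. u < v \<and> quot f u v < r \<and> K = {u..v}"
    "measure lebesgue (\<Union>A) > e - \<epsilon>" "(\<Sum>K\<in>A. incr (\<lambda>x. x) K) = measure lebesgue (\<Union>A)"
  proof (rule Vitali_finite_intervals[OF U(1-3) _ e(2) eps(1), where P = "\<lambda>u v. quot f u v < r"])
    fix x d :: real assume "x \<in> E" "d > 0"
    then have "\<exists>\<^sub>F y in at x. quot f x y < r" "d > 0" by (auto simp: E_def)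
    then show "\<exists>u v. u < v \<and> v - u < d \<and> x \<in> {u..v} \<and> quot f u v < r"
      using frequently_difference_quotient_intervals[of "\<lambda>t. t < r" f x d] by simp
  qed blast+
  \<comment> \<open>Passing to interiors loses only finitely many points and gives an open set to apply the
    covering argument in a second time.\<close>
  define V where "V = \<Union>(interior ` A)"
  have Aiv: "\<exists>u v. u < v \<and> K = {u..v}" if "K \<in> A" for K using A(4)[OF that] by blast
  have VA: "V \<subseteq> \<Union>A" unfolding V_def using interior_subset by blast
  have Vo: "open V" by (auto simp: V_def)
  have Vl: "V \<in> lmeasurable" using VA A(3) U(2) Vo by (intro fmeasurableI2[OF U(2)]) auto
  have Al: "\<Union>A \<in> lmeasurable" using A(1) Aiv by (intro fmeasurable.finite_Union) fastforce+
  have AV: "measure lebesgue (\<Union>A) \<le> measure lebesgue V"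
  proof -
    have fin: "finite (Inf ` A \<union> Sup ` A)" using A(1) by simp
    then have n: "Inf ` A \<union> Sup ` A \<in> null_sets lebesgue"
      using negligible_finite negligible_iff_null_sets by blast
    have "\<Union>A \<subseteq> V \<union> (Inf ` A \<union> Sup ` A)"
    proof
      fix x assume "x \<in> \<Union>A"
      then obtain K where K: "K \<in> A" "x \<in> K" by blast
      obtain u v where uv: "u < v" "K = {u..v}" using Aiv[OF K(1)] by blast
      have "u = Inf K" "v = Sup K" using uv by auto
      moreover have "x = u \<or> x = v \<or> x \<in> interior K" using K uv by auto
      ultimately show "x \<in> V \<union> (Inf ` A \<union> Sup ` A)" using K(1) by (auto simp: V_def)
    qed
    then have "measure lebesgue (\<Union>A) \<le> measure lebesgue (V \<union> (Inf ` A \<union> Sup ` A))"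
      by (rule measure_mono_fmeasurable[OF _ fmeasurableD[OF Al] fmeasurable.Un[OF Vl fmeasurableI_null_sets[OF n]]])
    also have "\<dots> = measure lebesgue V" using n Vl by (intro measure_Un_null_set) auto
    finally show ?thesis .
  qed
  have UV: "measure lebesgue (U - V) < 2 * \<epsilon>"
    using measurable_measure_Diff[OF U(2), of V] Vl VA A(3,5) AV U(5) by force
  obtain B where B: "finite B" "pairwise disjnt B" "\<Union>B \<subseteq> V"
    "\<And>K. K \<in> B \<Longrightarrow> \<exists>u v. u < v \<and> (s < quot f u v \<and> (\<exists>I\<in>A. {u..v} \<subseteq> I)) \<and> K = {u..v}"
    "measure lebesgue (\<Union>B) > (e - 2 * \<epsilon>) - \<epsilon>" "(\<Sum>K\<in>B. incr (\<lambda>x. x) K) = measure lebesgue (\<Union>B)"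
  proof (rule Vitali_finite_intervals[OF Vo Vl, where E = "E \<inter> V" and e = "e - 2 * \<epsilon>" and \<epsilon> = \<epsilon>
        and P = "\<lambda>u v. s < quot f u v \<and> (\<exists>I\<in>A. {u..v} \<subseteq> I)"])
    fix x d :: real assume x: "x \<in> E \<inter> V" "d > 0"
    then obtain I where I: "I \<in> A" "x \<in> interior I" by (auto simp: V_def)
    then obtain \<delta> where \<delta>: "\<delta> > 0" "ball x \<delta> \<subseteq> I"
      by (meson interior_subset open_interior openE order_trans)
    obtain u v where uv: "u < v" "v - u < min d \<delta>" "x \<in> {u..v}" "s < quot f u v"
      using frequently_difference_quotient_intervals[of "\<lambda>t. s < t" f x "min d \<delta>"] x \<delta>(1) by (auto simp: E_def)
    have "{u..v} \<subseteq> ball x \<delta>" using uv by (auto simp: dist_real_def)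
    then have "{u..v} \<subseteq> I" using \<delta>(2) by blast
    then show "\<exists>u v. u < v \<and> v - u < d \<and> x \<in> {u..v} \<and> s < quot f u v \<and> (\<exists>I\<in>A. {u..v} \<subseteq> I)"
      using uv I by auto
  next
    fix S assume S: "S \<in> lmeasurable" "E \<inter> V \<subseteq> S"
    \<comment> \<open>Covering \<open>E \<inter> V\<close> by \<open>S\<close> and the rest of \<open>E\<close> by \<open>U - V\<close> shows that \<open>E \<inter> V\<close> keeps most of the
      outer measure.\<close>
    have "e \<le> measure lebesgue (S \<union> (U - V))"
      using S U(2,3) Vl by (intro e(2)) (auto intro!: fmeasurable.Un fmeasurable_Diff)
    also have "\<dots> \<le> measure lebesgue S + measure lebesgue (U - V)"
      using S U(2) Vl by (intro measure_Un_le) auto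
    finally show "e - 2 * \<epsilon> \<le> measure lebesgue S" using UV by simp
  qed (use eps(1) in blast)+
  have Biv: "\<exists>u v. u < v \<and> K = {u..v}" "\<exists>I\<in>A. K \<subseteq> I" if "K \<in> B" for K using B(4)[OF that] by blast+
  obtain G where G: "G division_of \<Union>G" "\<Union>G \<subseteq> \<Union>A"
    "\<And>f. (\<Sum>K\<in>A. incr f K) = (\<Sum>K\<in>B. incr f K) + (\<Sum>K\<in>G. incr f K)"
    using disjoint_intervals_gaps[OF A(1,2) Aiv B(1,2) Biv] by blast
  define mA where "mA = measure lebesgue (\<Union>A)"
  define mB where "mB = measure lebesgue (\<Union>B)"
  define mG where "mG = (\<Sum>K\<in>G. incr (\<lambda>x. x) K)"
  have mAU: "mA < e + \<epsilon>"
    using measure_mono_fmeasurable[OF A(3) _ U(2)] Al U(5) by (auto simp: mA_def)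
  have mABG: "mA = mB + mG" using G(3)[of "\<lambda>x. x"] A(6) B(6) by (simp add: mA_def mB_def mG_def)
  have mG4: "mG < 4 * \<epsilon>" using mABG mAU B(5) by (simp add: mB_def)
  have mG0: "mG \<ge> 0" unfolding mG_def
  proof (rule sum_nonneg)
    fix K assume K: "K \<in> G"
    obtain u v where "K = cbox u v" using division_ofD(4)[OF G(1) K] by blast
    then show "0 \<le> incr (\<lambda>x. x) K" using division_ofD(3)[OF G(1) K] by auto
  qed
  have "\<Union>G \<subseteq> {a..b}" using G(2) A(3) U(4) by fastforce
  then have "(\<Sum>K\<in>G. \<bar>incr f K\<bar>) < \<eta>" using d(2)[OF G(1)] mG4 eps(3) by (simp add: mG_def)
  then have incG: "\<bar>\<Sum>K\<in>G. incr f K\<bar> < \<eta>" using sum_abs[of "incr f" G] by linarith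
  have "(\<Sum>K\<in>A. incr f K) \<le> (\<Sum>K\<in>A. r * incr (\<lambda>x. x) K)"
  proof (rule sum_mono)
    fix K assume "K \<in> A"
    then obtain u v where "u < v" "quot f u v < r" "K = {u..v}" using A(4) by blast
    then show "incr f K \<le> r * incr (\<lambda>x. x) K" by (simp add: divide_less_eq)
  qed
  then have iA: "(\<Sum>K\<in>A. incr f K) \<le> r * mA" using A(6) by (simp add: sum_distrib_left[symmetric] mA_def)
  have "(\<Sum>K\<in>B. s * incr (\<lambda>x. x) K) \<le> (\<Sum>K\<in>B. incr f K)"
  proof (rule sum_mono)
    fix K assume "K \<in> B"
    then obtain u v where "u < v" "s < quot f u v" "K = {u..v}" using B(4) by blast
    then show "s * incr (\<lambda>x. x) K \<le> incr f K" by (simp add: less_divide_eq)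
  qed
  then have iB: "s * mB \<le> (\<Sum>K\<in>B. incr f K)" using B(6) by (simp add: sum_distrib_left[symmetric] mB_def)
  have "s * mB \<le> r * mA + \<eta>" using iA iB G(3)[of f] incG by linarith
  then have "(s - r) * mA \<le> s * mG + \<eta>" unfolding mABG by (simp add: algebra_simps)
  moreover have "s * mG \<le> 4 * \<epsilon> * \<bar>s\<bar>"
    using mult_mono[of s "\<bar>s\<bar>" mG "4 * \<epsilon>"] mG4 mG0 by (simp add: mult.commute)
  moreover have "(s - r) * (3 / 4 * e) < (s - r) * mA"
    using A(5) eps(2) rs by (intro mult_strict_left_mono) (auto simp: mA_def)
  moreover have "(s - r) * (3 / 4 * e) = 3 * \<eta>" by (simp add: \<eta>_def)
  ultimately show False using eps4 \<eta> by linarith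
qed

text \<open>On a short interval the total variation of \<open>f\<close> is at most \<open>1\<close>, whereas disjoint intervals covering half
of a set of outer measure \<open>e\<close> with quotients above \<open>2 / e\<close> have increments adding up to more than \<open>1\<close>.\<close>

lemma negligible_unbounded_quotient:
  assumes f: "abs_continuous_on {a..b} f"
  shows "negligible {x\<in>{a<..<b}. \<forall>N. \<exists>\<^sub>F y in at x. N < \<bar>quot f x y\<bar>}" (is "negligible ?E")
proof -
  obtain d where d: "d > 0" "\<And>D. D division_of \<Union>D \<Longrightarrow> \<Union>D \<subseteq> {a..b} \<Longrightarrow> (\<Sum>K\<in>D. incr (\<lambda>x. x) K) < d
        \<Longrightarrow> (\<Sum>K\<in>D. \<bar>incr f K\<bar>) < 1"
    using abs_continuous_on_division[OF f zero_less_one] by blast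
  have loc: "negligible (?E \<inter> {c<..<c + d / 2})" for c
  proof (rule ccontr)
    let ?F = "?E \<inter> {c<..<c + d / 2}" and ?W = "{a<..<b} \<inter> {c<..<c + d / 2}"
    assume nn: "\<not> negligible ?F"
    have W: "open ?W" "bounded ?W" "?F \<subseteq> ?W" by (auto simp: bounded_Int)
    have Wl: "?W \<in> lmeasurable" by (rule lmeasurable_open[OF W(2,1)])
    obtain e where e: "e > 0" "\<And>S. S \<in> lmeasurable \<Longrightarrow> ?F \<subseteq> S \<Longrightarrow> e \<le> measure lebesgue S"
      by (rule non_negligible_outer_measure[OF W nn]) blast
    obtain D where D: "finite D" "pairwise disjnt D" "\<Union>D \<subseteq> ?W"
      "\<And>K. K \<in> D \<Longrightarrow> \<exists>u v. u < v \<and> 2 / e < \<bar>quot f u v\<bar> \<and> K = {u..v}"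
      "measure lebesgue (\<Union>D) > e - e / 2" "(\<Sum>K\<in>D. incr (\<lambda>x. x) K) = measure lebesgue (\<Union>D)"
    proof (rule Vitali_finite_intervals[OF W(1) Wl W(3) _ e(2),
          where \<epsilon> = "e / 2" and P = "\<lambda>u v. 2 / e < \<bar>quot f u v\<bar>"])
      fix x d :: real assume "x \<in> ?F" "d > 0"
      then show "\<exists>u v. u < v \<and> v - u < d \<and> x \<in> {u..v} \<and> 2 / e < \<bar>quot f u v\<bar>"
        using frequently_difference_quotient_intervals[of "\<lambda>t. 2 / e < \<bar>t\<bar>" f x d] by simp
    qed (use e(1) in auto)
    have Div: "\<exists>u v. u < v \<and> K = {u..v}" if "K \<in> D" for K using D(4)[OF that] by blast
    have Dl: "\<Union>D \<in> lmeasurable" using D(1) Div by (intro fmeasurable.finite_Union) fastforce+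
    have "measure lebesgue (\<Union>D) \<le> measure lebesgue {c<..<c + d / 2}"
      using D(3) Dl by (intro measure_mono_fmeasurable) auto
    then have "(\<Sum>K\<in>D. incr (\<lambda>x. x) K) < d" using d(1) D(6) by simp
    then have "(\<Sum>K\<in>D. \<bar>incr f K\<bar>) < 1"
      using D(3) by (intro d(2) disjoint_intervals_division[OF D(1,2) Div]) fastforce+
    moreover have "(\<Sum>K\<in>D. 2 / e * incr (\<lambda>x. x) K) \<le> (\<Sum>K\<in>D. \<bar>incr f K\<bar>)"
    proof (rule sum_mono)
      fix K assume "K \<in> D"
      then obtain u v where uv: "u < v" "2 / e < \<bar>quot f u v\<bar>" "K = {u..v}" using D(4) by blast
      then have "2 / e * (v - u) < \<bar>f v - f u\<bar>" by (simp add: pos_less_divide_eq)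
      then show "2 / e * incr (\<lambda>x. x) K \<le> \<bar>incr f K\<bar>" using uv by simp
    qed
    moreover have "2 / e * (e / 2) < 2 / e * measure lebesgue (\<Union>D)"
      using D(5) e(1) by (intro mult_strict_left_mono) auto
    moreover have "(\<Sum>K\<in>D. 2 / e * incr (\<lambda>x. x) K) = 2 / e * measure lebesgue (\<Union>D)"
      unfolding D(6)[symmetric] by (rule sum_distrib_left[symmetric])
    moreover have "2 / e * (e / 2) = 1" using e(1) by simp
    ultimately show False by linarith
  qed
  have "?E \<subseteq> (\<Union>c\<in>\<rat>. ?E \<inter> {c<..<c + d / 2})"
  proof
    fix x assume x: "x \<in> ?E"
    obtain c where "c \<in> \<rat>" "x - d / 2 < c" "c < x" using Rats_dense_in_real[of "x - d / 2" x] d(1) by auto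
    then show "x \<in> (\<Union>c\<in>\<rat>. ?E \<inter> {c<..<c + d / 2})" using x by auto
  qed
  moreover have "negligible (\<Union>c\<in>\<rat>. ?E \<inter> {c<..<c + d / 2})"
    using loc countable_rat by (intro negligible_countable_Union) auto
  ultimately show ?thesis by (rule negligible_subset[rotated])
qed

lemma convergent_if_bounded_not_oscillating:
  fixes q :: "'a \<Rightarrow> real"
  assumes F: "F \<noteq> bot" and bd: "\<forall>\<^sub>F y in F. \<bar>q y\<bar> \<le> N"
    and osc: "\<And>r s. r \<in> \<rat> \<Longrightarrow> s \<in> \<rat> \<Longrightarrow> r < s \<Longrightarrow> \<not> ((\<exists>\<^sub>F y in F. q y < r) \<and> (\<exists>\<^sub>F y in F. s < q y))"
  shows "\<exists>D. (q \<longlongrightarrow> D) F"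
proof -
  let ?q = "\<lambda>y. ereal (q y)"
  let ?l = "Liminf F ?q" and ?u = "Limsup F ?q"
  have lu: "?l \<le> ?u" by (rule Liminf_le_Limsup[OF F])
  have "ereal (- N) \<le> ?l" by (rule Liminf_bounded) (use bd in \<open>eventually_elim, simp\<close>)
  moreover have "?u \<le> ereal N" by (rule Limsup_bounded) (use bd in \<open>eventually_elim, simp\<close>)
  moreover have "\<not> ?l < ?u"
  proof
    assume "?l < ?u"
    then obtain r0 where r0: "?l < ereal r0" "ereal r0 < ?u" using ereal_dense2 by blast
    obtain s0 where s0: "ereal r0 < ereal s0" "ereal s0 < ?u" using ereal_dense2[OF r0(2)] by blast
    obtain t where t: "r0 < t" "t < s0" using dense s0(1) by auto
    obtain r where r: "r \<in> \<rat>" "r0 < r" "r < t" using Rats_dense_in_real[OF t(1)] by blast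
    obtain s where s: "s \<in> \<rat>" "t < s" "s < s0" using Rats_dense_in_real[OF t(2)] by blast
    have "\<exists>\<^sub>F y in F. q y < r"
    proof (rule ccontr)
      assume "\<not> ?thesis"
      then have "\<forall>\<^sub>F y in F. ereal r \<le> ?q y" by (simp add: not_frequently not_less)
      then have "ereal r \<le> ?l" by (rule Liminf_bounded)
      then show False using r0(1) r(2) by (metis ereal_less_eq(3) less_le_not_le order.strict_trans1 order.strict_trans2 linorder_not_less less_ereal.simps(1))
    qed
    moreover have "\<exists>\<^sub>F y in F. s < q y"
    proof (rule ccontr)
      assume "\<not> ?thesis"
      then have "\<forall>\<^sub>F y in F. ?q y \<le> ereal s" by (simp add: not_frequently not_less)
      then have "?u \<le> ereal s" by (rule Limsup_bounded)
      then show False using s0(2) s(3) by (metis leD less_ereal.simps(1) order.strict_trans)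
    qed
    ultimately show False using osc[OF r(1) s(1)] r s by auto
  qed
  ultimately obtain D where D: "?l = ereal D" "?u = ereal D"
    using lu by (cases ?l; cases ?u) auto
  then have "(?q \<longlongrightarrow> ereal D) F" by (intro Liminf_eq_Limsup F)
  then show ?thesis by auto
qed

text \<open>Where \<open>f\<close> is not differentiable, its difference quotients are unbounded or oscillate across an interval
with rational endpoints; these are countably many null sets.\<close>

theorem abs_continuous_on_differentiable_ae:
  assumes f: "abs_continuous_on {a..b} f"
  shows "negligible {x\<in>{a<..<b}. \<not> f differentiable (at x)}"
proof -
  define O' where "O' = (\<lambda>(r, s). {x\<in>{a<..<b}. (\<exists>\<^sub>F y in at x. quot f x y < r) \<and> (\<exists>\<^sub>F y in at x. s < quot f x y)})"
  let ?Q = "{(r, s). r \<in> \<rat> \<and> s \<in> \<rat> \<and> r < s}"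
  have "negligible (\<Union>i\<in>?Q. O' i)"
  proof (rule negligible_countable_Union)
    have "?Q \<subseteq> \<rat> \<times> \<rat>" by auto
    then show "countable (O' ` ?Q)" using countable_rat by (intro countable_image) (rule countable_subset[OF _ countable_SIGMA])
  qed (use negligible_oscillating_quotient[OF f] in \<open>auto simp: O'_def\<close>)
  then have "negligible ((\<Union>i\<in>?Q. O' i) \<union> {x\<in>{a<..<b}. \<forall>N. \<exists>\<^sub>F y in at x. N < \<bar>quot f x y\<bar>})"
    using negligible_unbounded_quotient[OF f] by (rule negligible_Un)
  moreover have "f differentiable (at x)"
    if x: "x \<in> {a<..<b}" and o: "x \<notin> (\<Union>i\<in>?Q. O' i)" and N: "\<not> (\<forall>N. \<exists>\<^sub>F y in at x. N < \<bar>quot f x y\<bar>)" for x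
  proof -
    obtain N where "\<forall>\<^sub>F y in at x. \<bar>quot f x y\<bar> \<le> N" using N by (auto simp: not_frequently not_less)
    then have "\<exists>D. (quot f x \<longlongrightarrow> D) (at x)"
      using o x by (intro convergent_if_bounded_not_oscillating) (auto simp: O'_def)
    then show ?thesis
      by (metis has_field_derivative_iff real_differentiable_def)
  qed
  ultimately show ?thesis by - (erule negligible_subset, blast)
qed

section \<open>Weights near regular points\<close>

lemma Lebesgue_decomposition_is:
  assumes "sets M = sets borel" "sigma_finite_measure M"
  shows "is_Lebesgue_decomposition M (singular_part M) (ac_density M)"
proof -
  have "\<exists>x. case x of (S, w) \<Rightarrow> is_Lebesgue_decomposition M S w"
    using Lebesgue_decomposition_exists[OF assms] by auto
  from someI_ex[OF this] show ?thesis
    unfolding singular_part_def ac_density_def Lebesgue_decomposition_def by (simp add: case_prod_unfold)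
qed

lemma ac_density_measurable:
  assumes "sets M = sets borel" "sigma_finite_measure M"
  shows "ac_density M \<in> borel_measurable borel"
  using Lebesgue_decomposition_is[OF assms] by (simp add: is_Lebesgue_decomposition_def)

text \<open>Off the two null sets carrying the singular parts, both measures are given by their densities, so
the densities define the same measure there.\<close>

lemma ac_density_unique_on:
  assumes M: "sets M = sets borel" "sigma_finite_measure M"
    and M': "sets M' = sets borel" "sigma_finite_measure M'"
    and I: "I \<in> sets borel" and eq: "\<And>A. A \<in> sets borel \<Longrightarrow> A \<subseteq> I \<Longrightarrow> emeasure M A = emeasure M' A"
  shows "AE x in lborel. x \<in> I \<longrightarrow> ac_density M x = ac_density M' x"
proof -
  note D = Lebesgue_decomposition_is[OF M, unfolded is_Lebesgue_decomposition_def]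
  note D' = Lebesgue_decomposition_is[OF M', unfolded is_Lebesgue_decomposition_def]
  obtain N where N: "N \<in> null_sets lborel" "emeasure (singular_part M) (UNIV - N) = 0" using D by blast
  obtain N' where N': "N' \<in> null_sets lborel" "emeasure (singular_part M') (UNIV - N') = 0" using D' by blast
  note [measurable] = ac_density_measurable[OF M] ac_density_measurable[OF M'] I
  have Nb [measurable]: "N \<in> sets borel" "N' \<in> sets borel" using N N' by auto
  define J where "J = I - N - N'"
  have J [measurable]: "J \<in> sets borel" by (simp add: J_def)
  have dens: "emeasure M A = (\<integral>\<^sup>+x\<in>A. ennreal (ac_density M x) \<partial>lborel)"
    "emeasure M' A = (\<integral>\<^sup>+x\<in>A. ennreal (ac_density M' x) \<partial>lborel)"
    if A: "A \<in> sets borel" "A \<subseteq> J" for A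
  proof -
    have "emeasure (singular_part M) A \<le> emeasure (singular_part M) (UNIV - N)"
      using A D Nb by (intro emeasure_mono) (auto simp: J_def)
    then show "emeasure M A = (\<integral>\<^sup>+x\<in>A. ennreal (ac_density M x) \<partial>lborel)" using D A N(2) by simp
    have "emeasure (singular_part M') A \<le> emeasure (singular_part M') (UNIV - N')"
      using A D' Nb by (intro emeasure_mono) (auto simp: J_def)
    then show "emeasure M' A = (\<integral>\<^sup>+x\<in>A. ennreal (ac_density M' x) \<partial>lborel)" using D' A N'(2) by simp
  qed
  let ?f = "\<lambda>x. ennreal (ac_density M x) * indicator J x" and ?g = "\<lambda>x. ennreal (ac_density M' x) * indicator J x"
  have "density lborel ?f = density lborel ?g"
  proof (rule measure_eqI)
    fix A assume "A \<in> sets (density lborel ?f)"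
    then have A [measurable]: "A \<in> sets borel" by simp
    have "emeasure (density lborel ?f) A = (\<integral>\<^sup>+x. ?f x * indicator A x \<partial>lborel)"
      by (rule emeasure_density) simp_all
    also have "\<dots> = (\<integral>\<^sup>+x\<in>A \<inter> J. ennreal (ac_density M x) \<partial>lborel)"
      by (rule nn_integral_cong) (simp split: split_indicator)
    also have "\<dots> = (\<integral>\<^sup>+x\<in>A \<inter> J. ennreal (ac_density M' x) \<partial>lborel)"
      using dens[of "A \<inter> J"] eq[of "A \<inter> J"] by (simp add: J_def le_infI2 subset_eq)
    also have "\<dots> = (\<integral>\<^sup>+x. ?g x * indicator A x \<partial>lborel)"
      by (rule nn_integral_cong) (simp split: split_indicator)
    also have "\<dots> = emeasure (density lborel ?g) A" by (rule emeasure_density[symmetric]) simp_all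
    finally show "emeasure (density lborel ?f) A = emeasure (density lborel ?g) A" .
  qed simp
  then have "AE x in lborel. ?f x = ?g x"
    by (intro sigma_finite_measure.density_unique[OF sigma_finite_lborel]) simp_all
  moreover have "AE x in lborel. x \<notin> N \<and> x \<notin> N'" using N(1) N'(1) by (auto dest: AE_not_in)
  ultimately show ?thesis
  proof eventually_elim
    case (elim x)
    then show ?case using D D' by (auto simp: J_def)
  qed
qed

lemma ennreal_powr_mono: "x \<le> y \<Longrightarrow> 0 \<le> r \<Longrightarrow> ennreal_powr x r \<le> ennreal_powr y r"
  by (auto simp: ennreal_powr_def top_unique less_top intro!: ennreal_leI powr_mono2 enn2real_mono)

lemma inv_weight_norm_mono:
  assumes AB: "A \<subseteq> B" "A \<in> sets borel" "B \<in> sets borel"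
    and [measurable]: "w \<in> borel_measurable borel" "w' \<in> borel_measurable borel"
    and ae: "AE x in lborel. x \<in> A \<longrightarrow> w x = w' x"
  shows "inv_weight_norm p w A \<le> inv_weight_norm p w' B"
proof -
  let ?r = "1 / ennreal (p - 1)"
  let ?f = "\<lambda>x. inverse (ennreal (w x))" and ?g = "\<lambda>x. inverse (ennreal (w' x))"
  have m: "?f \<in> borel_measurable (restrict_space lborel A)" "?g \<in> borel_measurable (restrict_space lborel B)"
    by (auto intro!: measurable_restrict_space1)
  show ?thesis
  proof (cases "?r = \<infinity>")
    case True
    have "AE x in restrict_space lborel B. ?g x \<le> esssup (restrict_space lborel B) ?g" by (rule esssup_AE)
    then have "AE x in lborel. x \<in> B \<longrightarrow> ?g x \<le> esssup (restrict_space lborel B) ?g"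
      using AB by (simp add: AE_restrict_space_iff)
    then have "AE x in lborel. x \<in> A \<longrightarrow> ?f x \<le> esssup (restrict_space lborel B) ?g"
      using ae by eventually_elim (use AB in auto)
    then have "AE x in restrict_space lborel A. ?f x \<le> esssup (restrict_space lborel B) ?g"
      using AB by (simp add: AE_restrict_space_iff)
    then show ?thesis using m True by (auto simp: inv_weight_norm_def L_norm_nn_def intro: esssup_I)
  next
    case False
    have "(\<integral>\<^sup>+x. ennreal_powr (?f x) (enn2real ?r) \<partial>restrict_space lborel A)
        = (\<integral>\<^sup>+x. ennreal_powr (?f x) (enn2real ?r) * indicator A x \<partial>lborel)"
      using AB by (subst nn_integral_restrict_space) auto
    also have "\<dots> \<le> (\<integral>\<^sup>+x. ennreal_powr (?g x) (enn2real ?r) * indicator B x \<partial>lborel)"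
      by (rule nn_integral_mono_AE) (use ae in eventually_elim, use AB in \<open>auto split: split_indicator\<close>)
    also have "\<dots> = (\<integral>\<^sup>+x. ennreal_powr (?g x) (enn2real ?r) \<partial>restrict_space lborel B)"
      using AB by (subst nn_integral_restrict_space) auto
    finally show ?thesis using False by (simp add: inv_weight_norm_def L_norm_nn_def ennreal_powr_mono)
  qed
qed

lemma B_class_transfer:
  assumes "w' \<in> B_class p B" "A \<subseteq> B" "w \<in> borel_measurable borel" "w' \<in> borel_measurable borel"
    and "AE x in lborel. x \<in> A \<longrightarrow> w x = w' x"
  shows "w \<in> B_class p A"
  unfolding B_class_def
proof (intro CollectI allI impI)
  fix K assume K: "compact K \<and> K \<subseteq> A"
  have "inv_weight_norm p w K \<le> inv_weight_norm p w' K"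
    using assms(5) by (intro inv_weight_norm_mono assms) (use K in \<open>auto simp: borel_compact\<close>)
  also have "\<dots> < \<infinity>" using assms(1,2) K by (auto simp: B_class_def)
  finally show "inv_weight_norm p w K < \<infinity>" .
qed

lemma B_class_mono: "w \<in> B_class p B \<Longrightarrow> A \<subseteq> B \<Longrightarrow> w \<in> B_class p A"
  by (auto simp: B_class_def)

definition sigma_finite_vector :: "nat \<Rightarrow> (nat \<Rightarrow> real measure) \<Rightarrow> bool" where
  "sigma_finite_vector k \<mu> \<longleftrightarrow> (\<forall>j\<le>k. sets (\<mu> j) = sets borel \<and> sigma_finite_measure (\<mu> j))"

text \<open>Only the original measures matter near an end point of a completion. Here \<open>H\<close> is the half-open
interval, \<open>N x\<close> its part between the end point and \<open>x\<close>, and \<open>R x\<close> the rest, so that left and right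
neighbourhoods are treated at once. If the added measure \<open>\<tau>\<close> at index \<open>n\<close> vanishes on some \<open>N c\<close>, the
completed and the original densities at \<open>n\<close> agree there. Otherwise all \<open>\<tau> (N x)\<close> are positive, and
finiteness of the Muckenhoupt constant makes the norm of the next inverse weight finite on every
\<open>R x\<close>; so the next completed weight is of class \<open>B\<^sub>p\<close> on \<open>H\<close>, and the argument moves on to index \<open>n + 1\<close>.
It stops at \<open>k\<close>, where nothing is added.\<close>

lemma weight_near_regular_end:
  assumes \<mu>: "sigma_finite_vector k \<mu>"
    and \<mu>': "\<And>j. j \<le> k \<Longrightarrow> sets (\<mu>' j) = sets borel"
    and top: "\<And>A. A \<in> sets borel \<Longrightarrow> A \<subseteq> H \<Longrightarrow> emeasure (\<mu>' k) A = emeasure (\<mu> k) A"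
    and off: "\<And>j A. j \<le> k \<Longrightarrow> A \<in> sets borel \<Longrightarrow> A \<subseteq> - H \<Longrightarrow> emeasure (\<mu>' j) A = emeasure (\<mu> j) A"
    and on: "\<And>j. j < k \<Longrightarrow> \<exists>\<tau>. sets \<tau> = sets borel \<and>
        (\<forall>A\<in>sets borel. A \<subseteq> H \<longrightarrow> emeasure (\<mu>' j) A = emeasure (\<mu> j) A + emeasure \<tau> A) \<and>
        emeasure \<tau> H < \<infinity> \<and>
        (SUP x\<in>X. emeasure \<tau> (N x) * inv_weight_norm p (ac_density (\<mu>' (Suc j))) (R x)) < \<infinity>"
    and H: "H \<in> sets borel" and X: "X \<noteq> {}"
    and N: "\<And>x. x \<in> X \<Longrightarrow> N x \<subseteq> H \<and> N x \<in> sets borel"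
    and R: "\<And>x. R x \<in> sets borel" "\<And>K. compact K \<Longrightarrow> K \<subseteq> H \<Longrightarrow> \<exists>x\<in>X. K \<subseteq> R x"
    and i: "i \<le> k" "ac_density (\<mu>' i) \<in> B_class p H"
  shows "\<exists>m c. i \<le> m \<and> m \<le> k \<and> c \<in> X \<and> ac_density (\<mu> m) \<in> B_class p (N c)"
proof -
  note s\<mu> = \<mu>[unfolded sigma_finite_vector_def, rule_format]
  \<comment> \<open>Uniqueness of densities is available only for \<open>\<sigma>\<close>-finite measures; the completion inherits this
    from \<open>\<mu>\<close> because only a finite measure is added.\<close>
  have sf: "sigma_finite_measure (\<mu>' j)" if j: "j \<le> k" for j
  proof -
    interpret sigma_finite_measure "\<mu> j" using s\<mu> j by simp
    obtain A where A: "countable A" "A \<subseteq> sets (\<mu> j)" "\<Union>A = space (\<mu> j)" "\<forall>a\<in>A. emeasure (\<mu> j) a \<noteq> \<infinity>"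
      using sigma_finite_countable by blast
    have Ab: "a \<in> sets borel" if "a \<in> A" for a using A(2) that s\<mu>[OF j] by auto
    have spm: "space (\<mu> j) = UNIV" "space (\<mu>' j) = UNIV"
      using s\<mu>[OF j] \<mu>'[OF j] sets_eq_imp_space_eq by (metis space_borel)+
    show ?thesis
    proof
      let ?B = "(\<lambda>a. a \<inter> H) ` A \<union> (\<lambda>a. a - H) ` A"
      have "emeasure (\<mu>' j) (a \<inter> H) \<noteq> \<infinity> \<and> emeasure (\<mu>' j) (a - H) \<noteq> \<infinity>" if a: "a \<in> A" for a
      proof
        have fin: "emeasure (\<mu> j) (a \<inter> H) \<noteq> \<infinity>" "emeasure (\<mu> j) (a - H) \<noteq> \<infinity>"
          using A(2,4) a emeasure_mono[of "a \<inter> H" a "\<mu> j"] emeasure_mono[of "a - H" a "\<mu> j"]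
          by (auto simp: top_unique)
        show "emeasure (\<mu>' j) (a - H) \<noteq> \<infinity>" using off[OF j, of "a - H"] Ab[OF a] H fin(2) by (simp add: Diff_eq)
        show "emeasure (\<mu>' j) (a \<inter> H) \<noteq> \<infinity>"
        proof (cases "j = k")
          case True
          then show ?thesis using top[of "a \<inter> H"] Ab[OF a] H fin(1) by auto
        next
          case False
          then obtain \<tau> where t: "sets \<tau> = sets borel" "emeasure \<tau> H < \<infinity>"
            "\<forall>A\<in>sets borel. A \<subseteq> H \<longrightarrow> emeasure (\<mu>' j) A = emeasure (\<mu> j) A + emeasure \<tau> A"
            using on[of j] j by auto
          have "emeasure \<tau> (a \<inter> H) \<le> emeasure \<tau> H" using t(1) H by (intro emeasure_mono) auto
          then have "emeasure \<tau> (a \<inter> H) \<noteq> \<infinity>" using t(2) by auto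
          then show ?thesis using t(3) Ab[OF a] H fin(1) by simp
        qed
      qed
      then show "\<exists>B. countable B \<and> B \<subseteq> sets (\<mu>' j) \<and> \<Union>B = space (\<mu>' j) \<and> (\<forall>a\<in>B. emeasure (\<mu>' j) a \<noteq> \<infinity>)"
        using A(1,3) Ab H \<mu>'[OF j] spm by (intro exI[of _ ?B]) auto
    qed
  qed
  have meas': "ac_density (\<mu>' j) \<in> borel_measurable borel" if "j \<le> k" for j
    using ac_density_measurable[OF \<mu>'[OF that] sf[OF that]] .
  have meas: "ac_density (\<mu> j) \<in> borel_measurable borel" if "j \<le> k" for j
    using ac_density_measurable s\<mu> that by blast
  have transfer_at: "ac_density (\<mu> m) \<in> B_class p (N c)"
    if m: "m \<le> k" "ac_density (\<mu>' m) \<in> B_class p H" and c: "c \<in> X"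
      and eq: "\<And>A. A \<in> sets borel \<Longrightarrow> A \<subseteq> N c \<Longrightarrow> emeasure (\<mu> m) A = emeasure (\<mu>' m) A" for m c
  proof (rule B_class_transfer[OF m(2) _ meas[OF m(1)] meas'[OF m(1)]])
    show "N c \<subseteq> H" using N[OF c] by simp
    show "AE x in lborel. x \<in> N c \<longrightarrow> ac_density (\<mu> m) x = ac_density (\<mu>' m) x"
      using s\<mu>[OF m(1)] \<mu>'[OF m(1)] sf[OF m(1)] N[OF c] eq by (intro ac_density_unique_on) auto
  qed
  have "ac_density (\<mu>' i) \<in> B_class p H \<longrightarrow>
      (\<exists>m c. i \<le> m \<and> m \<le> k \<and> c \<in> X \<and> ac_density (\<mu> m) \<in> B_class p (N c))"
    using i(1)
  proof (induction i rule: inc_induct)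
    case base
    obtain c where c: "c \<in> X" using X by blast
    have "ac_density (\<mu> k) \<in> B_class p (N c)" if "ac_density (\<mu>' k) \<in> B_class p H"
      by (rule transfer_at[OF order_refl that c]) (use top N[OF c] in auto)
    then show ?case using c by blast
  next
    case (step n)
    obtain \<tau> where t: "sets \<tau> = sets borel"
      "\<forall>A\<in>sets borel. A \<subseteq> H \<longrightarrow> emeasure (\<mu>' n) A = emeasure (\<mu> n) A + emeasure \<tau> A"
      "(SUP x\<in>X. emeasure \<tau> (N x) * inv_weight_norm p (ac_density (\<mu>' (Suc n))) (R x)) < \<infinity>"
      using on[OF step(2)] by blast
    show ?case
    proof (cases "\<exists>c\<in>X. emeasure \<tau> (N c) = 0")
      case True
      then obtain c where c: "c \<in> X" "emeasure \<tau> (N c) = 0" by blast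
      have "ac_density (\<mu> n) \<in> B_class p (N c)" if "ac_density (\<mu>' n) \<in> B_class p H"
      proof (rule transfer_at[OF _ that c(1)])
        show "n \<le> k" using step by simp
        fix A :: "real set" assume A: "A \<in> sets borel" "A \<subseteq> N c"
        have "emeasure \<tau> A \<le> emeasure \<tau> (N c)" using A N[OF c(1)] t(1) by (intro emeasure_mono) auto
        then show "emeasure (\<mu> n) A = emeasure (\<mu>' n) A" using A N[OF c(1)] t(2) c(2) by auto
      qed
      then show ?thesis using c step by (metis less_imp_le order_refl)
    next
      case False
      have "ac_density (\<mu>' (Suc n)) \<in> B_class p H"
        unfolding B_class_def
      proof (intro CollectI allI impI)
        fix K assume K: "compact K \<and> K \<subseteq> H"
        then obtain x where x: "x \<in> X" "K \<subseteq> R x" using R(2) by blast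
        have "emeasure \<tau> (N x) * inv_weight_norm p (ac_density (\<mu>' (Suc n))) (R x) < \<infinity>"
          using t(3) x(1) by (meson SUP_upper order.strict_trans1)
        moreover have "emeasure \<tau> (N x) \<noteq> 0" using False x(1) by blast
        ultimately have "inv_weight_norm p (ac_density (\<mu>' (Suc n))) (R x) < \<infinity>"
          by (auto simp: ennreal_mult_less_top less_top)
        moreover have "inv_weight_norm p (ac_density (\<mu>' (Suc n))) K \<le> inv_weight_norm p (ac_density (\<mu>' (Suc n))) (R x)"
          using x(2) K R(1) meas'[of "Suc n"] step(2) by (intro inv_weight_norm_mono) (auto simp: borel_compact)
        ultimately show "inv_weight_norm p (ac_density (\<mu>' (Suc n))) K < \<infinity>" by simp
      qed
      then show ?thesis using step.IH by (meson Suc_leD)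
    qed
  qed
  then show ?thesis using i(2) by blast
qed

lemma right_regular_weight:
  assumes \<mu>: "sigma_finite_vector k \<mu>" and r: "right_regular p k \<mu> j a"
  shows "\<exists>m c. j < m \<and> m \<le> k \<and> a < c \<and> ac_density (\<mu> m) \<in> B_class p {a<..c}"
proof -
  obtain b \<mu>' i where c: "right_completion p k \<mu> a b \<mu>'" and i: "j < i" "i \<le> k" "ac_density (\<mu>' i) \<in> B_class p {a..b}"
    using r unfolding right_regular_def by blast
  note C = c[unfolded right_completion_def Muckenhoupt_right_def]
  have "\<exists>m c. i \<le> m \<and> m \<le> k \<and> c \<in> {a<..<b} \<and> ac_density (\<mu> m) \<in> B_class p {a<..c}"
  proof (rule weight_near_regular_end[OF \<mu>, where \<mu>' = \<mu>' and H = "{a<..b}" and R = "\<lambda>x. {x..b}"])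
    show "\<exists>x\<in>{a<..<b}. K \<subseteq> {x..b}" if K: "compact K" "K \<subseteq> {a<..b}" for K
    proof (cases "K = {}")
      case True
      then show ?thesis using C dense[of a b] by auto
    next
      case False
      then obtain u where u: "u \<in> K" "\<forall>x\<in>K. u \<le> x" using compact_attains_inf[OF K(1)] by blast
      then obtain x where x: "a < x" "x < u" using dense[of a u] u(1) K(2) by (auto simp: subset_eq)
      have "x \<in> {a<..<b}" using x u K(2) by auto
      moreover have "K \<subseteq> {x..b}" using u x K(2) by force
      ultimately show ?thesis by blast
    qed
    show "i \<le> k" by (rule i(2))
    show "ac_density (\<mu>' i) \<in> B_class p {a<..b}" using i(3) by (rule B_class_mono) auto
    show "{a<..<b} \<noteq> {}" using C by simp
    show "emeasure (\<mu>' k) A = emeasure (\<mu> k) A" if "A \<in> sets borel" "A \<subseteq> {a<..b}" for A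
    proof -
      have "A \<subseteq> {a..b}" using that(2) by auto
      then show ?thesis using C that(1) by blast
    qed
  qed (use C in auto)
  then show ?thesis using i(1) by (metis greaterThanLessThan_iff order.strict_trans2)
qed

lemma left_regular_weight:
  assumes \<mu>: "sigma_finite_vector k \<mu>" and r: "left_regular p k \<mu> j a"
  shows "\<exists>m c. j < m \<and> m \<le> k \<and> c < a \<and> ac_density (\<mu> m) \<in> B_class p {c..<a}"
proof -
  obtain b \<mu>' i where c: "left_completion p k \<mu> b a \<mu>'" and i: "j < i" "i \<le> k" "ac_density (\<mu>' i) \<in> B_class p {b..a}"
    using r unfolding left_regular_def by blast
  note C = c[unfolded left_completion_def Muckenhoupt_left_def]
  have "\<exists>m c. i \<le> m \<and> m \<le> k \<and> c \<in> {b<..<a} \<and> ac_density (\<mu> m) \<in> B_class p {c..<a}"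
  proof (rule weight_near_regular_end[OF \<mu>, where \<mu>' = \<mu>' and H = "{b..<a}" and R = "\<lambda>x. {b..x}"])
    show "\<exists>x\<in>{b<..<a}. K \<subseteq> {b..x}" if K: "compact K" "K \<subseteq> {b..<a}" for K
    proof (cases "K = {}")
      case True
      then show ?thesis using C dense[of b a] by auto
    next
      case False
      then obtain u where u: "u \<in> K" "\<forall>x\<in>K. x \<le> u" using compact_attains_sup[OF K(1)] by blast
      then obtain x where x: "u < x" "x < a" using dense[of u a] u(1) K(2) by (auto simp: subset_eq)
      have "x \<in> {b<..<a}" using x u K(2) by force
      moreover have "K \<subseteq> {b..x}" using u x K(2) by force
      ultimately show ?thesis by blast
    qed
    show "i \<le> k" by (rule i(2))
    show "ac_density (\<mu>' i) \<in> B_class p {b..<a}" using i(3) by (rule B_class_mono) auto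
    show "{b<..<a} \<noteq> {}" using C by simp
    show "emeasure (\<mu>' k) A = emeasure (\<mu> k) A" if "A \<in> sets borel" "A \<subseteq> {b..<a}" for A
    proof -
      have "A \<subseteq> {b..a}" using that(2) by auto
      then show ?thesis using C that(1) by blast
    qed
  qed (use C in auto)
  then show ?thesis using i(1) by (metis greaterThanLessThan_iff order.strict_trans2)
qed

text \<open>The trivial completion, with nothing added, witnesses regularity.\<close>

lemma regular_of_weight:
  assumes \<mu>: "sigma_finite_vector k \<mu>" and m: "j < m" "m \<le> k"
    and w: "ac_density (\<mu> m) \<in> B_class p {a..b}" "a < b"
  shows "right_regular p k \<mu> j a" "left_regular p k \<mu> j b"
proof -
  have t: "\<exists>\<tau>. sets \<tau> = sets borel \<and>
        (\<forall>A\<in>sets borel. A \<subseteq> H \<longrightarrow> emeasure (\<mu> l) A = emeasure (\<mu> l) A + emeasure \<tau> A) \<and>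
        emeasure \<tau> H < \<infinity> \<and> (SUP x\<in>{a<..<b}. emeasure \<tau> (N x) * c x) < \<infinity>"
    for H :: "real set" and l N and c :: "real \<Rightarrow> ennreal"
    using w(2) by (intro exI[of _ "null_measure borel"]) auto
  have "right_completion p k \<mu> a b \<mu>"
    unfolding right_completion_def Muckenhoupt_right_def
    using \<mu> w(2) t by (auto simp: sigma_finite_vector_def)
  then show "right_regular p k \<mu> j a" unfolding right_regular_def using m w by blast
  have "left_completion p k \<mu> a b \<mu>"
    unfolding left_completion_def Muckenhoupt_left_def
    using \<mu> w(2) t by (auto simp: sigma_finite_vector_def)
  then show "left_regular p k \<mu> j b" unfolding left_regular_def using m w by blast
qed

lemma Omega_reg_of_weight:
  assumes \<mu>: "sigma_finite_vector k \<mu>" and m: "j < m" "m \<le> k"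
    and w: "ac_density (\<mu> m) \<in> B_class p V" and V: "{c..d} \<subseteq> V"
  shows "{c<..<d} \<subseteq> Omega_reg p k \<mu> j"
proof
  fix y assume y: "y \<in> {c<..<d}"
  have "ac_density (\<mu> m) \<in> B_class p {y..d}" "ac_density (\<mu> m) \<in> B_class p {c..y}"
    using w V y by (auto elim!: B_class_mono)
  then show "y \<in> Omega_reg p k \<mu> j"
    using regular_of_weight[OF \<mu> m] y by (auto simp: Omega_reg_def)
qed

lemma interval_in_Omega_reg_of_weight:
  assumes \<mu>: "sigma_finite_vector k \<mu>" and m: "j < m" "m \<le> k"
    and w: "ac_density (\<mu> m) \<in> B_class p V" and V: "{c..d} \<subseteq> V" "c < d"
  shows "interval_in_Omega_reg p k \<mu> j c d"
  using Omega_reg_of_weight[OF \<mu> m w V(1)] regular_of_weight[OF \<mu> m B_class_mono[OF w V(1)] V(2)] V(2)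
  by (auto simp: interval_in_Omega_reg_def)

text \<open>The weights found on both sides of \<open>x\<close> may have different indices, but each makes the points of its side
regular through the trivial completion; thus the regular set is open.\<close>

lemma Omega_reg_neighbourhood:
  assumes \<mu>: "sigma_finite_vector k \<mu>" and x: "x \<in> Omega_reg p k \<mu> j"
  shows "\<exists>c d. c < x \<and> x < d \<and> interval_in_Omega_reg p k \<mu> j c d"
proof -
  obtain m d where m: "j < m" "m \<le> k" "x < d" "ac_density (\<mu> m) \<in> B_class p {x<..d}"
    using right_regular_weight[OF \<mu>, of p j x] x by (auto simp: Omega_reg_def)
  obtain n c where n: "j < n" "n \<le> k" "c < x" "ac_density (\<mu> n) \<in> B_class p {c..<x}"
    using left_regular_weight[OF \<mu>, of p j x] x by (auto simp: Omega_reg_def)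
  have D: "{x<..<d} \<subseteq> Omega_reg p k \<mu> j"
  proof
    fix y assume y: "y \<in> {x<..<d}"
    obtain z where z: "x < z" "z < y" using y dense by auto
    then have "{z<..<d} \<subseteq> Omega_reg p k \<mu> j"
      by (intro Omega_reg_of_weight[OF \<mu> m(1,2,4)]) auto
    then show "y \<in> Omega_reg p k \<mu> j" using y z by auto
  qed
  have C: "{c<..<x} \<subseteq> Omega_reg p k \<mu> j"
  proof
    fix y assume y: "y \<in> {c<..<x}"
    obtain z where z: "y < z" "z < x" using y dense by auto
    then have "{c<..<z} \<subseteq> Omega_reg p k \<mu> j"
      by (intro Omega_reg_of_weight[OF \<mu> n(1,2,4)]) auto
    then show "y \<in> Omega_reg p k \<mu> j" using y z by auto
  qed
  obtain c' where c': "c < c'" "c' < x" using n(3) dense by blast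
  obtain d' where d': "x < d'" "d' < d" using m(3) dense by blast
  have all: "{c<..<d} \<subseteq> Omega_reg p k \<mu> j"
  proof
    fix y assume "y \<in> {c<..<d}"
    then consider "y \<in> {c<..<x}" | "y = x" | "y \<in> {x<..<d}" by force
    then show "y \<in> Omega_reg p k \<mu> j" by cases (use C D x in auto)
  qed
  have "c' \<in> Omega_reg p k \<mu> j" "d' \<in> Omega_reg p k \<mu> j" "{c'<..<d'} \<subseteq> Omega_reg p k \<mu> j"
    using all c' d' by auto
  then show ?thesis using c' d'
    by (intro exI[of _ c'] exI[of _ d']) (auto simp: interval_in_Omega_reg_def Omega_reg_def)
qed

section \<open>Higher derivatives almost everywhere\<close>

text \<open>Existence of the iterated derivative of order \<open>j\<close> at \<open>x\<close> in the form in which it passes to sums: the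
derivatives of order less than \<open>j\<close> exist in a neighbourhood, where they are then additive, and the
last one is differentiable at \<open>x\<close> only, as almost everywhere differentiability provides no more.\<close>

definition diff_times_at :: "nat \<Rightarrow> (real \<Rightarrow> real) \<Rightarrow> real \<Rightarrow> bool" where
  "diff_times_at j f x \<longleftrightarrow> (\<exists>U. open U \<and> x \<in> U \<and>
     (\<forall>i y. Suc i < j \<longrightarrow> y \<in> U \<longrightarrow> (deriv ^^ i) f differentiable at y) \<and>
     (\<forall>i. Suc i = j \<longrightarrow> (deriv ^^ i) f differentiable at x))"

lemma diff_times_at_0: "diff_times_at 0 f x"
  unfolding diff_times_at_def by (intro exI[of _ UNIV]) auto

lemma deriv_linear:
  fixes F G :: "real \<Rightarrow> real"
  assumes "F differentiable at x" "G differentiable at x"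
  shows "deriv (\<lambda>x. a * F x + b * G x) x = a * deriv F x + b * deriv G x"
proof -
  have "(F has_real_derivative deriv F x) (at x)" "(G has_real_derivative deriv G x) (at x)"
    using assms by (auto simp: DERIV_deriv_iff_real_differentiable)
  then have "((\<lambda>x. a * F x + b * G x) has_real_derivative a * deriv F x + b * deriv G x) (at x)"
    by (auto intro!: derivative_eq_intros)
  then show ?thesis by (rule DERIV_imp_deriv)
qed

lemma higher_deriv_linear:
  assumes f: "diff_times_at j f x" and g: "diff_times_at j g x"
  shows "(deriv ^^ j) (\<lambda>x. a * f x + b * g x) x = a * (deriv ^^ j) f x + b * (deriv ^^ j) g x"
proof -
  obtain U where U: "open U" "x \<in> U" "\<And>i y. Suc i < j \<Longrightarrow> y \<in> U \<Longrightarrow> (deriv ^^ i) f differentiable at y"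
    "\<And>i. Suc i = j \<Longrightarrow> (deriv ^^ i) f differentiable at x"
    using f unfolding diff_times_at_def by blast
  obtain V where V: "open V" "x \<in> V" "\<And>i y. Suc i < j \<Longrightarrow> y \<in> V \<Longrightarrow> (deriv ^^ i) g differentiable at y"
    "\<And>i. Suc i = j \<Longrightarrow> (deriv ^^ i) g differentiable at x"
    using g unfolding diff_times_at_def by blast
  let ?h = "\<lambda>x. a * f x + b * g x"
  have near: "\<forall>y\<in>U \<inter> V. (deriv ^^ i) ?h y = a * (deriv ^^ i) f y + b * (deriv ^^ i) g y" if "i < j" for i
    using that
  proof (induction i)
    case (Suc i)
    show ?case
    proof
      fix y assume y: "y \<in> U \<inter> V"
      have "\<forall>\<^sub>F z in nhds y. z \<in> U \<inter> V" using U(1) V(1) y by (intro eventually_nhds_in_open) auto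
      then have "\<forall>\<^sub>F z in nhds y. (deriv ^^ i) ?h z = a * (deriv ^^ i) f z + b * (deriv ^^ i) g z"
        by eventually_elim (use Suc in auto)
      then have "deriv ((deriv ^^ i) ?h) y = deriv (\<lambda>z. a * (deriv ^^ i) f z + b * (deriv ^^ i) g z) y"
        by (rule deriv_cong_ev) simp
      also have "\<dots> = a * deriv ((deriv ^^ i) f) y + b * deriv ((deriv ^^ i) g) y"
        using U(3) V(3) y Suc.prems by (intro deriv_linear) auto
      finally show "(deriv ^^ Suc i) ?h y = a * (deriv ^^ Suc i) f y + b * (deriv ^^ Suc i) g y" by simp
    qed
  qed simp
  show ?thesis
  proof (cases j)
    case (Suc i)
    have "\<forall>\<^sub>F z in nhds x. z \<in> U \<inter> V" using U(1,2) V(1,2) by (intro eventually_nhds_in_open) auto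
    then have "\<forall>\<^sub>F z in nhds x. (deriv ^^ i) ?h z = a * (deriv ^^ i) f z + b * (deriv ^^ i) g z"
      by eventually_elim (use near Suc in auto)
    then have "deriv ((deriv ^^ i) ?h) x = deriv (\<lambda>z. a * (deriv ^^ i) f z + b * (deriv ^^ i) g z) x"
      by (rule deriv_cong_ev) simp
    also have "\<dots> = a * deriv ((deriv ^^ i) f) x + b * deriv ((deriv ^^ i) g) x"
      using U(4) V(4) Suc by (intro deriv_linear) auto
    finally show ?thesis using Suc by simp
  qed simp
qed

lemma has_nth_derivative_on_deriv:
  assumes "has_nth_derivative_on j {c..d} f g"
  shows "\<And>i x. i < j \<Longrightarrow> x \<in> {c<..<d} \<Longrightarrow> (deriv ^^ i) f differentiable at x"
    and "\<And>x. x \<in> {c<..<d} \<Longrightarrow> (deriv ^^ j) f x = g x"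
proof -
  obtain h where h: "h 0 = f" "h j = g"
    "\<And>i x. i < j \<Longrightarrow> x \<in> {c..d} \<Longrightarrow> (h i has_real_derivative h (Suc i) x) (at x within {c..d})"
    using assms unfolding has_nth_derivative_on_def by blast
  have D: "(h i has_real_derivative h (Suc i) x) (at x)" if "i < j" "x \<in> {c<..<d}" for i x
  proof -
    have "at x within {c..d} = at x" using that(2) by (intro at_within_interior) auto
    then show ?thesis using h(3)[OF that(1), of x] that(2) by auto
  qed
  have eq: "\<forall>x\<in>{c<..<d}. (deriv ^^ i) f x = h i x" if "i \<le> j" for i
    using that
  proof (induction i)
    case (Suc i)
    show ?case
    proof
      fix x assume x: "x \<in> {c<..<d}"
      have "\<forall>\<^sub>F z in nhds x. z \<in> {c<..<d}" using x by (intro eventually_nhds_in_open) auto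
      then have "\<forall>\<^sub>F z in nhds x. (deriv ^^ i) f z = h i z" by eventually_elim (use Suc in auto)
      then have "deriv ((deriv ^^ i) f) x = deriv (h i) x" by (rule deriv_cong_ev) simp
      also have "\<dots> = h (Suc i) x" using D[of i x] Suc.prems x by (intro DERIV_imp_deriv) auto
      finally show "(deriv ^^ Suc i) f x = h (Suc i) x" by simp
    qed
  qed (simp add: h)
  show "(deriv ^^ j) f x = g x" if "x \<in> {c<..<d}" for x using eq[of j] that h(2) by simp
  show "(deriv ^^ i) f differentiable at x" if i: "i < j" and x: "x \<in> {c<..<d}" for i x
  proof -
    have "((deriv ^^ i) f has_real_derivative h (Suc i) x) (at x)"
    proof (rule has_field_derivative_transform_within_open[OF D[OF i x]])
      show "h i y = (deriv ^^ i) f y" if "y \<in> {c<..<d}" for y using eq[of i] i that by auto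
    qed (use x in auto)
    then show ?thesis by (auto simp: real_differentiable_def)
  qed
qed

text \<open>The absolutely continuous \<open>j\<close>-th derivative within the closed interval agrees with the iterated
\<open>deriv\<close> in the interior.\<close>

lemma diff_times_ae_on_interval:
  assumes I: "interval_in_Omega_reg p k \<mu> j c d" and f: "derivative_AC_loc p k \<mu> j f"
  shows "negligible {x\<in>{c<..<d}. \<not> diff_times_at (Suc j) f x}"
proof -
  obtain g where g: "has_nth_derivative_on j {c..d} f g" "abs_continuous_on {c..d} g"
    using f I unfolding derivative_AC_loc_def by blast
  note G = has_nth_derivative_on_deriv[OF g(1)]
  have "{x\<in>{c<..<d}. \<not> diff_times_at (Suc j) f x} \<subseteq> {x\<in>{c<..<d}. \<not> g differentiable at x}"
  proof (intro subsetI CollectI conjI notI)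
    fix x assume x0: "x \<in> {x\<in>{c<..<d}. \<not> diff_times_at (Suc j) f x}" "g differentiable at x"
    then have x: "x \<in> {c<..<d}" and n: "\<not> diff_times_at (Suc j) f x" by auto
    from x0(2) obtain D where "(g has_real_derivative D) (at x)" by (auto simp: real_differentiable_def)
    then have "((deriv ^^ j) f has_real_derivative D) (at x)"
      by (rule has_field_derivative_transform_within_open[of _ _ _ "{c<..<d}"]) (use G(2) x in auto)
    then have "(deriv ^^ j) f differentiable at x" by (auto simp: real_differentiable_def)
    then have "diff_times_at (Suc j) f x"
      unfolding diff_times_at_def using G(1) x by (intro exI[of _ "{c<..<d}"]) auto
    then show False using n by blast
  qed simp
  then show ?thesis using abs_continuous_on_differentiable_ae[OF g(2)] by (rule negligible_subset[rotated])
qed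

lemma diff_times_at_regular:
  assumes \<mu>: "sigma_finite_vector k \<mu>" and x: "x \<in> Omega_reg p k \<mu> j" and f: "derivative_AC_loc p k \<mu> j f"
  shows "diff_times_at j f x"
proof -
  obtain c d where cd: "c < x" "x < d" "interval_in_Omega_reg p k \<mu> j c d"
    using Omega_reg_neighbourhood[OF \<mu> x] by blast
  obtain g where g: "has_nth_derivative_on j {c..d} f g"
    using f cd(3) unfolding derivative_AC_loc_def by blast
  show ?thesis unfolding diff_times_at_def
    using has_nth_derivative_on_deriv(1)[OF g] cd by (intro exI[of _ "{c<..<d}"]) auto
qed

lemma open_Omega: "open (Omega p \<mu> j)"
  unfolding Omega_def open_subopen[of "{x. _ x}"] by blast

text \<open>A point of \<open>\<Omega>\<^bsub>j+1\<^esub>\<close> lies in an interval with rational end points all of whose points are \<open>j\<close>-regular, and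
there are countably many such intervals.\<close>

lemma diff_times_ae_Omega:
  assumes \<mu>: "sigma_finite_vector k \<mu>" and j: "j < k" and f: "derivative_AC_loc p k \<mu> j f"
  shows "negligible {x\<in>Omega p \<mu> (Suc j). \<not> diff_times_at (Suc j) f x}"
proof -
  let ?Q = "{(c, d). c \<in> \<rat> \<and> d \<in> \<rat> \<and> interval_in_Omega_reg p k \<mu> j c d}"
  let ?B = "\<lambda>(c, d). {x\<in>{c<..<d}. \<not> diff_times_at (Suc j) f x}"
  have "negligible (\<Union>i\<in>?Q. ?B i)"
  proof (rule negligible_countable_Union)
    have "?Q \<subseteq> \<rat> \<times> \<rat>" by auto
    then show "countable (?B ` ?Q)"
      using countable_rat by (intro countable_image) (rule countable_subset[OF _ countable_SIGMA])
  qed (use diff_times_ae_on_interval[OF _ f] in auto)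
  moreover have "{x\<in>Omega p \<mu> (Suc j). \<not> diff_times_at (Suc j) f x} \<subseteq> (\<Union>i\<in>?Q. ?B i)"
  proof safe
    fix x assume x: "x \<in> Omega p \<mu> (Suc j)" "\<not> diff_times_at (Suc j) f x"
    obtain V where V: "open V" "x \<in> V" "ac_density (\<mu> (Suc j)) \<in> B_class p V"
      using x(1) by (auto simp: Omega_def)
    obtain e where e: "e > 0" "ball x e \<subseteq> V" using V openE by blast
    obtain c where c: "c \<in> \<rat>" "x - e < c" "c < x" using Rats_dense_in_real[of "x - e" x] e(1) by auto
    obtain d where d: "d \<in> \<rat>" "x < d" "d < x + e" using Rats_dense_in_real[of x "x + e"] e(1) by auto
    have "{c..d} \<subseteq> ball x e" using c d by (auto simp: dist_real_def)
    then have "interval_in_Omega_reg p k \<mu> j c d"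
      using c d e(2) j by (intro interval_in_Omega_reg_of_weight[OF \<mu> _ _ V(3)]) auto
    then show "x \<in> (\<Union>i\<in>?Q. ?B i)" using c d x by (intro UN_I[of "(c, d)"]) auto
  qed
  ultimately show ?thesis by (rule negligible_subset)
qed

lemma p_admissible_sigma_finite: "p_admissible p k \<mu> \<Longrightarrow> sigma_finite_vector k \<mu>"
  by (simp add: p_admissible_def sigma_finite_vector_def)

text \<open>For \<open>j \<ge> 1\<close> the exceptional set is contained in the null set \<open>N\<close> of \<open>\<mu>\<^sub>j\<^sup>*\<close> outside which all points are
\<open>j\<close>-regular. Its part outside \<open>\<Omega>\<^sub>j\<close> is null for \<open>\<mu>\<^sub>j\<close> since \<open>\<mu>\<^sub>j = \<mu>\<^sub>j\<^sup>*\<close> there, and its part in \<open>\<Omega>\<^sub>j\<close> is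
Lebesgue null and carries no singular mass. For \<open>j = k\<close> the set \<open>N\<close> is the whole line.\<close>

lemma diff_times_ae:
  assumes adm: "p_admissible p k \<mu>" and j: "j \<le> k" and f: "\<And>l. l < k \<Longrightarrow> derivative_AC_loc p k \<mu> l f"
  shows "AE x in \<mu> j. diff_times_at j f x"
proof (cases j)
  case 0
  then show ?thesis by (simp add: diff_times_at_0)
next
  case (Suc i)
  note \<mu> = p_admissible_sigma_finite[OF adm]
  have sj: "sets (\<mu> j) = sets borel" "sigma_finite_measure (\<mu> j)" using \<mu> j by (auto simp: sigma_finite_vector_def)
  note D = Lebesgue_decomposition_is[OF sj, unfolded is_Lebesgue_decomposition_def]
  obtain N where N [measurable]: "N \<in> sets borel" and N0: "mu_star p \<mu> j N = 0"
    and Nr: "\<And>x. x \<notin> N \<Longrightarrow> diff_times_at j f x"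
  proof (cases "j < k")
    case True
    have "\<forall>l. 1 \<le> l \<and> l < k \<longrightarrow>
        (\<exists>N\<in>sets borel. UNIV - Omega_reg p k \<mu> l \<subseteq> N \<and> mu_star p \<mu> l N = 0)"
      using adm unfolding p_admissible_def by blast
    moreover have "1 \<le> j" using Suc by simp
    ultimately obtain N where N: "N \<in> sets borel" "UNIV - Omega_reg p k \<mu> j \<subseteq> N" "mu_star p \<mu> j N = 0"
      using True by blast
    show ?thesis
    proof (rule that[OF N(1,3)])
      fix x assume "x \<notin> N"
      then have "x \<in> Omega_reg p k \<mu> j" using N(2) by blast
      then show "diff_times_at j f x" by (rule diff_times_at_regular[OF \<mu> _ f[OF True]])
    qed
  next
    case False
    then have jk: "j = k" using j by simp
    have all0: "\<forall>A\<in>sets borel. mu_star p \<mu> k A = 0" using adm unfolding p_admissible_def by blast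
    have "mu_star p \<mu> j UNIV = 0" unfolding jk by (rule bspec[OF all0]) simp
    from that[OF _ this] show ?thesis by simp
  qed
  have "{x\<in>Omega p \<mu> j. \<not> diff_times_at j f x} \<in> null_sets lebesgue"
    using diff_times_ae_Omega[OF \<mu> _ f, of i] Suc j by (simp add: negligible_iff_null_sets)
  then obtain L where L: "L \<in> null_sets lborel" "{x\<in>Omega p \<mu> j. \<not> diff_times_at j f x} \<subseteq> L"
    unfolding null_sets_completion_iff2 by (elim bexE)
  have [measurable]: "L \<in> sets borel" "Omega p \<mu> j \<in> sets borel" using L open_Omega by auto
  let ?w = "\<lambda>x. ennreal (ac_density (\<mu> j) x)"
  let ?Z = "(N - Omega p \<mu> j) \<union> (N \<inter> L)"
  have S0: "emeasure (singular_part (\<mu> j)) N = 0" and W0: "(\<integral>\<^sup>+x\<in>N - Omega p \<mu> j. ?w x \<partial>lborel) = 0"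
    using N0 by (auto simp: mu_star_def)
  have "emeasure (\<mu> j) (N - Omega p \<mu> j) = 0"
  proof -
    have "emeasure (singular_part (\<mu> j)) (N - Omega p \<mu> j) \<le> emeasure (singular_part (\<mu> j)) N"
      using D by (intro emeasure_mono) auto
    then show ?thesis using D S0 W0 by simp
  qed
  moreover have "emeasure (\<mu> j) (N \<inter> L) = 0"
  proof -
    have "emeasure (singular_part (\<mu> j)) (N \<inter> L) \<le> emeasure (singular_part (\<mu> j)) N"
      using D by (intro emeasure_mono) auto
    moreover have "(\<integral>\<^sup>+x\<in>N \<inter> L. ?w x \<partial>lborel) = nn_integral lborel (\<lambda>x::real. 0)"
      by (rule nn_integral_cong_AE) (use AE_not_in[OF L(1)] in eventually_elim, simp)
    ultimately show ?thesis using D S0 by simp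
  qed
  ultimately have "?Z \<in> null_sets (\<mu> j)" using sj by (intro null_sets.Un) auto
  moreover have "{x \<in> space (\<mu> j). \<not> diff_times_at j f x} \<subseteq> ?Z" using Nr L(2) by blast
  ultimately show ?thesis by (rule AE_I')
qed

lemma closed_supp: "closed (supp M)"
proof -
  have "- supp M = \<Union>{U. open U \<and> emeasure M U = 0}"
    by (auto simp: supp_def zero_less_iff_neq_zero)
  then have "open (- supp M)" by (simp only:) (rule open_Union, blast)
  then show ?thesis by (simp add: closed_def)
qed

lemma Delta_borel: "Delta k \<mu> \<in> sets borel"
  unfolding Delta_def by (intro borel_closed closed_UN) (auto simp: closed_supp)

lemma AE_on_Delta:
  assumes "sets (\<mu> j) = sets borel" "AE x in \<mu> j. P x"
  shows "AE x in on_Delta k \<mu> j. P x"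
proof -
  have "Delta k \<mu> \<inter> space (completion (\<mu> j)) \<in> sets (completion (\<mu> j))"
    using assms(1) Delta_borel[of k \<mu>] by auto
  then show ?thesis
    unfolding on_Delta_def AE_restrict_space_iff[OF \<open>_ \<in> _\<close>]
    using AE_completion[OF assms(2)] by eventually_elim simp
qed

lemma P_map_linear_ae:
  assumes adm: "p_admissible p k \<mu>" and j: "j \<le> k"
    and f: "\<And>l. l < k \<Longrightarrow> derivative_AC_loc p k \<mu> l f" and g: "\<And>l. l < k \<Longrightarrow> derivative_AC_loc p k \<mu> l g"
  shows "AE x in on_Delta k \<mu> j. P_map (\<lambda>x. a * f x + b * g x) j x = a * P_map f j x + b * P_map g j x"
proof (rule AE_on_Delta)
  show "sets (\<mu> j) = sets borel" using adm j by (simp add: p_admissible_def)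
  show "AE x in \<mu> j. P_map (\<lambda>x. a * f x + b * g x) j x = a * P_map f j x + b * P_map g j x"
  proof -
    have "AE x in \<mu> j. diff_times_at j f x" "AE x in \<mu> j. diff_times_at j g x"
      by (rule diff_times_ae[OF adm j], erule f, rule diff_times_ae[OF adm j], erule g)
    then show ?thesis by eventually_elim (simp add: P_map_def higher_deriv_linear)
  qed
qed

lemma abs_continuous_on_linear:
  assumes f: "abs_continuous_on I f" and g: "abs_continuous_on I g"
  shows "abs_continuous_on I (\<lambda>x. a * f x + b * g x)"
  unfolding abs_continuous_on_def
proof (intro allI impI)
  fix e :: real assume e: "e > 0"
  define e' where "e' = e / (\<bar>a\<bar> + \<bar>b\<bar> + 1)"
  have e': "e' > 0" using e by (simp add: e'_def)
  let ?fam = "\<lambda>d (n::nat) x y. (\<forall>i<n. x i \<le> y i \<and> {x i..y i} \<subseteq> I) \<and>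
        (\<forall>i<n. \<forall>l<n. i \<noteq> l \<longrightarrow> {x i<..<y i} \<inter> {x l<..<y l} = {}) \<and> (\<Sum>i<n. y i - x i) < d"
  obtain d1 where d1: "d1 > 0" "\<And>n x y. ?fam d1 n x y \<Longrightarrow> (\<Sum>i<n. \<bar>f (y i) - f (x i)\<bar>) < e'"
    using f[unfolded abs_continuous_on_def, rule_format, OF e'] by blast
  obtain d2 where d2: "d2 > 0" "\<And>n x y. ?fam d2 n x y \<Longrightarrow> (\<Sum>i<n. \<bar>g (y i) - g (x i)\<bar>) < e'"
    using g[unfolded abs_continuous_on_def, rule_format, OF e'] by blast
  have "(\<Sum>i<n. \<bar>a * f (y i) + b * g (y i) - (a * f (x i) + b * g (x i))\<bar>) < e"
    if F: "?fam (min d1 d2) n x y" for n x y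
  proof -
    have s: "(\<Sum>i<n. \<bar>f (y i) - f (x i)\<bar>) < e'" "(\<Sum>i<n. \<bar>g (y i) - g (x i)\<bar>) < e'"
      using F by (intro d1(2) d2(2) conjI; simp)+
    have "(\<Sum>i<n. \<bar>a * f (y i) + b * g (y i) - (a * f (x i) + b * g (x i))\<bar>)
        \<le> (\<Sum>i<n. \<bar>a\<bar> * \<bar>f (y i) - f (x i)\<bar> + \<bar>b\<bar> * \<bar>g (y i) - g (x i)\<bar>)"
    proof (rule sum_mono)
      fix i
      have "a * f (y i) + b * g (y i) - (a * f (x i) + b * g (x i)) = a * (f (y i) - f (x i)) + b * (g (y i) - g (x i))"
        by (simp add: algebra_simps)
      then show "\<bar>a * f (y i) + b * g (y i) - (a * f (x i) + b * g (x i))\<bar>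
          \<le> \<bar>a\<bar> * \<bar>f (y i) - f (x i)\<bar> + \<bar>b\<bar> * \<bar>g (y i) - g (x i)\<bar>"
        by (metis abs_mult abs_triangle_ineq)
    qed
    also have "\<dots> = \<bar>a\<bar> * (\<Sum>i<n. \<bar>f (y i) - f (x i)\<bar>) + \<bar>b\<bar> * (\<Sum>i<n. \<bar>g (y i) - g (x i)\<bar>)"
      by (simp add: sum.distrib sum_distrib_left)
    also have "\<dots> \<le> \<bar>a\<bar> * e' + \<bar>b\<bar> * e'" using s by (intro add_mono mult_left_mono) auto
    also have "\<dots> < (\<bar>a\<bar> + \<bar>b\<bar> + 1) * e'" using e' by (simp add: algebra_simps)
    also have "\<dots> = e" by (simp add: e'_def)
    finally show ?thesis .
  qed
  then show "\<exists>d>0. \<forall>(n::nat) x y. ?fam d n x y \<longrightarrow>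
      (\<Sum>i<n. \<bar>a * f (y i) + b * g (y i) - (a * f (x i) + b * g (x i))\<bar>) < e"
    using d1(1) d2(1) by (intro exI[of _ "min d1 d2"]) auto
qed

lemma derivative_AC_loc_linear:
  assumes f: "derivative_AC_loc p k \<mu> j f" and g: "derivative_AC_loc p k \<mu> j g"
  shows "derivative_AC_loc p k \<mu> j (\<lambda>x. a * f x + b * g x)"
  unfolding derivative_AC_loc_def
proof (intro allI impI)
  fix c d assume I: "interval_in_Omega_reg p k \<mu> j c d"
  obtain f' where f': "has_nth_derivative_on j {c..d} f f'" "abs_continuous_on {c..d} f'"
    using f I unfolding derivative_AC_loc_def by blast
  obtain g' where g': "has_nth_derivative_on j {c..d} g g'" "abs_continuous_on {c..d} g'"
    using g I unfolding derivative_AC_loc_def by blast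
  obtain hf where hf: "hf 0 = f" "hf j = f'"
    "\<And>i x. i < j \<Longrightarrow> x \<in> {c..d} \<Longrightarrow> (hf i has_real_derivative hf (Suc i) x) (at x within {c..d})"
    using f'(1) unfolding has_nth_derivative_on_def by blast
  obtain hg where hg: "hg 0 = g" "hg j = g'"
    "\<And>i x. i < j \<Longrightarrow> x \<in> {c..d} \<Longrightarrow> (hg i has_real_derivative hg (Suc i) x) (at x within {c..d})"
    using g'(1) unfolding has_nth_derivative_on_def by blast
  have "has_nth_derivative_on j {c..d} (\<lambda>x. a * f x + b * g x) (\<lambda>x. a * f' x + b * g' x)"
    unfolding has_nth_derivative_on_def
  proof (intro exI[of _ "\<lambda>i x. a * hf i x + b * hg i x"] conjI allI impI ballI)
    fix i x assume "i < j" "x \<in> {c..d}"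
    from DERIV_cmult[OF hf(3)[OF this], of a] DERIV_cmult[OF hg(3)[OF this], of b]
    show "((\<lambda>x. a * hf i x + b * hg i x) has_real_derivative a * hf (Suc i) x + b * hg (Suc i) x) (at x within {c..d})"
      by (rule DERIV_add)
  qed (simp_all add: hf(1,2) hg(1,2))
  then show "\<exists>h. has_nth_derivative_on j {c..d} (\<lambda>x. a * f x + b * g x) h \<and> abs_continuous_on {c..d} h"
    using abs_continuous_on_linear[OF f'(2) g'(2)] by blast
qed

section \<open>Linearity of the derivatives modulo null sets\<close>

lemma sigma_finite_completion:
  assumes "sigma_finite_measure M"
  shows "sigma_finite_measure (completion M)"
proof -
  interpret sigma_finite_measure M by fact
  obtain A where A: "countable A" "A \<subseteq> sets M" "\<Union>A = space M" "\<forall>a\<in>A. emeasure M a \<noteq> \<infinity>"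
    using sigma_finite_countable by blast
  show ?thesis
  proof (standard, intro exI conjI)
    show "countable A" "A \<subseteq> sets (completion M)" "\<Union>A = space (completion M)"
      "\<forall>a\<in>A. emeasure (completion M) a \<noteq> \<infinity>"
      using A by auto
  qed
qed

lemma Delta_in_completion:
  assumes "sets (\<mu> j) = sets borel"
  shows "Delta k \<mu> \<in> sets (completion (\<mu> j))"
  using assms Delta_borel[of k \<mu>] by auto

lemma sigma_finite_on_Delta:
  assumes "sets (\<mu> j) = sets borel" "sigma_finite_measure (\<mu> j)"
  shows "sigma_finite_measure (on_Delta k \<mu> j)"
  unfolding on_Delta_def
  by (rule sigma_finite_measure_restrict_space[OF sigma_finite_completion[OF assms(2)]
        Delta_in_completion[of \<mu> j k, OF assms(1)]])

lemma complete_on_Delta: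
  assumes "sets (\<mu> j) = sets borel"
  shows "complete_measure (on_Delta k \<mu> j)"
proof
  fix A B assume AB: "A \<subseteq> B" "B \<in> null_sets (on_Delta k \<mu> j)"
  note D = Delta_in_completion[of \<mu> j k, OF assms]
  have B: "B \<subseteq> Delta k \<mu>" "B \<in> null_sets (completion (\<mu> j))"
    using AB(2) by (simp_all add: on_Delta_def null_sets_restrict_space[OF D])
  have "A \<in> null_sets (completion (\<mu> j))" by (rule completion.complete2[OF AB(1) B(2)])
  then have "A \<in> null_sets (on_Delta k \<mu> j)"
    using AB(1) B(1) by (simp add: on_Delta_def null_sets_restrict_space[OF D])
  then show "A \<in> sets (on_Delta k \<mu> j)" by auto
qed

text \<open>Completeness enters here: derivatives are only determined almost everywhere, and linear combinations
of derivatives have to remain measurable.\<close>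

lemma complete_measurable_AE:
  fixes f g :: "'a \<Rightarrow> real"
  assumes "complete_measure M" "f \<in> borel_measurable M" "AE x in M. f x = g x"
  shows "g \<in> borel_measurable M"
proof (rule measurableI)
  interpret complete_measure M by fact
  fix A :: "real set" assume A: "A \<in> sets borel"
  show "g -` A \<inter> space M \<in> sets M"
  proof (rule in_sets_AE)
    show "f -` A \<inter> space M \<in> sets M" using measurable_sets[OF assms(2) A] .
    show "AE x in M. x \<in> f -` A \<inter> space M \<longleftrightarrow> x \<in> g -` A \<inter> space M"
      using assms(3) by eventually_elim auto
  qed auto
qed auto

lemma L_norm_nn_cong_AE:
  fixes f g :: "'a \<Rightarrow> real"
  assumes [measurable]: "f \<in> borel_measurable M" "g \<in> borel_measurable M" and ae: "AE x in M. f x = g x"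
  shows "L_norm_nn M r (\<lambda>x. ennreal \<bar>f x\<bar>) = L_norm_nn M r (\<lambda>x. ennreal \<bar>g x\<bar>)"
proof -
  have "esssup M (\<lambda>x. ennreal \<bar>f x\<bar>) = esssup M (\<lambda>x. ennreal \<bar>g x\<bar>)"
  proof (rule esssup_AE_cong)
    show "AE x in M. ennreal \<bar>f x\<bar> = ennreal \<bar>g x\<bar>" using ae by eventually_elim simp
  qed measurable
  moreover have "(\<integral>\<^sup>+x. ennreal_powr (ennreal \<bar>f x\<bar>) s \<partial>M) = (\<integral>\<^sup>+x. ennreal_powr (ennreal \<bar>g x\<bar>) s \<partial>M)" for s
    by (rule nn_integral_cong_AE) (use ae in eventually_elim, simp)
  ultimately show ?thesis by (simp add: L_norm_nn_def)
qed

lemma L_fun_cong_AE: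
  assumes "f \<in> L_fun M r" "g \<in> borel_measurable M" "AE x in M. f x = g x"
  shows "g \<in> L_fun M r"
  using assms L_norm_nn_cong_AE[OF _ assms(2,3), of r] by (simp add: L_fun_def)

lemma L_norm_cong_AE:
  assumes "f \<in> L_fun M r" "g \<in> L_fun M r" "AE x in M. f x = g x"
  shows "L_norm M r f = L_norm M r g"
  using L_norm_nn_cong_AE[OF L_fun_measurable[OF assms(1)] L_fun_measurable[OF assms(2)] assms(3), of r]
  by (simp add: L_norm_def)

text \<open>The classes in \<open>L_space\<close>, in a form without the quotient.\<close>

definition L_class :: "'a measure \<Rightarrow> ennreal \<Rightarrow> ('a \<Rightarrow> real) \<Rightarrow> ('a \<Rightarrow> real) set" where
  "L_class M r f = {g \<in> L_fun M r. AE x in M. f x = g x}"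

lemma L_space_eq: "L_space M r = L_class M r ` L_fun M r"
  unfolding L_space_def quotient_def L_class_def by (auto simp: Image_def)

lemma L_class_eq:
  assumes "AE x in M. f x = g x"
  shows "L_class M r f = L_class M r g"
  unfolding L_class_def
proof (intro Collect_cong conj_cong refl iffI)
  fix h
  show "AE x in M. g x = h x" if "AE x in M. f x = h x" using that assms by eventually_elim simp
  show "AE x in M. f x = h x" if "AE x in M. g x = h x" using that assms by eventually_elim simp
qed

lemma rep_L_class:
  assumes "f \<in> L_fun M r"
  shows "rep (L_class M r f) \<in> L_fun M r" "AE x in M. f x = rep (L_class M r f) x"
proof -
  have "f \<in> L_class M r f" using assms by (simp add: L_class_def)
  then have "rep (L_class M r f) \<in> L_class M r f"
    unfolding rep_def by (rule someI[of "\<lambda>g. g \<in> L_class M r f"])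
  then show "rep (L_class M r f) \<in> L_fun M r" "AE x in M. f x = rep (L_class M r f) x"
    by (auto simp: L_class_def)
qed

lemma L_space_rep:
  assumes "X \<in> L_space M r"
  shows "rep X \<in> L_fun M r" "X = L_class M r (rep X)"
proof -
  obtain f where f: "f \<in> L_fun M r" "X = L_class M r f" using assms by (auto simp: L_space_eq)
  show "rep X \<in> L_fun M r" using rep_L_class(1)[OF f(1)] f(2) by simp
  show "X = L_class M r (rep X)" using L_class_eq[OF rep_L_class(2)[OF f(1)], of r] unfolding f(2)[symmetric] .
qed

text \<open>The map \<open>P\<close> with values in functions of pairs \<open>(j, x)\<close>.\<close>

definition derivative_family :: "(real \<Rightarrow> real) \<Rightarrow> nat \<times> real \<Rightarrow> real" where
  "derivative_family f = (\<lambda>(j, x). P_map f j x)"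

lemma derivative_family_in:
  assumes "f \<in> sobolev_fun p k \<mu>"
  shows "derivative_family f \<in> fam_space p {..k} (on_Delta k \<mu>)"
  using assms by (auto simp: derivative_family_def fam_space_def sobolev_fun_def)

lemma prod_norm_eq:
  assumes p: "p \<ge> 1" and g: "\<And>j. j \<le> k \<Longrightarrow> g j \<in> L_fun (on_Delta k \<mu> j) (ennreal p)"
  shows "prod_norm (ennreal p) k \<mu> g = fam_power p {..k} (on_Delta k \<mu>) (\<lambda>(j, x). g j x) powr (1 / p)"
proof -
  have "L_norm (on_Delta k \<mu> j) (ennreal p) (g j) powr p = (\<integral>x. \<bar>g j x\<bar> powr p \<partial>(on_Delta k \<mu> j))"
    if "j \<le> k" for j
    using p g[OF that] by (simp add: L_norm_real powr_powr integral_nonneg_AE)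
  then show ?thesis using p by (simp add: prod_norm_def fam_power_def)
qed

lemma sobolev_norm_eq:
  assumes p: "p \<ge> 1" and f: "f \<in> sobolev_fun p k \<mu>"
  shows "sobolev_norm p k \<mu> f = fam_power p {..k} (on_Delta k \<mu>) (derivative_family f) powr (1 / p)"
  unfolding sobolev_norm_def derivative_family_def
  using f by (intro prod_norm_eq p) (auto simp: sobolev_fun_def)

lemma P_map_zero: "P_map (\<lambda>_. 0) j = (\<lambda>_. 0)"
proof -
  have "deriv (\<lambda>_::real. 0::real) = (\<lambda>_. 0)" by (rule ext) (simp add: DERIV_imp_deriv)
  then show ?thesis unfolding P_map_def by (induction j) auto
qed

lemma sobolev_fun_zero:
  assumes "p \<ge> 1"
  shows "(\<lambda>_. 0) \<in> sobolev_fun p k \<mu>"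
proof -
  have "derivative_AC_loc p k \<mu> j (\<lambda>_. 0)" for j
    unfolding derivative_AC_loc_def
  proof (intro allI impI exI conjI)
    show "has_nth_derivative_on j {a..b} (\<lambda>_. 0) (\<lambda>_. 0)" for a b
      unfolding has_nth_derivative_on_def by (intro exI[of _ "\<lambda>_ _. 0"]) auto
    show "abs_continuous_on {a..b} (\<lambda>_. 0)" for a b
      unfolding abs_continuous_on_def by (auto intro: exI[of _ 1])
  qed
  then show ?thesis
    using assms by (simp add: sobolev_fun_def P_map_zero fun_spaceD(1)[OF fun_space_L_fun])
qed

lemma sobolev_P_map_linear:
  assumes adm: "p_admissible p k \<mu>" and j: "j \<le> k"
    and fg: "f \<in> sobolev_fun p k \<mu>" "g \<in> sobolev_fun p k \<mu>"
  shows "AE x in on_Delta k \<mu> j. P_map (\<lambda>x. a * f x + b * g x) j x = a * P_map f j x + b * P_map g j x"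
proof (rule P_map_linear_ae[OF adm j])
  show "derivative_AC_loc p k \<mu> l f" "derivative_AC_loc p k \<mu> l g" if "l < k" for l
    using fg that by (simp_all add: sobolev_fun_def)
qed

lemma sobolev_fun_linear:
  assumes p: "p \<ge> 1" and adm: "p_admissible p k \<mu>"
    and fg: "f \<in> sobolev_fun p k \<mu>" "g \<in> sobolev_fun p k \<mu>"
  shows "(\<lambda>x. a * f x + b * g x) \<in> sobolev_fun p k \<mu>"
proof -
  have "P_map (\<lambda>x. a * f x + b * g x) j \<in> L_fun (on_Delta k \<mu> j) (ennreal p)" if j: "j \<le> k" for j
  proof -
    have c: "complete_measure (on_Delta k \<mu> j)"
      by (rule complete_on_Delta) (use adm j in \<open>simp add: p_admissible_def\<close>)
    have comb: "(\<lambda>x. a * P_map f j x + b * P_map g j x) \<in> L_fun (on_Delta k \<mu> j) (ennreal p)"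
      using fg j p by (intro fun_spaceD(2)[OF fun_space_L_fun]) (auto simp: sobolev_fun_def)
    have ae: "AE x in on_Delta k \<mu> j. a * P_map f j x + b * P_map g j x = P_map (\<lambda>x. a * f x + b * g x) j x"
      using sobolev_P_map_linear[OF adm j fg, of a b] by eventually_elim simp
    show ?thesis
      by (rule L_fun_cong_AE[OF comb complete_measurable_AE[OF c L_fun_measurable[OF comb] ae] ae])
  qed
  then show ?thesis using fg derivative_AC_loc_linear by (auto simp: sobolev_fun_def)
qed

lemma fam_power_eq_0_iff:
  assumes "finite I" "p > 0" and u: "u \<in> fam_space p I M"
  shows "fam_power p I M u = 0 \<longleftrightarrow> (\<forall>i\<in>I. AE x in M i. u (i, x) = 0)"
proof -
  have "fam_power p I M u = 0 \<longleftrightarrow> (\<forall>i\<in>I. (\<integral>x. \<bar>u (i, x)\<bar> powr p \<partial>(M i)) = 0)"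
    unfolding fam_power_def using assms(1) by (intro sum_nonneg_eq_0_iff) (auto intro: integral_nonneg_AE)
  also have "\<dots> \<longleftrightarrow> (\<forall>i\<in>I. AE x in M i. u (i, x) = 0)"
  proof (rule ball_cong[OF refl])
    fix i assume "i \<in> I"
    then have "integrable (M i) (\<lambda>x. \<bar>u (i, x)\<bar> powr p)"
      using fam_spaceD[OF u] assms(2) by (simp add: L_fun_real_iff)
    from integral_nonneg_eq_0_iff_AE[OF this]
    show "(\<integral>x. \<bar>u (i, x)\<bar> powr p \<partial>(M i)) = 0 \<longleftrightarrow> (AE x in M i. u (i, x) = 0)" by simp
  qed
  finally show ?thesis .
qed

lemma fam_power_cong_AE:
  assumes "\<And>i. i \<in> I \<Longrightarrow> (\<lambda>x. u (i, x)) \<in> borel_measurable (M i)"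
    "\<And>i. i \<in> I \<Longrightarrow> (\<lambda>x. v (i, x)) \<in> borel_measurable (M i)"
    "\<And>i. i \<in> I \<Longrightarrow> AE x in M i. u (i, x) = v (i, x)"
  shows "fam_power p I M u = fam_power p I M v"
  unfolding fam_power_def
proof (rule sum.cong[OF refl])
  fix i assume i: "i \<in> I"
  note [measurable] = assms(1,2)[OF i]
  show "(\<integral>x. \<bar>u (i, x)\<bar> powr p \<partial>(M i)) = (\<integral>x. \<bar>v (i, x)\<bar> powr p \<partial>(M i))"
  proof (rule integral_cong_AE)
    show "AE x in M i. \<bar>u (i, x)\<bar> powr p = \<bar>v (i, x)\<bar> powr p" using assms(3)[OF i] by eventually_elim simp
  qed measurable
qed

lemma sobolev_norm_diff_eq_0_iff:
  assumes p: "p \<ge> 1" and adm: "p_admissible p k \<mu>"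
    and fg: "f \<in> sobolev_fun p k \<mu>" "g \<in> sobolev_fun p k \<mu>"
  shows "sobolev_norm p k \<mu> (\<lambda>x. f x - g x) = 0 \<longleftrightarrow>
    (\<forall>j\<le>k. AE x in on_Delta k \<mu> j. P_map f j x = P_map g j x)"
proof -
  have d: "(\<lambda>x. f x - g x) \<in> sobolev_fun p k \<mu>"
    using sobolev_fun_linear[OF p adm fg, of 1 "-1"] by simp
  have "sobolev_norm p k \<mu> (\<lambda>x. f x - g x) = 0 \<longleftrightarrow>
      (\<forall>j\<in>{..k}. AE x in on_Delta k \<mu> j. derivative_family (\<lambda>x. f x - g x) (j, x) = 0)"
    using fam_power_eq_0_iff[OF finite_atMost _ derivative_family_in[OF d]] p
    by (simp add: sobolev_norm_eq[OF p d])
  also have "\<dots> \<longleftrightarrow> (\<forall>j\<le>k. AE x in on_Delta k \<mu> j. P_map f j x = P_map g j x)"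
  proof (simp only: Ball_def atMost_iff, intro all_cong1 imp_cong refl)
    fix j assume j: "j \<le> k"
    have "AE x in on_Delta k \<mu> j. derivative_family (\<lambda>x. f x - g x) (j, x) = P_map f j x - P_map g j x"
      using sobolev_P_map_linear[OF adm j fg, of 1 "-1"] by (simp add: derivative_family_def)
    then have "AE x in on_Delta k \<mu> j. (derivative_family (\<lambda>x. f x - g x) (j, x) = 0) = (P_map f j x = P_map g j x)"
      by eventually_elim simp
    then show "(AE x in on_Delta k \<mu> j. derivative_family (\<lambda>x. f x - g x) (j, x) = 0)
        = (AE x in on_Delta k \<mu> j. P_map f j x = P_map g j x)"
      by (rule eventually_subst)
  qed
  finally show ?thesis .
qed

text \<open>A class depends only on the derivatives up to null sets, so a functional on classes is a functional on
the image of \<open>P\<close>.\<close>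

lemma sobolev_class_eqI:
  assumes p: "p \<ge> 1" and adm: "p_admissible p k \<mu>"
    and fg: "f \<in> sobolev_fun p k \<mu>" "g \<in> sobolev_fun p k \<mu>"
    and ae: "\<And>j. j \<le> k \<Longrightarrow> AE x in on_Delta k \<mu> j. P_map f j x = P_map g j x"
  shows "sobolev_class p k \<mu> f = sobolev_class p k \<mu> g"
proof -
  have "(f, h) \<in> sobolev_rel p k \<mu> \<longleftrightarrow> (g, h) \<in> sobolev_rel p k \<mu>" for h
  proof (cases "h \<in> sobolev_fun p k \<mu>")
    case True
    have "(AE x in on_Delta k \<mu> j. P_map f j x = P_map h j x) \<longleftrightarrow> (AE x in on_Delta k \<mu> j. P_map g j x = P_map h j x)"
      if "j \<le> k" for j
    proof
      show "AE x in on_Delta k \<mu> j. P_map g j x = P_map h j x" if "AE x in on_Delta k \<mu> j. P_map f j x = P_map h j x"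
        using that ae[OF \<open>j \<le> k\<close>] by eventually_elim simp
      show "AE x in on_Delta k \<mu> j. P_map f j x = P_map h j x" if "AE x in on_Delta k \<mu> j. P_map g j x = P_map h j x"
        using that ae[OF \<open>j \<le> k\<close>] by eventually_elim simp
    qed
    then show ?thesis
      using True fg sobolev_norm_diff_eq_0_iff[OF p adm _ True] by (simp add: sobolev_rel_def)
  qed (simp add: sobolev_rel_def)
  then show ?thesis by (auto simp: sobolev_class_def)
qed

lemma rep_sobolev_class:
  assumes p: "p \<ge> 1" and adm: "p_admissible p k \<mu>" and f: "f \<in> sobolev_fun p k \<mu>"
  shows "rep (sobolev_class p k \<mu> f) \<in> sobolev_fun p k \<mu>"
    and "j \<le> k \<Longrightarrow> AE x in on_Delta k \<mu> j. P_map f j x = P_map (rep (sobolev_class p k \<mu> f)) j x"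
    and "sobolev_norm p k \<mu> (rep (sobolev_class p k \<mu> f)) = sobolev_norm p k \<mu> f"
proof -
  let ?r = "rep (sobolev_class p k \<mu> f)"
  have "f \<in> sobolev_class p k \<mu> f"
    using f sobolev_norm_diff_eq_0_iff[OF p adm f f] by (simp add: sobolev_class_def sobolev_rel_def)
  then have "?r \<in> sobolev_class p k \<mu> f"
    unfolding rep_def by (rule someI[of "\<lambda>g. g \<in> sobolev_class p k \<mu> f"])
  then have r: "?r \<in> sobolev_fun p k \<mu>" "sobolev_norm p k \<mu> (\<lambda>x. f x - ?r x) = 0"
    by (auto simp: sobolev_class_def sobolev_rel_def)
  show "?r \<in> sobolev_fun p k \<mu>" by (rule r(1))
  have ae: "AE x in on_Delta k \<mu> j. P_map f j x = P_map ?r j x" if "j \<le> k" for j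
    using sobolev_norm_diff_eq_0_iff[OF p adm f r(1)] r(2) that by blast
  then show "j \<le> k \<Longrightarrow> AE x in on_Delta k \<mu> j. P_map f j x = P_map ?r j x" .
  have "fam_power p {..k} (on_Delta k \<mu>) (derivative_family ?r) = fam_power p {..k} (on_Delta k \<mu>) (derivative_family f)"
  proof (rule fam_power_cong_AE)
    fix i assume "i \<in> {..k}"
    then show "(\<lambda>x. derivative_family ?r (i, x)) \<in> borel_measurable (on_Delta k \<mu> i)"
      "(\<lambda>x. derivative_family f (i, x)) \<in> borel_measurable (on_Delta k \<mu> i)"
      using derivative_family_in[OF r(1)] derivative_family_in[OF f] by (auto dest: fam_spaceD L_fun_measurable)
    show "AE x in on_Delta k \<mu> i. derivative_family ?r (i, x) = derivative_family f (i, x)"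
      using ae[of i] \<open>i \<in> {..k}\<close> by (auto simp: derivative_family_def elim: eventually_mono)
  qed
  then show "sobolev_norm p k \<mu> ?r = sobolev_norm p k \<mu> f"
    by (simp add: sobolev_norm_eq[OF p] r(1) f)
qed

lemma sobolev_space_eq: "sobolev_space p k \<mu> = sobolev_class p k \<mu> ` sobolev_fun p k \<mu>"
  unfolding sobolev_space_def quotient_def sobolev_class_def by auto

lemma sobolev_space_rep:
  assumes p: "p \<ge> 1" and adm: "p_admissible p k \<mu>" and F: "F \<in> sobolev_space p k \<mu>"
  shows "rep F \<in> sobolev_fun p k \<mu>" "F = sobolev_class p k \<mu> (rep F)"
proof -
  obtain f where f: "f \<in> sobolev_fun p k \<mu>" "F = sobolev_class p k \<mu> f"
    using F by (auto simp: sobolev_space_eq)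
  show r: "rep F \<in> sobolev_fun p k \<mu>" using rep_sobolev_class(1)[OF p adm f(1)] f(2) by simp
  show "F = sobolev_class p k \<mu> (rep F)"
    using sobolev_class_eqI[OF p adm f(1) r] rep_sobolev_class(2)[OF p adm f(1)] f(2) by simp
qed

section \<open>Extension and representation of Sobolev functionals\<close>

lemma L_fun_inf:
  assumes [measurable]: "f \<in> borel_measurable M" and "AE x in M. \<bar>f x\<bar> \<le> C" "C \<ge> 0"
  shows "f \<in> L_fun M \<infinity>" "L_norm M \<infinity> f \<le> C"
proof -
  have "esssup M (\<lambda>x. ennreal \<bar>f x\<bar>) \<le> ennreal C"
  proof (rule esssup_I)
    show "AE x in M. ennreal \<bar>f x\<bar> \<le> ennreal C"
      using assms(2) by eventually_elim (rule ennreal_leI)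
  qed measurable
  then show "f \<in> L_fun M \<infinity>" "L_norm M \<infinity> f \<le> C"
    using assms(3) by (auto simp: L_fun_def L_norm_def L_norm_nn_def le_less_trans enn2real_leI)
qed

lemma AE_le_L_norm_inf:
  assumes "f \<in> L_fun M \<infinity>"
  shows "AE x in M. \<bar>f x\<bar> \<le> L_norm M \<infinity> f"
proof -
  have fin: "esssup M (\<lambda>x. ennreal \<bar>f x\<bar>) < \<infinity>" using assms by (simp add: L_fun_def L_norm_nn_def)
  have "AE x in M. ennreal \<bar>f x\<bar> \<le> esssup M (\<lambda>x. ennreal \<bar>f x\<bar>)" by (rule esssup_AE)
  then show ?thesis
  proof eventually_elim
    case (elim x)
    then have "enn2real (ennreal \<bar>f x\<bar>) \<le> enn2real (esssup M (\<lambda>x. ennreal \<bar>f x\<bar>))"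
      using fin by (intro enn2real_mono) auto
    then show ?case by (simp add: L_norm_def L_norm_nn_def)
  qed
qed

text \<open>The solutions of \<open>1 / p + 1 / q = 1\<close> with \<open>1 \<le> p < \<infinity>\<close>, split into the two cases that need different
norms.\<close>

definition conjugate_exponents :: "real \<Rightarrow> ennreal \<Rightarrow> bool" where
  "conjugate_exponents p q \<longleftrightarrow> p = 1 \<and> q = \<infinity> \<or> p > 1 \<and> q = ennreal (p / (p - 1))"

lemma conjugate_exponents_ge_1: "conjugate_exponents p q \<Longrightarrow> p \<ge> 1"
  by (auto simp: conjugate_exponents_def)

lemma conjugate_exponents_of_sum:
  assumes p: "1 \<le> p" and pq: "1 / ennreal p + 1 / q = 1"
  shows "conjugate_exponents p q"
proof (cases q)
  case top
  then have "ennreal (1 / p) = ennreal 1" using p pq by (simp add: divide_ennreal[symmetric])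
  then show ?thesis using p top by (simp add: conjugate_exponents_def ennreal_inj del: ennreal_1)
next
  case (real r)
  have r0: "r > 0"
  proof (rule ccontr)
    assume "\<not> r > 0"
    then have "1 / q = \<infinity>" using real by (simp add: divide_ennreal_def)
    then show False using pq by simp
  qed
  have "1 / ennreal p = ennreal (1 / p)" "1 / q = ennreal (1 / r)"
    using p r0 real by (simp_all add: divide_ennreal[symmetric])
  then have "ennreal (1 / p + 1 / r) = ennreal 1" using pq p r0 by (simp add: ennreal_plus)
  then have eq: "1 / p + 1 / r = 1" using p r0 by (subst (asm) ennreal_inj) auto
  have "p \<noteq> 1" using eq r0 by auto
  then have p1: "p > 1" using p by simp
  have "1 / r = (p - 1) / p" using eq p1 by (simp add: field_simps)
  then have "1 / (1 / r) = 1 / ((p - 1) / p)" by simp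
  then have "r = p / (p - 1)" by simp
  then show ?thesis using p1 real by (simp add: conjugate_exponents_def)
qed

lemma sobolev_norm_nonneg: "p \<ge> 1 \<Longrightarrow> f \<in> sobolev_fun p k \<mu> \<Longrightarrow> 0 \<le> sobolev_norm p k \<mu> f"
  by (simp add: sobolev_norm_eq)

lemma sobolev_norm_scale:
  assumes p: "p \<ge> 1" and adm: "p_admissible p k \<mu>" and f: "f \<in> sobolev_fun p k \<mu>" and c: "c \<ge> 0"
  shows "(\<lambda>x. c * f x) \<in> sobolev_fun p k \<mu>" "sobolev_norm p k \<mu> (\<lambda>x. c * f x) = c * sobolev_norm p k \<mu> f"
proof -
  let ?N = "fam_power p {..k} (on_Delta k \<mu>)"
  show cf: "(\<lambda>x. c * f x) \<in> sobolev_fun p k \<mu>" using sobolev_fun_linear[OF p adm f f, of c 0] by simp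
  have "?N (derivative_family (\<lambda>x. c * f x)) = ?N (\<lambda>y. c * derivative_family f y)"
  proof (rule fam_power_cong_AE)
    fix i assume i: "i \<in> {..k}"
    have m: "(\<lambda>x. derivative_family f (i, x)) \<in> borel_measurable (on_Delta k \<mu> i)"
      by (rule L_fun_measurable[OF fam_spaceD[OF derivative_family_in[OF f] i]])
    then show "(\<lambda>x. c * derivative_family f (i, x)) \<in> borel_measurable (on_Delta k \<mu> i)" by simp
    show "(\<lambda>x. derivative_family (\<lambda>x. c * f x) (i, x)) \<in> borel_measurable (on_Delta k \<mu> i)"
      by (rule L_fun_measurable[OF fam_spaceD[OF derivative_family_in[OF cf] i]])
    show "AE x in on_Delta k \<mu> i. derivative_family (\<lambda>x. c * f x) (i, x) = c * derivative_family f (i, x)"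
      using sobolev_P_map_linear[OF adm _ f f, of i c 0] i by (simp add: derivative_family_def)
  qed
  also have "\<dots> = c powr p * ?N (derivative_family f)" by (rule fam_power_scale[OF c])
  finally show "sobolev_norm p k \<mu> (\<lambda>x. c * f x) = c * sobolev_norm p k \<mu> f"
    using p c by (simp add: sobolev_norm_eq[OF p] cf f powr_mult powr_powr fam_power_nonneg)
qed

lemma sobolev_dual_linear:
  assumes p: "p \<ge> 1" and adm: "p_admissible p k \<mu>" and T: "T \<in> sobolev_dual p k \<mu>"
    and fg: "f \<in> sobolev_fun p k \<mu>" "g \<in> sobolev_fun p k \<mu>"
  shows "T (sobolev_class p k \<mu> (\<lambda>x. a * f x + b * g x)) = a * T (sobolev_class p k \<mu> f) + b * T (sobolev_class p k \<mu> g)"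
proof -
  have cf: "(\<lambda>x. a * f x) \<in> sobolev_fun p k \<mu>" "(\<lambda>x. b * g x) \<in> sobolev_fun p k \<mu>"
    using sobolev_fun_linear[OF p adm fg(1) fg(1), of a 0] sobolev_fun_linear[OF p adm fg(2) fg(2), of b 0] by simp_all
  have "T (sobolev_class p k \<mu> (\<lambda>x. a * f x + b * g x))
      = T (sobolev_class p k \<mu> (\<lambda>x. a * f x)) + T (sobolev_class p k \<mu> (\<lambda>x. b * g x))"
    using T cf by (simp add: sobolev_dual_def)
  then show ?thesis using T fg by (simp add: sobolev_dual_def)
qed

text \<open>The supremum is finite by boundedness of \<open>T\<close>, and the estimate follows by scaling. For functions of
seminorm \<open>0\<close>, which cannot be scaled to norm \<open>1\<close>, boundedness gives \<open>T = 0\<close>.\<close>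

lemma dual_norm_bound:
  assumes p: "p \<ge> 1" and adm: "p_admissible p k \<mu>" and T: "T \<in> sobolev_dual p k \<mu>"
  shows "0 \<le> dual_norm p k \<mu> T"
    and "f \<in> sobolev_fun p k \<mu> \<Longrightarrow> \<bar>T (sobolev_class p k \<mu> f)\<bar> \<le> dual_norm p k \<mu> T * sobolev_norm p k \<mu> f"
proof -
  let ?U = "{F \<in> sobolev_space p k \<mu>. sobolev_norm p k \<mu> (rep F) \<le> 1}"
  obtain C where C: "\<And>F. F \<in> sobolev_space p k \<mu> \<Longrightarrow> \<bar>T F\<bar> \<le> C * sobolev_norm p k \<mu> (rep F)"
    using T unfolding sobolev_dual_def by blast
  have bdd: "bdd_above ((\<lambda>F. \<bar>T F\<bar>) ` ?U)"
  proof (rule bdd_aboveI2)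
    fix F assume F: "F \<in> ?U"
    then have n: "0 \<le> sobolev_norm p k \<mu> (rep F)" "sobolev_norm p k \<mu> (rep F) \<le> 1"
      using sobolev_norm_nonneg[OF p] sobolev_space_rep(1)[OF p adm] by auto
    have "\<bar>T F\<bar> \<le> C * sobolev_norm p k \<mu> (rep F)" using C F by simp
    also have "\<dots> \<le> \<bar>C\<bar> * 1" using n by (intro mult_mono) auto
    finally show "\<bar>T F\<bar> \<le> \<bar>C\<bar>" by simp
  qed
  have le: "\<bar>T (sobolev_class p k \<mu> f)\<bar> \<le> dual_norm p k \<mu> T"
    if f: "f \<in> sobolev_fun p k \<mu>" "sobolev_norm p k \<mu> f \<le> 1" for f
    unfolding dual_norm_def
    using f rep_sobolev_class(3)[OF p adm f(1)]
    by (intro cSUP_upper[OF _ bdd]) (auto simp: sobolev_space_eq)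
  have z: "(\<lambda>_. 0) \<in> sobolev_fun p k \<mu>" by (rule sobolev_fun_zero[OF p])
  have "sobolev_norm p k \<mu> (\<lambda>_. 0) = 0" using sobolev_norm_scale(2)[OF p adm z, of 0] by simp
  then show "0 \<le> dual_norm p k \<mu> T" using le[OF z] by simp
  assume f: "f \<in> sobolev_fun p k \<mu>"
  let ?n = "sobolev_norm p k \<mu> f"
  show "\<bar>T (sobolev_class p k \<mu> f)\<bar> \<le> dual_norm p k \<mu> T * ?n"
  proof (cases "?n = 0")
    case True
    have "sobolev_class p k \<mu> f \<in> sobolev_space p k \<mu>" using f by (simp add: sobolev_space_eq)
    from C[OF this] show ?thesis using rep_sobolev_class(3)[OF p adm f] True by simp
  next
    case False
    then have n: "?n > 0" using sobolev_norm_nonneg[OF p f] by simp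
    then have n': "0 \<le> 1 / ?n" by simp
    have "T (sobolev_class p k \<mu> (\<lambda>x. (1 / ?n) * f x)) = (1 / ?n) * T (sobolev_class p k \<mu> f)"
      using sobolev_dual_linear[OF p adm T f f, of "1 / ?n" 0] by simp
    moreover have "\<bar>T (sobolev_class p k \<mu> (\<lambda>x. (1 / ?n) * f x))\<bar> \<le> dual_norm p k \<mu> T"
      by (rule le[OF sobolev_norm_scale(1)[OF p adm f n']])
        (use n in \<open>simp only: sobolev_norm_scale(2)[OF p adm f n'], simp\<close>)
    ultimately have "\<bar>T (sobolev_class p k \<mu> f)\<bar> / ?n \<le> dual_norm p k \<mu> T" using n by (simp add: abs_mult)
    then show ?thesis using n by (simp add: pos_divide_le_eq)
  qed
qed

text \<open>The functional is transported to the families that agree almost everywhere with some \<open>P f\<close>. The image of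
\<open>P\<close> itself need not be a subspace, because \<open>P\<close> is linear only up to null sets.\<close>

lemma sobolev_dual_representation:
  assumes p: "p \<ge> 1" and adm: "p_admissible p k \<mu>" and T: "T \<in> sobolev_dual p k \<mu>"
  obtains v where "\<And>j. j \<in> {..k} \<Longrightarrow> (\<lambda>x. v (j, x)) \<in> borel_measurable (on_Delta k \<mu> j)"
    "\<And>j f. j \<in> {..k} \<Longrightarrow> f \<in> L_fun (on_Delta k \<mu> j) (ennreal p) \<Longrightarrow> integrable (on_Delta k \<mu> j) (\<lambda>x. f x * v (j, x))"
    "\<And>f. f \<in> sobolev_fun p k \<mu> \<Longrightarrow>
      T (sobolev_class p k \<mu> f) = (\<Sum>j\<in>{..k}. \<integral>x. P_map f j x * v (j, x) \<partial>(on_Delta k \<mu> j))"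
    "\<And>u. u \<in> fam_space p {..k} (on_Delta k \<mu>) \<Longrightarrow> fam_pairing {..k} (on_Delta k \<mu>) u v
      \<le> dual_norm p k \<mu> T * fam_power p {..k} (on_Delta k \<mu>) u powr (1 / p)"
proof -
  let ?M = "on_Delta k \<mu>" and ?V = "fam_space p {..k} (on_Delta k \<mu>)"
  have p0: "p > 0" using p by simp
  note Vsp = fun_space_fam_space[OF p0, of "{..k}" ?M]
  define jet_of where "jet_of u f \<longleftrightarrow> f \<in> sobolev_fun p k \<mu> \<and> (\<forall>j\<in>{..k}. AE x in ?M j. u (j, x) = P_map f j x)" for u f
  define W where "W = {u \<in> ?V. \<exists>f. jet_of u f}"
  define T' where "T' u = T (sobolev_class p k \<mu> (SOME f. jet_of u f))" for u
  have T': "T' u = T (sobolev_class p k \<mu> f)" if f: "jet_of u f" for u f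
  proof -
    have g: "jet_of u (SOME f. jet_of u f)" using f by (rule someI[of "jet_of u"])
    have "AE x in ?M j. P_map (SOME f. jet_of u f) j x = P_map f j x" if "j \<le> k" for j
    proof -
      have "AE x in ?M j. u (j, x) = P_map f j x" "AE x in ?M j. u (j, x) = P_map (SOME f. jet_of u f) j x"
        using f g that by (auto simp: jet_of_def)
      then show ?thesis by eventually_elim simp
    qed
    then have "sobolev_class p k \<mu> (SOME f. jet_of u f) = sobolev_class p k \<mu> f"
      using f g by (intro sobolev_class_eqI[OF p adm]) (auto simp: jet_of_def)
    then show ?thesis by (simp add: T'_def)
  qed
  have lin: "jet_of (\<lambda>y. a * u y + b * w y) (\<lambda>x. a * f x + b * g x)" if uw: "jet_of u f" "jet_of w g" for u w f g a b
    unfolding jet_of_def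
  proof (intro conjI ballI)
    have fg: "f \<in> sobolev_fun p k \<mu>" "g \<in> sobolev_fun p k \<mu>" using uw by (auto simp: jet_of_def)
    show "(\<lambda>x. a * f x + b * g x) \<in> sobolev_fun p k \<mu>" by (rule sobolev_fun_linear[OF p adm fg])
    fix j assume j: "j \<in> {..k}"
    have "AE x in ?M j. u (j, x) = P_map f j x" "AE x in ?M j. w (j, x) = P_map g j x"
      using uw j by (auto simp: jet_of_def)
    moreover have "AE x in ?M j. P_map (\<lambda>x. a * f x + b * g x) j x = a * P_map f j x + b * P_map g j x"
      using sobolev_P_map_linear[OF adm _ fg] j by simp
    ultimately show "AE x in ?M j. a * u (j, x) + b * w (j, x) = P_map (\<lambda>x. a * f x + b * g x) j x"
      by eventually_elim simp
  qed
  have isP: "jet_of (derivative_family f) f" if "f \<in> sobolev_fun p k \<mu>" for f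
    using that by (simp add: jet_of_def derivative_family_def)
  obtain v where v: "\<And>j. j \<in> {..k} \<Longrightarrow> (\<lambda>x. v (j, x)) \<in> borel_measurable (?M j)"
    "\<And>j f. j \<in> {..k} \<Longrightarrow> f \<in> L_fun (?M j) (ennreal p) \<Longrightarrow> integrable (?M j) (\<lambda>x. f x * v (j, x))"
    "\<And>u. u \<in> W \<Longrightarrow> T' u = fam_pairing {..k} ?M u v"
    "\<And>u. u \<in> ?V \<Longrightarrow> fam_pairing {..k} ?M u v
        \<le> dual_norm p k \<mu> T * fam_power p {..k} ?M u powr (1 / p)"
  proof (rule family_representation[of "{..k}" ?M p "dual_norm p k \<mu> T" W T'])
    show "sigma_finite_measure (?M j)" if "j \<in> {..k}" for j
      using adm that by (intro sigma_finite_on_Delta) (auto simp: p_admissible_def)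
    show "0 \<le> dual_norm p k \<mu> T" by (rule dual_norm_bound(1)[OF p adm T])
    show "W \<subseteq> ?V" by (auto simp: W_def)
    show "fun_space W"
      unfolding fun_space_def
    proof (intro conjI ballI allI)
      have "jet_of (\<lambda>_. 0) (\<lambda>_. 0)" using sobolev_fun_zero[OF p] by (simp add: jet_of_def P_map_zero)
      then show "(\<lambda>_. 0) \<in> W" using fun_spaceD(1)[OF Vsp] by (auto simp: W_def)
      fix u w a b assume "u \<in> W" "w \<in> W"
      then obtain f g where "jet_of u f" "jet_of w g" "u \<in> ?V" "w \<in> ?V" by (auto simp: W_def)
      then show "(\<lambda>y. a * u y + b * w y) \<in> W" using lin fun_spaceD(2)[OF Vsp] unfolding W_def by blast
    qed
    show "linear_on_fun W T'"
      unfolding linear_on_fun_def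
    proof (intro ballI allI)
      fix u w a b assume "u \<in> W" "w \<in> W"
      then obtain f g where fg: "jet_of u f" "jet_of w g" by (auto simp: W_def)
      then have "f \<in> sobolev_fun p k \<mu>" "g \<in> sobolev_fun p k \<mu>" by (auto simp: jet_of_def)
      from sobolev_dual_linear[OF p adm T this]
      show "T' (\<lambda>y. a * u y + b * w y) = a * T' u + b * T' w"
        using T'[OF lin[OF fg]] T'[OF fg(1)] T'[OF fg(2)] by simp
    qed
    fix u assume u: "u \<in> W"
    then obtain f where f: "jet_of u f" by (auto simp: W_def)
    then have fS: "f \<in> sobolev_fun p k \<mu>" by (simp add: jet_of_def)
    have "fam_power p {..k} ?M u = fam_power p {..k} ?M (derivative_family f)"
    proof (rule fam_power_cong_AE)
      fix i assume i: "i \<in> {..k}"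
      show "(\<lambda>x. u (i, x)) \<in> borel_measurable (?M i)" "(\<lambda>x. derivative_family f (i, x)) \<in> borel_measurable (?M i)"
        using u fam_spaceD[OF _ i] derivative_family_in[OF fS] by (auto simp: W_def intro: L_fun_measurable)
      show "AE x in ?M i. u (i, x) = derivative_family f (i, x)" using f i by (simp add: jet_of_def derivative_family_def)
    qed
    then show "\<bar>T' u\<bar> \<le> dual_norm p k \<mu> T * fam_power p {..k} ?M u powr (1 / p)"
      using dual_norm_bound(2)[OF p adm T fS] T'[OF f] by (simp add: sobolev_norm_eq[OF p fS])
  qed (use p in auto)
  show thesis
  proof (rule that[OF v(1,2) _ v(4)])
    fix f assume f: "f \<in> sobolev_fun p k \<mu>"
    have "derivative_family f \<in> W" using isP[OF f] derivative_family_in[OF f] by (auto simp: W_def)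
    from v(3)[OF this] show "T (sobolev_class p k \<mu> f) = (\<Sum>j\<in>{..k}. \<integral>x. P_map f j x * v (j, x) \<partial>(?M j))"
      using T'[OF isP[OF f]] by (simp add: derivative_family_def)
  qed
qed

section \<open>Norms of representing families\<close>

lemma L_norm_nonneg: "0 \<le> L_norm M r f"
  by (simp add: L_norm_def)

lemma prod_norm_nonneg: "0 \<le> prod_norm q k \<mu> g"
proof (cases "q = \<infinity>")
  case True
  have "0 \<le> L_norm (on_Delta k \<mu> 0) \<infinity> (g 0)" by (rule L_norm_nonneg)
  also have "\<dots> \<le> (MAX j\<in>{..k}. L_norm (on_Delta k \<mu> j) \<infinity> (g j))" by (rule Max_ge) auto
  finally show ?thesis using True by (simp add: prod_norm_def)
qed (simp add: prod_norm_def)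

lemma prod_norm_cong_AE:
  assumes "\<And>j. j \<le> k \<Longrightarrow> f j \<in> L_fun (on_Delta k \<mu> j) q" "\<And>j. j \<le> k \<Longrightarrow> g j \<in> L_fun (on_Delta k \<mu> j) q"
    and "\<And>j. j \<le> k \<Longrightarrow> AE x in on_Delta k \<mu> j. f j x = g j x"
  shows "prod_norm q k \<mu> f = prod_norm q k \<mu> g"
proof -
  have "L_norm (on_Delta k \<mu> j) q (f j) = L_norm (on_Delta k \<mu> j) q (g j)" if "j \<le> k" for j
    using assms that by (intro L_norm_cong_AE) auto
  then have "(\<lambda>j. L_norm (on_Delta k \<mu> j) q (f j)) ` {..k} = (\<lambda>j. L_norm (on_Delta k \<mu> j) q (g j)) ` {..k}"
    "(\<Sum>j\<le>k. L_norm (on_Delta k \<mu> j) q (f j) powr enn2real q)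
      = (\<Sum>j\<le>k. L_norm (on_Delta k \<mu> j) q (g j) powr enn2real q)"
    by (intro image_cong sum.cong; simp)+
  then show ?thesis unfolding prod_norm_def by (simp only:)
qed

lemma pairing_integrable_bound:
  assumes pq: "conjugate_exponents p q" and u: "u \<in> fam_space p {..k} (on_Delta k \<mu>)"
    and v: "\<And>j. j \<le> k \<Longrightarrow> v j \<in> L_fun (on_Delta k \<mu> j) q"
  shows "j \<le> k \<Longrightarrow> integrable (on_Delta k \<mu> j) (\<lambda>x. u (j, x) * v j x)"
    and "\<bar>\<Sum>j\<le>k. \<integral>x. u (j, x) * v j x \<partial>(on_Delta k \<mu> j)\<bar>
      \<le> fam_power p {..k} (on_Delta k \<mu>) u powr (1 / p) * prod_norm q k \<mu> v"
proof -
  let ?M = "on_Delta k \<mu>"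
  have uj: "(\<lambda>x. u (j, x)) \<in> L_fun (?M j) (ennreal p)" if "j \<le> k" for j
    using fam_spaceD[OF u, of j] that by simp
  have "(\<forall>j\<le>k. integrable (?M j) (\<lambda>x. u (j, x) * v j x)) \<and>
    \<bar>\<Sum>j\<le>k. \<integral>x. u (j, x) * v j x \<partial>(?M j)\<bar> \<le> fam_power p {..k} ?M u powr (1 / p) * prod_norm q k \<mu> v"
  proof (cases "p = 1")
    case True
    then have q: "q = \<infinity>" using pq by (simp add: conjugate_exponents_def)
    have int1: "integrable (?M j) (\<lambda>x. \<bar>u (j, x)\<bar>)" if "j \<le> k" for j
      using uj[OF that] True L_fun_real_iff[of 1 "\<lambda>x. u (j, x)" "?M j"] by simp
    have vj: "AE x in ?M j. \<bar>v j x\<bar> \<le> L_norm (?M j) \<infinity> (v j)" if "j \<le> k" for j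
      using AE_le_L_norm_inf v[OF that] q by blast
    have le: "AE x in ?M j. \<bar>u (j, x) * v j x\<bar> \<le> \<bar>u (j, x)\<bar> * L_norm (?M j) \<infinity> (v j)" if "j \<le> k" for j
      using vj[OF that] by eventually_elim (simp add: abs_mult mult_left_mono)
    have int: "integrable (?M j) (\<lambda>x. u (j, x) * v j x)" if j: "j \<le> k" for j
    proof (rule Bochner_Integration.integrable_bound)
      note [measurable] = L_fun_measurable[OF uj[OF j]] L_fun_measurable[OF v[OF j]]
      show "integrable (?M j) (\<lambda>x. \<bar>u (j, x)\<bar> * L_norm (?M j) \<infinity> (v j))" using int1[OF j] by simp
      show "(\<lambda>x. u (j, x) * v j x) \<in> borel_measurable (?M j)" by measurable
      show "AE x in ?M j. norm (u (j, x) * v j x) \<le> norm (\<bar>u (j, x)\<bar> * L_norm (?M j) \<infinity> (v j))"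
        using le[OF j] by eventually_elim (simp add: L_norm_nonneg abs_mult)
    qed
    have "\<bar>\<Sum>j\<le>k. \<integral>x. u (j, x) * v j x \<partial>(?M j)\<bar> \<le> (\<Sum>j\<le>k. \<bar>\<integral>x. u (j, x) * v j x \<partial>(?M j)\<bar>)" by (rule sum_abs)
    also have "\<dots> \<le> (\<Sum>j\<le>k. (\<integral>x. \<bar>u (j, x)\<bar> \<partial>(?M j)) * prod_norm q k \<mu> v)"
    proof (rule sum_mono)
      fix j assume "j \<in> {..k}"
      then have j: "j \<le> k" by simp
      have "\<bar>\<integral>x. u (j, x) * v j x \<partial>(?M j)\<bar> \<le> (\<integral>x. \<bar>u (j, x) * v j x\<bar> \<partial>(?M j))" by (rule integral_abs_bound)
      also have "\<dots> \<le> (\<integral>x. \<bar>u (j, x)\<bar> * L_norm (?M j) \<infinity> (v j) \<partial>(?M j))"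
        using int[OF j] int1[OF j] le[OF j] by (intro integral_mono_AE) auto
      also have "\<dots> = (\<integral>x. \<bar>u (j, x)\<bar> \<partial>(?M j)) * L_norm (?M j) \<infinity> (v j)" by simp
      also have "\<dots> \<le> (\<integral>x. \<bar>u (j, x)\<bar> \<partial>(?M j)) * prod_norm q k \<mu> v"
        using j q by (intro mult_left_mono integral_nonneg_AE) (auto simp: prod_norm_def intro!: Max_ge)
      finally show "\<bar>\<integral>x. u (j, x) * v j x \<partial>(?M j)\<bar> \<le> (\<integral>x. \<bar>u (j, x)\<bar> \<partial>(?M j)) * prod_norm q k \<mu> v" .
    qed
    also have "\<dots> = fam_power p {..k} ?M u powr (1 / p) * prod_norm q k \<mu> v"
    proof -
      have "fam_power p {..k} ?M u = (\<Sum>j\<le>k. \<integral>x. \<bar>u (j, x)\<bar> \<partial>(?M j))"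
        using True by (simp add: fam_power_def)
      moreover have "fam_power p {..k} ?M u powr (1 / p) = fam_power p {..k} ?M u"
        using True fam_power_nonneg[of p "{..k}" ?M u] by simp
      ultimately show ?thesis by (simp add: sum_distrib_right)
    qed
    finally show ?thesis using int by blast
  next
    case False
    define r where "r = p / (p - 1)"
    have p: "p > 1" and q: "q = ennreal r" using pq False by (auto simp: conjugate_exponents_def r_def)
    have r: "r \<ge> 1" unfolding r_def using p by (simp add: le_divide_eq)
    have vr: "v j \<in> L_fun (?M j) (ennreal r)" if "j \<le> k" for j using v[OF that] q by simp
    then have vf: "(\<lambda>(j, x). v j x) \<in> fam_space r {..k} ?M" by (simp add: fam_space_def)
    have "prod_norm q k \<mu> v = fam_power r {..k} ?M (\<lambda>(j, x). v j x) powr (1 / r)"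
      unfolding q by (rule prod_norm_eq[OF r vr])
    then show ?thesis
      using fam_Holder[OF p r_def u vf] Young_integral(1)[OF p r_def uj vr] by simp
  qed
  then show "j \<le> k \<Longrightarrow> integrable (?M j) (\<lambda>x. u (j, x) * v j x)"
    and "\<bar>\<Sum>j\<le>k. \<integral>x. u (j, x) * v j x \<partial>(?M j)\<bar> \<le> fam_power p {..k} ?M u powr (1 / p) * prod_norm q k \<mu> v"
    by blast+
qed

text \<open>The bound is first tested on families supported on one index, which places every component in \<open>L\<^sup>q\<close>
and settles \<open>p = 1\<close>, where the norm is a maximum over indices. For \<open>p > 1\<close> the extremal family of all
components at once is then available.\<close>

lemma prod_norm_le_of_dual_bound:
  assumes pq: "conjugate_exponents p q" and adm: "p_admissible p k \<mu>" and D: "D \<ge> 0"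
    and v: "\<And>j. j \<in> {..k} \<Longrightarrow> (\<lambda>x. v (j, x)) \<in> borel_measurable (on_Delta k \<mu> j)"
    and int: "\<And>j f. j \<in> {..k} \<Longrightarrow> f \<in> L_fun (on_Delta k \<mu> j) (ennreal p) \<Longrightarrow> integrable (on_Delta k \<mu> j) (\<lambda>x. f x * v (j, x))"
    and bd: "\<And>u. u \<in> fam_space p {..k} (on_Delta k \<mu>) \<Longrightarrow> fam_pairing {..k} (on_Delta k \<mu>) u v
      \<le> D * fam_power p {..k} (on_Delta k \<mu>) u powr (1 / p)"
  shows "j \<le> k \<Longrightarrow> (\<lambda>x. v (j, x)) \<in> L_fun (on_Delta k \<mu> j) q"
    and "prod_norm q k \<mu> (\<lambda>j x. v (j, x)) \<le> D"
proof -
  let ?M = "on_Delta k \<mu>"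
  note p = conjugate_exponents_ge_1[OF pq]
  then have p0: "p > 0" by simp
  have sf: "sigma_finite_measure (?M j)" if "j \<le> k" for j
    using adm that by (intro sigma_finite_on_Delta) (auto simp: p_admissible_def)
  have comp: "integrable (?M j) (\<lambda>x. f x * v (j, x)) \<and>
      (\<integral>x. f x * v (j, x) \<partial>(?M j)) \<le> D * (\<integral>x. \<bar>f x\<bar> powr p \<partial>(?M j)) powr (1 / p)"
    if j: "j \<le> k" and f: "f \<in> L_fun (?M j) (ennreal p)" for j f
  proof
    show "integrable (?M j) (\<lambda>x. f x * v (j, x))" using int j f by simp
    define e where "e = (\<lambda>(i, x). if i = j then f x else 0)"
    have eV: "e \<in> fam_space p {..k} ?M"
      unfolding fam_space_def
    proof (intro CollectI ballI)
      fix i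
      show "(\<lambda>x. e (i, x)) \<in> L_fun (?M i) (ennreal p)"
        by (cases "i = j") (simp_all add: e_def f fun_spaceD(1)[OF fun_space_L_fun[OF p0]])
    qed
    have "fam_pairing {..k} ?M e v = (\<Sum>i\<in>{..k}. if i = j then \<integral>x. f x * v (j, x) \<partial>(?M j) else 0)"
      by (rule sum.cong) (auto simp: e_def)
    moreover have "fam_power p {..k} ?M e = (\<Sum>i\<in>{..k}. if i = j then \<integral>x. \<bar>f x\<bar> powr p \<partial>(?M j) else 0)"
      unfolding fam_power_def by (rule sum.cong) (auto simp: e_def)
    ultimately show "(\<integral>x. f x * v (j, x) \<partial>(?M j)) \<le> D * (\<integral>x. \<bar>f x\<bar> powr p \<partial>(?M j)) powr (1 / p)"
      using bd[OF eV] j by simp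
  qed
  have "(\<forall>j\<le>k. (\<lambda>x. v (j, x)) \<in> L_fun (?M j) q) \<and> prod_norm q k \<mu> (\<lambda>j x. v (j, x)) \<le> D"
  proof (cases "p = 1")
    case True
    then have q: "q = \<infinity>" using pq by (simp add: conjugate_exponents_def)
    have ae: "AE x in ?M j. \<bar>v (j, x)\<bar> \<le> D" if j: "j \<le> k" for j
    proof (rule dual_exponent_bounded[OF sf[OF j] _ D])
      show "(\<lambda>x. v (j, x)) \<in> borel_measurable (?M j)" using v j by simp
      fix f assume "f \<in> L_fun (?M j) (ennreal 1)"
      then have "f \<in> L_fun (?M j) (ennreal p)" using True by simp
      from comp[OF j this] show "integrable (?M j) (\<lambda>x. f x * v (j, x)) \<and>
          (\<integral>x. f x * v (j, x) \<partial>(?M j)) \<le> D * (\<integral>x. \<bar>f x\<bar> \<partial>(?M j))"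
        using True by simp
    qed
    have "(\<lambda>x. v (j, x)) \<in> L_fun (?M j) \<infinity> \<and> L_norm (?M j) \<infinity> (\<lambda>x. v (j, x)) \<le> D" if j: "j \<le> k" for j
      using L_fun_inf[OF _ ae[OF j] D] v j by simp
    then show ?thesis using q by (auto simp: prod_norm_def)
  next
    case False
    define r where "r = p / (p - 1)"
    have p1: "p > 1" and q: "q = ennreal r" using pq False by (auto simp: conjugate_exponents_def r_def)
    have r: "r \<ge> 1" unfolding r_def using p1 by (simp add: le_divide_eq)
    have vr: "(\<lambda>x. v (j, x)) \<in> L_fun (?M j) (ennreal r)" if j: "j \<le> k" for j
    proof -
      have m: "(\<lambda>x. v (j, x)) \<in> borel_measurable (?M j)" using v j by simp
      have "integrable (?M j) (\<lambda>x. \<bar>v (j, x)\<bar> powr r)"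
        by (rule dual_exponent_integrable[OF sf[OF j] p1 r_def m D comp[OF j]])
      then show ?thesis using m r by (simp add: L_fun_real_iff)
    qed
    then have vf: "v \<in> fam_space r {..k} ?M" by (simp add: fam_space_def)
    have "prod_norm q k \<mu> (\<lambda>j x. v (j, x)) = fam_power r {..k} ?M (\<lambda>(j, x). v (j, x)) powr (1 / r)"
      unfolding q by (rule prod_norm_eq[OF r vr])
    also have "\<dots> \<le> D" using fam_dual_norm_le[OF p1 r_def D vf bd] by simp
    finally show ?thesis using vr q by simp
  qed
  then show "j \<le> k \<Longrightarrow> (\<lambda>x. v (j, x)) \<in> L_fun (?M j) q" and "prod_norm q k \<mu> (\<lambda>j x. v (j, x)) \<le> D"
    by blast+
qed

lemma dual_norm_le_prod_norm:
  assumes pq: "conjugate_exponents p q" and adm: "p_admissible p k \<mu>"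
    and w: "\<And>j. j \<le> k \<Longrightarrow> w j \<in> L_fun (on_Delta k \<mu> j) q"
    and T: "\<And>F. F \<in> sobolev_space p k \<mu> \<Longrightarrow> T F = pairing k \<mu> (P_map (rep F)) w"
  shows "dual_norm p k \<mu> T \<le> prod_norm q k \<mu> w"
  unfolding dual_norm_def
proof (rule cSUP_least)
  note p = conjugate_exponents_ge_1[OF pq]
  have z: "(\<lambda>_. 0) \<in> sobolev_fun p k \<mu>" by (rule sobolev_fun_zero[OF p])
  have "sobolev_norm p k \<mu> (\<lambda>_. 0) = 0" using sobolev_norm_scale(2)[OF p adm z, of 0] by simp
  then have "sobolev_class p k \<mu> (\<lambda>_. 0) \<in> {F \<in> sobolev_space p k \<mu>. sobolev_norm p k \<mu> (rep F) \<le> 1}"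
    using z rep_sobolev_class(3)[OF p adm z] by (auto simp: sobolev_space_eq)
  then show "{F \<in> sobolev_space p k \<mu>. sobolev_norm p k \<mu> (rep F) \<le> 1} \<noteq> {}" by blast
  fix F assume F: "F \<in> {F \<in> sobolev_space p k \<mu>. sobolev_norm p k \<mu> (rep F) \<le> 1}"
  then have r: "rep F \<in> sobolev_fun p k \<mu>" using sobolev_space_rep(1)[OF p adm] by simp
  have "T F = (\<Sum>j\<le>k. \<integral>x. derivative_family (rep F) (j, x) * w j x \<partial>(on_Delta k \<mu> j))"
    using T F by (simp add: pairing_def derivative_family_def)
  then have "\<bar>T F\<bar> \<le> sobolev_norm p k \<mu> (rep F) * prod_norm q k \<mu> w"
    using pairing_integrable_bound(2)[OF pq derivative_family_in[OF r] w] by (simp add: sobolev_norm_eq[OF p r])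
  also have "\<dots> \<le> 1 * prod_norm q k \<mu> w" using F by (intro mult_right_mono prod_norm_nonneg) auto
  finally show "\<bar>T F\<bar> \<le> prod_norm q k \<mu> w" by simp
qed

lemma representation_exists:
  assumes pq: "conjugate_exponents p q" and adm: "p_admissible p k \<mu>" and T: "T \<in> sobolev_dual p k \<mu>"
  shows "\<exists>v \<in> prod_space q k \<mu>. (\<forall>F \<in> sobolev_space p k \<mu>. T F = J_map k \<mu> v F) \<and>
       dual_norm p k \<mu> T = prod_norm q k \<mu> (\<lambda>j. rep (v j))"
proof -
  let ?M = "on_Delta k \<mu>"
  note p = conjugate_exponents_ge_1[OF pq]
  obtain w where w: "\<And>j. j \<in> {..k} \<Longrightarrow> (\<lambda>x. w (j, x)) \<in> borel_measurable (?M j)"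
    "\<And>j f. j \<in> {..k} \<Longrightarrow> f \<in> L_fun (?M j) (ennreal p) \<Longrightarrow> integrable (?M j) (\<lambda>x. f x * w (j, x))"
    "\<And>f. f \<in> sobolev_fun p k \<mu> \<Longrightarrow> T (sobolev_class p k \<mu> f) = (\<Sum>j\<in>{..k}. \<integral>x. P_map f j x * w (j, x) \<partial>(?M j))"
    "\<And>u. u \<in> fam_space p {..k} ?M \<Longrightarrow> fam_pairing {..k} ?M u w
      \<le> dual_norm p k \<mu> T * fam_power p {..k} ?M u powr (1 / p)"
    using sobolev_dual_representation[OF p adm T] by blast
  note D0 = dual_norm_bound(1)[OF p adm T]
  have wL: "(\<lambda>x. w (j, x)) \<in> L_fun (?M j) q" if "j \<le> k" for j
    by (rule prod_norm_le_of_dual_bound(1)[OF pq adm D0 w(1,2,4) that])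
  have wN: "prod_norm q k \<mu> (\<lambda>j x. w (j, x)) \<le> dual_norm p k \<mu> T"
    by (rule prod_norm_le_of_dual_bound(2)[OF pq adm D0 w(1,2,4)])
  define v where "v = (\<lambda>j\<in>{..k}. L_class (?M j) q (\<lambda>x. w (j, x)))"
  have vP: "v \<in> prod_space q k \<mu>"
    unfolding prod_space_def v_def L_space_eq restrict_PiE_iff by (intro ballI imageI wL) simp_all
  have rv: "rep (v j) \<in> L_fun (?M j) q" "AE x in ?M j. w (j, x) = rep (v j) x" if "j \<le> k" for j
    using rep_L_class[OF wL[OF that]] that by (simp_all add: v_def)
  have TJ: "T F = J_map k \<mu> v F" if F: "F \<in> sobolev_space p k \<mu>" for F
  proof -
    note r = sobolev_space_rep[OF p adm F]
    have "T F = T (sobolev_class p k \<mu> (rep F))" using r(2) by (rule arg_cong)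
    also have "\<dots> = (\<Sum>j\<le>k. \<integral>x. P_map (rep F) j x * w (j, x) \<partial>(?M j))" by (rule w(3)[OF r(1)])
    also have "\<dots> = (\<Sum>j\<le>k. \<integral>x. P_map (rep F) j x * rep (v j) x \<partial>(?M j))"
    proof (rule sum.cong[OF refl])
      fix j assume "j \<in> {..k}"
      then have j: "j \<le> k" by simp
      have "P_map (rep F) j \<in> borel_measurable (?M j)"
        using r(1) j by (auto simp: sobolev_fun_def dest: L_fun_measurable)
      note [measurable] = this w(1)[OF \<open>j \<in> {..k}\<close>] L_fun_measurable[OF rv(1)[OF j]]
      show "(\<integral>x. P_map (rep F) j x * w (j, x) \<partial>(?M j)) = (\<integral>x. P_map (rep F) j x * rep (v j) x \<partial>(?M j))"
      proof (rule integral_cong_AE)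
        show "AE x in ?M j. P_map (rep F) j x * w (j, x) = P_map (rep F) j x * rep (v j) x"
          using rv(2)[OF j] by eventually_elim simp
      qed measurable
    qed
    finally show ?thesis by (simp add: J_map_def pairing_def)
  qed
  have "prod_norm q k \<mu> (\<lambda>j. rep (v j)) = prod_norm q k \<mu> (\<lambda>j x. w (j, x))"
    by (rule prod_norm_cong_AE[symmetric, OF wL rv])
  then have "prod_norm q k \<mu> (\<lambda>j. rep (v j)) \<le> dual_norm p k \<mu> T" using wN by simp
  moreover have "dual_norm p k \<mu> T \<le> prod_norm q k \<mu> (\<lambda>j. rep (v j))"
    using TJ by (intro dual_norm_le_prod_norm[OF pq adm rv(1)]) (auto simp: J_map_def)
  ultimately show ?thesis using vP TJ by (intro bexI[OF _ vP]) auto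
qed

text \<open>The midpoint of two representatives represents \<open>T\<close> as well, so its norm is at least \<open>\<parallel>T\<parallel>\<close>, the common
norm of both; strict convexity forces equality almost everywhere.\<close>

lemma representation_unique:
  assumes p: "p > 1" and q: "q = ennreal (p / (p - 1))" and adm: "p_admissible p k \<mu>"
    and v: "v \<in> prod_space q k \<mu>" "\<And>F. F \<in> sobolev_space p k \<mu> \<Longrightarrow> T F = J_map k \<mu> v F"
      "dual_norm p k \<mu> T = prod_norm q k \<mu> (\<lambda>j. rep (v j))"
    and v': "v' \<in> prod_space q k \<mu>" "\<And>F. F \<in> sobolev_space p k \<mu> \<Longrightarrow> T F = J_map k \<mu> v' F"
      "dual_norm p k \<mu> T = prod_norm q k \<mu> (\<lambda>j. rep (v' j))"
  shows "v = v'"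
proof -
  let ?M = "on_Delta k \<mu>"
  define r where "r = p / (p - 1)"
  have pq: "conjugate_exponents p q" using p q by (simp add: conjugate_exponents_def)
  have p1: "p \<ge> 1" using p by simp
  have r: "r > 1" unfolding r_def using p by (simp add: less_divide_eq)
  then have r1: "r \<ge> 1" and r0: "r > 0" by auto
  have qr: "q = ennreal r" by (simp add: q r_def)
  have Lv: "v j \<in> L_space (?M j) q" "v' j \<in> L_space (?M j) q" if "j \<le> k" for j
    using v(1) v'(1) that by (auto simp: prod_space_def)
  have R: "rep (v j) \<in> L_fun (?M j) q" "rep (v' j) \<in> L_fun (?M j) q" if "j \<le> k" for j
    using L_space_rep(1) Lv[OF that] by blast+
  define V where "V = (\<lambda>(j, x). rep (v j) x)"
  define V' where "V' = (\<lambda>(j, x). rep (v' j) x)"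
  define m where "m j x = (rep (v j) x + rep (v' j) x) / 2" for j x
  have VS: "V \<in> fam_space r {..k} ?M" "V' \<in> fam_space r {..k} ?M"
    using R qr by (simp_all add: V_def V'_def fam_space_def)
  have mL: "m j \<in> L_fun (?M j) q" if j: "j \<le> k" for j
  proof -
    have "(\<lambda>x. (1 / 2) * rep (v j) x + (1 / 2) * rep (v' j) x) \<in> L_fun (?M j) q"
      using R[OF j] unfolding qr by (rule fun_spaceD(2)[OF fun_space_L_fun[OF r0]])
    moreover have "(\<lambda>x. (1 / 2) * rep (v j) x + (1 / 2) * rep (v' j) x) = m j" by (auto simp: m_def)
    ultimately show ?thesis by simp
  qed
  have Tm: "T F = pairing k \<mu> (P_map (rep F)) m" if F: "F \<in> sobolev_space p k \<mu>" for F
  proof -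
    have u: "derivative_family (rep F) \<in> fam_space p {..k} ?M"
      by (rule derivative_family_in[OF sobolev_space_rep(1)[OF p1 adm F]])
    have half: "(\<integral>x. P_map (rep F) j x * m j x \<partial>(?M j))
        = ((\<integral>x. P_map (rep F) j x * rep (v j) x \<partial>(?M j)) + (\<integral>x. P_map (rep F) j x * rep (v' j) x \<partial>(?M j))) / 2"
      if "j \<in> {..k}" for j
    proof -
      have j: "j \<le> k" using that by simp
      have i: "integrable (?M j) (\<lambda>x. P_map (rep F) j x * rep (v j) x)" "integrable (?M j) (\<lambda>x. P_map (rep F) j x * rep (v' j) x)"
        using pairing_integrable_bound(1)[OF pq u R(1) j] pairing_integrable_bound(1)[OF pq u R(2) j]
        by (simp_all add: derivative_family_def)
      have "(\<integral>x. P_map (rep F) j x * m j x \<partial>(?M j))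
          = (\<integral>x. (P_map (rep F) j x * rep (v j) x + P_map (rep F) j x * rep (v' j) x) / 2 \<partial>(?M j))"
        by (simp add: m_def distrib_left)
      also have "\<dots> = ((\<integral>x. P_map (rep F) j x * rep (v j) x \<partial>(?M j)) + (\<integral>x. P_map (rep F) j x * rep (v' j) x \<partial>(?M j))) / 2"
        using i by simp
      finally show ?thesis .
    qed
    have "pairing k \<mu> (P_map (rep F)) m = (J_map k \<mu> v F + J_map k \<mu> v' F) / 2"
      unfolding pairing_def J_map_def sum.distrib[symmetric] sum_divide_distrib
      by (rule sum.cong[OF refl half])
    then show ?thesis using v(2)[OF F] v'(2)[OF F] by simp
  qed
  have low: "dual_norm p k \<mu> T \<le> prod_norm q k \<mu> m"
    by (rule dual_norm_le_prod_norm[OF pq adm mL Tm])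
  have N: "prod_norm q k \<mu> (\<lambda>j. rep (v j)) = fam_power r {..k} ?M V powr (1 / r)"
    "prod_norm q k \<mu> (\<lambda>j. rep (v' j)) = fam_power r {..k} ?M V' powr (1 / r)"
    "prod_norm q k \<mu> m = fam_power r {..k} ?M (\<lambda>(j, x). m j x) powr (1 / r)"
    unfolding qr V_def V'_def using R mL by (auto intro!: prod_norm_eq[OF r1] simp: qr)
  have root: "a = b" if "a powr (1 / r) = b powr (1 / r)" "0 \<le> a" "0 \<le> b" for a b :: real
  proof -
    have "(a powr (1 / r)) powr r = (b powr (1 / r)) powr r" using that(1) by simp
    then show ?thesis using that(2,3) r0 by (simp add: powr_powr)
  qed
  have eq: "fam_power r {..k} ?M V' = fam_power r {..k} ?M V"
    by (rule root[OF _ fam_power_nonneg fam_power_nonneg]) (use v(3) v'(3) N(1,2) in simp)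
  have "fam_power r {..k} ?M V powr (1 / r) \<le> fam_power r {..k} ?M (\<lambda>(j, x). m j x) powr (1 / r)"
    using low v(3) N(1,3) by simp
  then have "(fam_power r {..k} ?M V powr (1 / r)) powr r \<le> (fam_power r {..k} ?M (\<lambda>(j, x). m j x) powr (1 / r)) powr r"
    by (rule powr_mono2[rotated 2]) (use r0 in simp_all)
  then have "fam_power r {..k} ?M V \<le> fam_power r {..k} ?M (\<lambda>(j, x). m j x)"
    using r0 by (simp add: powr_powr fam_power_nonneg)
  also have "(\<lambda>(j, x). m j x) = (\<lambda>y. (V y + V' y) / 2)" by (auto simp: m_def V_def V'_def)
  finally have mid: "fam_power r {..k} ?M V \<le> fam_power r {..k} ?M (\<lambda>y. (V y + V' y) / 2)" .
  have ae: "AE x in ?M j. rep (v j) x = rep (v' j) x" if "j \<le> k" for j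
    using fam_strict_convexity[OF finite_atMost r VS refl eq mid, of j] that by (simp add: V_def V'_def)
  show "v = v'"
  proof (rule PiE_ext[of v "{..k}" "\<lambda>j. L_space (?M j) q" v'])
    show "v \<in> (\<Pi>\<^sub>E j\<in>{..k}. L_space (?M j) q)" "v' \<in> (\<Pi>\<^sub>E j\<in>{..k}. L_space (?M j) q)"
      using v(1) v'(1) by (simp_all add: prod_space_def)
    fix j assume "j \<in> {..k}"
    then have j: "j \<le> k" by simp
    have "v j = L_class (?M j) q (rep (v j))" by (rule L_space_rep(2)[OF Lv(1)[OF j]])
    also have "\<dots> = L_class (?M j) q (rep (v' j))" by (rule L_class_eq[OF ae[OF j]])
    also have "\<dots> = v' j" by (rule L_space_rep(2)[OF Lv(2)[OF j], symmetric])
    finally show "v j = v' j" .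
  qed
qed

theorem theorem4p3:
  fixes p :: real and q :: ennreal and k :: nat and \<mu> :: "nat \<Rightarrow> real measure"
  assumes "1 \<le> p"
    and "1 / ennreal p + 1 / q = 1"
    and "p_admissible p k \<mu>"
  shows "\<forall>T \<in> sobolev_dual p k \<mu>.
    (\<exists>v \<in> prod_space q k \<mu>.
       (\<forall>F \<in> sobolev_space p k \<mu>. T F = J_map k \<mu> v F) \<and>
       dual_norm p k \<mu> T = prod_norm q k \<mu> (\<lambda>j. rep (v j))) \<and>
    (1 < p \<longrightarrow>
      (\<exists>!v. v \<in> prod_space q k \<mu> \<and>
         (\<forall>F \<in> sobolev_space p k \<mu>. T F = J_map k \<mu> v F) \<and>
         dual_norm p k \<mu> T = prod_norm q k \<mu> (\<lambda>j. rep (v j))))"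
proof (intro ballI conjI impI)
  fix T assume T: "T \<in> sobolev_dual p k \<mu>"
  have pq: "conjugate_exponents p q" by (rule conjugate_exponents_of_sum[OF assms(1,2)])
  show ex: "\<exists>v \<in> prod_space q k \<mu>. (\<forall>F \<in> sobolev_space p k \<mu>. T F = J_map k \<mu> v F) \<and>
       dual_norm p k \<mu> T = prod_norm q k \<mu> (\<lambda>j. rep (v j))"
    by (rule representation_exists[OF pq assms(3) T])
  assume p: "1 < p"
  then have q: "q = ennreal (p / (p - 1))" using pq by (simp add: conjugate_exponents_def)
  show "\<exists>!v. v \<in> prod_space q k \<mu> \<and> (\<forall>F \<in> sobolev_space p k \<mu>. T F = J_map k \<mu> v F) \<and>
         dual_norm p k \<mu> T = prod_norm q k \<mu> (\<lambda>j. rep (v j))"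
  proof (rule ex_ex1I)
    show "\<exists>v. v \<in> prod_space q k \<mu> \<and> (\<forall>F \<in> sobolev_space p k \<mu>. T F = J_map k \<mu> v F) \<and>
         dual_norm p k \<mu> T = prod_norm q k \<mu> (\<lambda>j. rep (v j))"
      using ex by blast
    fix v v'
    assume "v \<in> prod_space q k \<mu> \<and> (\<forall>F \<in> sobolev_space p k \<mu>. T F = J_map k \<mu> v F) \<and>
         dual_norm p k \<mu> T = prod_norm q k \<mu> (\<lambda>j. rep (v j))"
      and "v' \<in> prod_space q k \<mu> \<and> (\<forall>F \<in> sobolev_space p k \<mu>. T F = J_map k \<mu> v' F) \<and>
         dual_norm p k \<mu> T = prod_norm q k \<mu> (\<lambda>j. rep (v' j))"
    then show "v = v'" by - (rule representation_unique[OF p q assms(3), of v T v'], blast+)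
  qed
qed

end
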